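(* Let $c\ge0$ and $\kappa\in\mathbb{R}$. Assume that $u\in\mathcal{X}(\mathbb{R})$ is a weak solution to $\mathrm{TW}(c,\kappa)$. If $(c,\kappa)\notin\tilde{\mathcal{D}}\cup\mathcal{C}$, then either $(c,\kappa)\in\mathcal{D}_2$ and $u\in C^2(\mathbb{R})$, so that $u$ is, up to a translation and multiplication by a constant phase, the dark soliton $u_{c,\kappa}$ given explicitly in the context; or $u$ is a constant function of modulus one.
   Context: For $z_1,z_2\in\mathbb{C}$, $\langle z_1,z_2\rangle=\operatorname{Re}(z_1\overline{z_2})$. Energy space: $\mathcal{X}(\mathbb{R})=\{v\in H^1_{\mathrm{loc}}(\mathbb{R};\mathbb{C}): 1-|v|^2\in L^2(\mathbb{R}),\ v'\in L^2(\mathbb{R})\}$. $\mathrm{TW}(c,\kappa)$ is the equation $icu'+u''+u(1-|u|^2)+\kappa u(1-|u|^2)''=0$. A function $u\in\mathcal{X}(\mathbb{R})$ is a weak solution if for all $\phi\in C_0^\infty(\mathbb{R};\mathbb{C})$, $$\int_{\mathbb{R}}\langle icu'+u(1-|u|^2),\phi\rangle-\langle u',\phi'\rangle+2\kappa\langle u,u'\rangle\langle u,\phi\rangle'=0.$$ Parameter sets (with $c\ge0$): $\mathcal{D}_1=\{0\le c<\sqrt2,\ 0<\kappa<1/2\}$, $\mathcal{D}_2=\{0\le c<\sqrt2,\ \kappa\le0\}$, $\mathcal{D}_3=\{c>\sqrt2,\ \kappa>1/2\}$, $\mathcal{B}_-=\{c=\sqrt2,\ 0<\kappa<1/2\}$,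 $\mathcal{B}_+=\{c=\sqrt2,\ \kappa>1/2\}$, $\tilde{\mathcal{D}}=\mathcal{D}_1\cup\mathcal{D}_3\cup\mathcal{B}_-\cup\mathcal{B}_+$, $\mathcal{C}=\{c\ge0,\ \kappa=1/2\}$. Dark soliton for $(c,\kappa)\in\mathcal{D}_2$: the function $G_{c,\kappa}:(0,1-c^2/2]\to[0,\infty)$, $$G_{c,\kappa}(y)=-2\sqrt{-\kappa}\operatorname{artanh}\Big(\sqrt{-\kappa}\sqrt{\tfrac{2-c^2-2y}{1-2\kappa+2\kappa y}}\Big)+2\sqrt{\tfrac{1-2\kappa}{2-c^2}}\operatorname{artanh}\Big(\sqrt{\tfrac{(1-2\kappa)(2-c^2-2y)}{(2-c^2)(1-2\kappa+2\kappa y)}}\Big),$$ is a decreasing bijection; let $\eta_{c,\kappa}=\mathcal{G}_{c,\kappa}$ be its inverse extended to $\mathbb{R}$ as an even function. If $c>0$, $u_{c,\kappa}=\sqrt{1-\eta_{c,\kappa}}\,e^{i\theta_{c,\kappa}}$ with $\theta_{c,\kappa}(x)=\frac c2\int_0^x\frac{\eta_{c,\kappa}(y)}{1-\eta_{c,\kappa}(y)}dy$; if $c=0$, $u_{0,\kappa}(x)=\pm\sqrt{1-\eta_{0,\kappa}(x)}$ for $\pm x\ge0$. *)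

theory Defs
  imports "HOL-Analysis.Analysis"
begin

text \<open>
  Elements of Lebesgue and Sobolev spaces are represented by functions \<open>real \<Rightarrow> 'a\<close>; statements about
  them are meant up to equality almost everywhere.
\<close>

subsection \<open>Functions of class \<open>C\<^sup>k\<close> and test functions\<close>

definition nth_vderiv :: "nat \<Rightarrow> (real \<Rightarrow> 'a) \<Rightarrow> real \<Rightarrow> 'a::real_normed_vector" where
  "nth_vderiv n f = ((\<lambda>g x. vector_derivative g (at x)) ^^ n) f"

definition C_k :: "nat \<Rightarrow> (real \<Rightarrow> 'a::real_normed_vector) \<Rightarrow> bool" where
  "C_k k f \<longleftrightarrow>
     (\<forall>j<k. \<forall>x. nth_vderiv j f differentiable (at x)) \<and> continuous_on UNIV (nth_vderiv k f)"

definition test_functions :: "(real \<Rightarrow> 'a::real_normed_vector) set" where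
  "test_functions = {\<phi>. (\<forall>k. C_k k \<phi>) \<and> compact (closure {x. \<phi> x \<noteq> 0})}"

subsection \<open>Weak derivatives and function spaces\<close>

definition locally_integrable ::
    "(real \<Rightarrow> 'a::{banach, second_countable_topology}) \<Rightarrow> bool" where
  "locally_integrable f \<longleftrightarrow> (\<forall>K. compact K \<longrightarrow> set_integrable lebesgue K f)"

definition is_weak_deriv ::
    "(real \<Rightarrow> 'a::{banach, second_countable_topology}) \<Rightarrow> (real \<Rightarrow> 'a) \<Rightarrow> bool" where
  "is_weak_deriv f g \<longleftrightarrow> locally_integrable f \<and> locally_integrable g \<and>
     (\<forall>\<psi>::real \<Rightarrow> real. \<psi> \<in> test_functions \<longrightarrow>
        (LINT x|lebesgue. vector_derivative \<psi> (at x) *\<^sub>R f x) = - (LINT x|lebesgue. \<psi> x *\<^sub>R g x))"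

text \<open>
  Weak derivatives are unique up to null sets, so the choice below is immaterial whenever \<open>f\<close> is
  weakly differentiable; otherwise the value is unspecified.
\<close>

definition weak_deriv ::
    "(real \<Rightarrow> 'a) \<Rightarrow> real \<Rightarrow> 'a::{banach, second_countable_topology}" where
  "weak_deriv f = (SOME g. is_weak_deriv f g)"

definition L2 :: "(real \<Rightarrow> 'a::real_normed_vector) set" where
  "L2 = {f. f \<in> borel_measurable lebesgue \<and> integrable lebesgue (\<lambda>x. (norm (f x))\<^sup>2)}"

definition L2_loc :: "(real \<Rightarrow> 'a::real_normed_vector) set" where
  "L2_loc = {f. f \<in> borel_measurable lebesgue \<and>
     (\<forall>K. compact K \<longrightarrow> set_integrable lebesgue K (\<lambda>x. (norm (f x))\<^sup>2))}"

definition H1_loc :: "(real \<Rightarrow> complex) set" where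
  "H1_loc = {f \<in> L2_loc. \<exists>g \<in> L2_loc. is_weak_deriv f g}"

definition energy_space :: "(real \<Rightarrow> complex) set" where
  "energy_space = {v \<in> H1_loc. (\<lambda>x. 1 - (norm (v x))\<^sup>2) \<in> L2 \<and> weak_deriv v \<in> L2}"

subsection \<open>Weak solutions of \<open>TW(c, \<kappa>)\<close>\<close>

text \<open>
  The pairing \<open>\<langle>z, w\<rangle> = Re (z * cnj w)\<close> is the real inner product \<open>inner z w\<close> on \<open>complex\<close>.
\<close>

definition weak_solution :: "real \<Rightarrow> real \<Rightarrow> (real \<Rightarrow> complex) \<Rightarrow> bool" where
  "weak_solution c \<kappa> u \<longleftrightarrow> u \<in> energy_space \<and>
     (\<forall>\<phi>::real \<Rightarrow> complex. \<phi> \<in> test_functions \<longrightarrow>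
        (LINT x|lebesgue.
             inner (\<i> * complex_of_real c * weak_deriv u x
                      + u x * complex_of_real (1 - (norm (u x))\<^sup>2)) (\<phi> x)
           - inner (weak_deriv u x) (vector_derivative \<phi> (at x))
           + 2 * \<kappa> * inner (u x) (weak_deriv u x)
               * weak_deriv (\<lambda>y. inner (u y) (\<phi> y)) x) = 0)"

subsection \<open>Parameter sets, as sets of pairs \<open>(c, \<kappa>)\<close>\<close>

definition D1 :: "(real \<times> real) set" where
  "D1 = {(c, \<kappa>). 0 \<le> c \<and> c < sqrt 2 \<and> 0 < \<kappa> \<and> \<kappa> < 1/2}"

definition D2 :: "(real \<times> real) set" where
  "D2 = {(c, \<kappa>). 0 \<le> c \<and> c < sqrt 2 \<and> \<kappa> \<le> 0}"

definition D3 :: "(real \<times> real) set" where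
  "D3 = {(c, \<kappa>). c > sqrt 2 \<and> \<kappa> > 1/2}"

definition B_minus :: "(real \<times> real) set" where
  "B_minus = {(c, \<kappa>). c = sqrt 2 \<and> 0 < \<kappa> \<and> \<kappa> < 1/2}"

definition B_plus :: "(real \<times> real) set" where
  "B_plus = {(c, \<kappa>). c = sqrt 2 \<and> \<kappa> > 1/2}"

definition D_tilde :: "(real \<times> real) set" where
  "D_tilde = D1 \<union> D3 \<union> B_minus \<union> B_plus"

definition C_crit :: "(real \<times> real) set" where
  "C_crit = {(c, \<kappa>). c \<ge> 0 \<and> \<kappa> = 1/2}"

subsection \<open>The dark soliton, for \<open>(c, \<kappa>) \<in> D2\<close>\<close>

definition G :: "real \<Rightarrow> real \<Rightarrow> real \<Rightarrow> real" where
  "G c \<kappa> y =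
     - 2 * sqrt (- \<kappa>) *
         artanh (sqrt (- \<kappa>) * sqrt ((2 - c\<^sup>2 - 2 * y) / (1 - 2 * \<kappa> + 2 * \<kappa> * y)))
     + 2 * sqrt ((1 - 2 * \<kappa>) / (2 - c\<^sup>2)) *
         artanh (sqrt (((1 - 2 * \<kappa>) * (2 - c\<^sup>2 - 2 * y)) /
                       ((2 - c\<^sup>2) * (1 - 2 * \<kappa> + 2 * \<kappa> * y))))"

text \<open>
  For \<open>(c, \<kappa>) \<in> D2\<close>, \<open>G c \<kappa>\<close> is a decreasing bijection from \<open>{0<..1 - c\<^sup>2/2}\<close> onto \<open>{0..}\<close>; the inverse
  is extended evenly to the whole line.
\<close>

definition eta :: "real \<Rightarrow> real \<Rightarrow> real \<Rightarrow> real" where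
  "eta c \<kappa> x = inv_into {0<..1 - c\<^sup>2/2} (G c \<kappa>) \<bar>x\<bar>"

definition theta :: "real \<Rightarrow> real \<Rightarrow> real \<Rightarrow> real" where
  "theta c \<kappa> x = c / 2 * (LBINT y=ereal 0..ereal x. eta c \<kappa> y / (1 - eta c \<kappa> y))"

definition dark_soliton :: "real \<Rightarrow> real \<Rightarrow> real \<Rightarrow> complex" where
  "dark_soliton c \<kappa> x =
     (if c = 0
      then (if x \<ge> 0 then complex_of_real (sqrt (1 - eta 0 \<kappa> x))
            else - complex_of_real (sqrt (1 - eta 0 \<kappa> x)))
      else complex_of_real (sqrt (1 - eta c \<kappa> x)) * exp (\<i> * complex_of_real (theta c \<kappa> x)))"

end

theory Submission
  imports Defs
begin

text \<open>
  Write \<open>\<eta> = 1 - |u|\<^sup>2\<close>. Testing the weak equation against \<open>C\<^sub>c\<^sup>\<infinity>\<close> functions says that the flux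
  \<open>m = u' - 2\<kappa>\<langle>u, u'\<rangle>u\<close> has the locally integrable weak derivative
  \<open>- (icu' + \<eta>u + 2\<kappa>\<langle>u, u'\<rangle>u')\<close>; hence \<open>m\<close> is continuous. Since \<open>\<langle>u, m\<rangle> = A\<langle>u, u'\<rangle>\<close> with
  \<open>A = 1 - 2\<kappa>|u|\<^sup>2\<close>, also \<open>u'\<close> is continuous wherever \<open>A \<noteq> 0\<close>, and there \<open>u\<close> is a classical \<open>C\<^sup>2\<close>
  solution. On any such interval reaching \<open>+\<infinity>\<close> the first integrals \<open>\<langle>iu, u'\<rangle> - c\<eta>/2\<close> and
  \<open>|u'|\<^sup>2 - \<kappa>\<eta>'\<^sup>2/2 - \<eta>\<^sup>2/2\<close> vanish by finiteness of the energy, so that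
  \<open>A \<eta>'\<^sup>2 = \<eta>\<^sup>2 (2 - c\<^sup>2 - 2\<eta>)\<close>. If \<open>(1 - 2\<kappa>)(2 - c\<^sup>2) < 0\<close> the two sides have opposite signs for small \<open>\<eta>\<close>,
  and \<open>\<eta> = 0\<close> propagates from infinity. If \<open>\<kappa> \<le> 0\<close>, then \<open>A \<ge> 1\<close>, a nonzero extremal value of \<open>\<eta>\<close>
  can only be \<open>1 - c\<^sup>2/2\<close>, and for \<open>c < \<surd>2\<close> integrating the equation away from the unique maximum
  gives the dark soliton.
\<close>

section \<open>Smooth functions\<close>

text \<open>The degeneracy of \<open>1 - 2\<kappa>|u|\<^sup>2\<close> shapes the argument. For
  \<kappa> > 0 it can vanish, and there the flux no longer determines u'; so every differential
  identity is stated on an open set where the coefficient is nonzero, and the first integrals on a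
  convex one that contains a half-line. For \<kappa> \<le> 0 the whole line qualifies. A second
  obstacle: the first-order profile equation does not determine \<eta>. The constant
  \<open>1 - c\<^sup>2/2\<close> solves it too, and the square root is not Lipschitz there, so a
  solution might rest at its maximum. The second-order equation excludes this by forcing \<eta>'' <
  0 wherever \<eta>' vanishes. Then \<open>G\<close> is the time that the profile takes to descend
  from its maximum to a given height, and \<open>G\<close> of \<eta> is the distance to the maximum.
  The phase follows from the momentum integral, except for c = 0, where u has a zero and two
  half-lines must be joined. Outside \<open>D_tilde\<close> and \<open>C_crit\<close>, every pair
  with \<open>(1 - 2 * \<kappa>) * (2 - c\<^sup>2) \<ge> 0\<close> has \<kappa> \<le> 0 and
  \<open>c \<le> sqrt 2\<close>.\<close>

lemma C_k_0 [simp]: "C_k 0 f \<longleftrightarrow> continuous_on UNIV f"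
  by (simp add: C_k_def nth_vderiv_def)

text \<open>Moves the extra derivative from the outermost to the innermost place, so that inductions
  on the order run with the function arbitrary.\<close>

lemma nth_vderiv_Suc: "nth_vderiv (Suc k) f = nth_vderiv k (\<lambda>x. vector_derivative f (at x))"
  unfolding nth_vderiv_def by (subst funpow_Suc_right) simp

lemma C_k_Suc:
  "C_k (Suc k) f \<longleftrightarrow> (\<forall>x. f differentiable (at x)) \<and> C_k k (\<lambda>x. vector_derivative f (at x))"
  unfolding C_k_def
  by (auto simp: less_Suc_eq_0_disj nth_vderiv_Suc) (auto simp: nth_vderiv_def)

lemma C_k_SucI:
  assumes "\<And>x. (f has_vector_derivative f' x) (at x)" "C_k k f'"
  shows "C_k (Suc k) f"
proof -
  have "(\<lambda>x. vector_derivative f (at x)) = f'"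
    using assms(1) vector_derivative_at by blast
  then show ?thesis
    using assms differentiableI_vector by (auto simp: C_k_Suc)
qed

lemma C_k_SucD: "C_k (Suc k) f \<Longrightarrow> C_k k f"
proof (induction k arbitrary: f)
  case 0
  then show ?case
    by (auto simp: C_k_Suc continuous_on_eq_continuous_within differentiable_imp_continuous_within)
next
  case (Suc k)
  then show ?case by (subst C_k_Suc) (auto simp: C_k_Suc)
qed

lemma C_k_has_vector_derivative:
  "C_k (Suc k) f \<Longrightarrow> (f has_vector_derivative vector_derivative f (at x)) (at x)"
  by (simp add: C_k_Suc vector_derivative_works)

lemma C_k_add: "C_k k f \<Longrightarrow> C_k k g \<Longrightarrow> C_k k (\<lambda>x. f x + g x)"
proof (induction k arbitrary: f g)
  case (Suc k)
  show ?case
    by (rule C_k_SucI[OF has_vector_derivative_add Suc.IH])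
       (use Suc.prems in \<open>auto simp: C_k_Suc vector_derivative_works\<close>)
qed (auto intro: continuous_intros)

lemma C_k_bounded_linear:
  assumes "bounded_linear L"
  shows "C_k k f \<Longrightarrow> C_k k (\<lambda>x. L (f x))"
proof (induction k arbitrary: f)
  case 0
  then show ?case using assms by (auto intro: bounded_linear.continuous_on)
next
  case (Suc k)
  show ?case
    by (rule C_k_SucI[OF bounded_linear.has_vector_derivative[OF assms] Suc.IH])
       (use Suc.prems in \<open>auto simp: C_k_Suc vector_derivative_works\<close>)
qed

lemma C_k_scaleR:
  fixes f :: "real \<Rightarrow> real"
  shows "C_k k f \<Longrightarrow> C_k k g \<Longrightarrow> C_k k (\<lambda>x. f x *\<^sub>R g x)"
proof (induction k arbitrary: f g)
  case (Suc k)
  let ?f' = "\<lambda>x. vector_derivative f (at x)" and ?g' = "\<lambda>x. vector_derivative g (at x)"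
  have "((\<lambda>x. f x *\<^sub>R g x) has_vector_derivative f x *\<^sub>R ?g' x + ?f' x *\<^sub>R g x) (at x)" for x
    using C_k_has_vector_derivative[OF Suc.prems(1), of x] C_k_has_vector_derivative[OF Suc.prems(2), of x]
    by (intro has_vector_derivative_scaleR)
       (auto simp: has_real_derivative_iff_has_vector_derivative)
  moreover have "C_k k (\<lambda>x. f x *\<^sub>R ?g' x + ?f' x *\<^sub>R g x)"
    using Suc.prems by (intro C_k_add Suc.IH) (auto simp: C_k_Suc intro: C_k_SucD)
  ultimately show ?case by (rule C_k_SucI)
qed (auto intro: continuous_intros)

lemma C_k_affine:
  fixes f :: "real \<Rightarrow> 'a::real_normed_vector"
  shows "C_k k f \<Longrightarrow> C_k k (\<lambda>x. f (a * x + b))"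
proof (induction k arbitrary: f)
  case 0
  then show ?case by (auto intro!: continuous_intros elim!: continuous_on_compose2)
next
  case (Suc k)
  let ?f' = "\<lambda>x. vector_derivative f (at x)"
  have "((\<lambda>x. f (a * x + b)) has_vector_derivative a *\<^sub>R ?f' (a * x + b)) (at x)" for x
  proof -
    have "((\<lambda>x. a * x + b) has_vector_derivative a) (at x)"
      by (auto intro!: derivative_eq_intros)
    from vector_diff_chain_at[OF this C_k_has_vector_derivative[OF Suc.prems]]
    show ?thesis by (simp add: o_def)
  qed
  moreover have "C_k k (\<lambda>x. a *\<^sub>R ?f' (a * x + b))"
    using Suc.prems by (intro C_k_bounded_linear[OF bounded_linear_scaleR_right] Suc.IH) (auto simp: C_k_Suc)
  ultimately show ?case by (rule C_k_SucI)
qed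

section \<open>A smooth function that vanishes on a half-line\<close>

definition flat :: "nat \<Rightarrow> real \<Rightarrow> real" where
  "flat n x = (if x > 0 then exp (- (1 / x)) / x ^ n else 0)"

lemma flat_nonneg: "flat n x \<ge> 0"
  by (simp add: flat_def)

lemma flat_0_le_1: "flat 0 x \<le> 1"
  by (simp add: flat_def)

lemma flat_pos: "x > 0 \<Longrightarrow> flat n x > 0"
  by (simp add: flat_def)

lemma flat_eq_0: "x \<le> 0 \<Longrightarrow> flat n x = 0"
  by (simp add: flat_def)

lemma tendsto_flat: "(flat n \<longlongrightarrow> 0) (at 0)"
proof -
  have "((\<lambda>x::real. inverse x ^ n / exp (inverse x)) \<longlongrightarrow> 0) (at_right 0)"
    by (rule filterlim_compose[OF tendsto_power_div_exp_0 filterlim_inverse_at_top_right])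
  then have "(flat n \<longlongrightarrow> 0) (at_right 0)"
    by (rule Lim_transform_eventually)
       (auto simp: eventually_at_filter flat_def exp_minus field_simps)
  moreover have "(flat n \<longlongrightarrow> 0) (at_left 0)"
    by (rule Lim_transform_eventually[OF tendsto_const])
       (auto simp: eventually_at_filter flat_def)
  ultimately show ?thesis by (simp add: filterlim_split_at)
qed

text \<open>Carrying powers of \<open>1 / x\<close> along makes the family closed under
  differentiation up to linear combinations, so smoothness of all members follows by one induction
  on the order. \<open>flat 0\<close> is the usual flat function.\<close>

lemma flat_has_derivative:
  "(flat n has_vector_derivative flat (n + 2) x + (- real n) *\<^sub>R flat (n + 1) x) (at x)"
proof -
  consider "x > 0" | "x < 0" | "x = 0" by linarith
  then show ?thesis
  proof cases
    case 1
    have "((\<lambda>x. exp (- (1 / x)) / x ^ n) has_real_derivative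
            flat (n + 2) x + (- real n) *\<^sub>R flat (n + 1) x) (at x)"
    proof -
      have "((\<lambda>x. exp (- (1 / x))) has_real_derivative exp (- (1 / x)) * (1 / x\<^sup>2)) (at x)"
        using 1 by (auto intro!: derivative_eq_intros simp: power2_eq_square)
      from DERIV_divide[OF this DERIV_pow[of n x]] 1
      have "((\<lambda>x. exp (- (1 / x)) / x ^ n) has_real_derivative
        (exp (- (1 / x)) * (1 / x\<^sup>2) * x ^ n - exp (- (1 / x)) * (real n * x ^ (n - Suc 0))) / (x ^ n * x ^ n)) (at x)"
        by simp
      moreover have "(exp (- (1 / x)) * (1 / x\<^sup>2) * x ^ n - exp (- (1 / x)) * (real n * x ^ (n - Suc 0))) / (x ^ n * x ^ n)
        = flat (n + 2) x + (- real n) *\<^sub>R flat (n + 1) x"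
        using 1 by (cases n) (simp_all add: flat_def divide_simps power2_eq_square algebra_simps)
      ultimately show ?thesis by simp
    qed
    then have "((\<lambda>x. exp (- (1 / x)) / x ^ n) has_vector_derivative
            flat (n + 2) x + (- real n) *\<^sub>R flat (n + 1) x) (at x)"
      by (simp add: has_real_derivative_iff_has_vector_derivative)
    then show ?thesis
      by (rule has_vector_derivative_transform_within_open[of _ _ _ "{0<..}"])
         (use 1 in \<open>auto simp: flat_def\<close>)
  next
    case 2
    show ?thesis
      by (rule has_vector_derivative_transform_within_open[of "\<lambda>_. 0" _ _ "{..<0}"])
         (use 2 in \<open>auto simp: flat_def\<close>)
  next
    case 3
    \<comment> \<open>The difference quotient of \<open>flat n\<close> at 0 is
      \<open>flat (n + 1)\<close>, whose limit is known.\<close>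
    have "((\<lambda>h. flat n h / h) \<longlongrightarrow> 0) (at 0)"
      by (rule Lim_transform_eventually[OF tendsto_flat[of "n + 1"]])
         (auto simp: eventually_at_filter flat_def)
    then have "(flat n has_real_derivative 0) (at 0)"
      by (simp add: DERIV_def flat_def)
    then show ?thesis
      using 3 by (simp add: has_real_derivative_iff_has_vector_derivative flat_def)
  qed
qed

lemma C_k_flat: "C_k k (flat n)"
proof (induction k arbitrary: n)
  case 0
  show ?case
    by (simp add: continuous_on_eq_continuous_within has_vector_derivative_continuous[OF flat_has_derivative])
next
  case (Suc k)
  show ?case
    by (rule C_k_SucI[OF flat_has_derivative])
       (intro C_k_add C_k_bounded_linear[OF bounded_linear_scaleR_right] Suc)
qed

section \<open>Test functions\<close>

lemma test_functionsI:
  assumes "\<And>k. C_k k \<phi>" "\<And>x. \<phi> x \<noteq> 0 \<Longrightarrow> \<bar>x\<bar> \<le> R"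
  shows "\<phi> \<in> test_functions"
proof -
  have "bounded {x. \<phi> x \<noteq> 0}"
    unfolding bounded_iff using assms(2) by (auto intro: exI[of _ R])
  then show ?thesis
    using assms(1) by (simp add: test_functions_def compact_closure)
qed

lemma test_functions_C_k: "\<phi> \<in> test_functions \<Longrightarrow> C_k k \<phi>"
  by (simp add: test_functions_def)

lemma test_functions_support:
  assumes "\<phi> \<in> test_functions"
  obtains R where "R > 0" "\<And>x. \<bar>x\<bar> > R \<Longrightarrow> \<phi> x = 0"
proof -
  have "bounded {x. \<phi> x \<noteq> 0}"
    using assms by (simp add: test_functions_def compact_closure)
  then obtain R where "R > 0" "\<forall>x\<in>{x. \<phi> x \<noteq> 0}. norm x \<le> R"
    using bounded_pos by blast
  then show ?thesis using that[of R] by force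
qed

lemma test_functions_has_vector_derivative:
  "\<phi> \<in> test_functions \<Longrightarrow> (\<phi> has_vector_derivative vector_derivative \<phi> (at x)) (at x)"
  by (rule C_k_has_vector_derivative[OF test_functions_C_k[of _ "Suc 0"]])

lemma test_functions_continuous: "\<phi> \<in> test_functions \<Longrightarrow> continuous_on S \<phi>"
  using test_functions_C_k[of \<phi> 0] continuous_on_subset by auto

lemma test_functions_vector_derivative:
  assumes "\<phi> \<in> test_functions"
  shows "(\<lambda>x. vector_derivative \<phi> (at x)) \<in> test_functions"
proof -
  obtain R where R: "R > 0" "\<And>x. \<bar>x\<bar> > R \<Longrightarrow> \<phi> x = 0"
    using test_functions_support[OF assms] by blast
  have "vector_derivative \<phi> (at x) = 0" if "\<bar>x\<bar> > R" for x
  proof (rule vector_derivative_at)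
    show "(\<phi> has_vector_derivative 0) (at x)"
      by (rule has_vector_derivative_transform_within_open[of "\<lambda>_. 0" _ _ "{x. \<bar>x\<bar> > R}"])
         (use that R in \<open>auto intro!: open_Collect_less continuous_intros\<close>)
  qed
  moreover have "C_k k (\<lambda>x. vector_derivative \<phi> (at x))" for k
    using test_functions_C_k[OF assms, of "Suc k"] by (simp add: C_k_Suc)
  ultimately show ?thesis
    by (intro test_functionsI[of _ R]) force+
qed

lemma test_functions_bounded_linear:
  assumes "bounded_linear L" "\<phi> \<in> test_functions"
  shows "(\<lambda>x. L (\<phi> x)) \<in> test_functions"
proof -
  obtain R where "R > 0" "\<And>x. \<bar>x\<bar> > R \<Longrightarrow> \<phi> x = 0"
    using test_functions_support[OF assms(2)] by blast
  then show ?thesis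
    using assms linear_0[OF bounded_linear.linear[OF assms(1)]]
    by (intro test_functionsI[of _ R] C_k_bounded_linear[OF assms(1)] test_functions_C_k[OF assms(2)]) (metis not_le)
qed

lemma test_functions_add:
  assumes "\<phi> \<in> test_functions" "\<psi> \<in> test_functions"
  shows "(\<lambda>x. \<phi> x + \<psi> x) \<in> test_functions"
proof -
  obtain R where "R > 0" "\<And>x. \<bar>x\<bar> > R \<Longrightarrow> \<phi> x = 0"
    using test_functions_support[OF assms(1)] by blast
  moreover obtain R' where "R' > 0" "\<And>x. \<bar>x\<bar> > R' \<Longrightarrow> \<psi> x = 0"
    using test_functions_support[OF assms(2)] by blast
  ultimately show ?thesis
    by (intro test_functionsI[of _ "max R R'"] C_k_add[OF test_functions_C_k[OF assms(1)] test_functions_C_k[OF assms(2)]])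
       (metis add_0 le_max_iff_disj not_le)
qed

lemma test_functions_scaleR:
  fixes \<phi> :: "real \<Rightarrow> real"
  assumes "\<phi> \<in> test_functions" "\<psi> \<in> test_functions"
  shows "(\<lambda>x. \<phi> x *\<^sub>R \<psi> x) \<in> test_functions"
proof -
  obtain R where "R > 0" "\<And>x. \<bar>x\<bar> > R \<Longrightarrow> \<phi> x = 0"
    using test_functions_support[OF assms(1)] by blast
  then show ?thesis
    by (intro test_functionsI[of _ R] C_k_scaleR[OF test_functions_C_k[OF assms(1)] test_functions_C_k[OF assms(2)]]) force
qed

text \<open>The affine arguments are written out to match \<open>C_k_affine\<close>;
  \<open>bump_alt\<close> is the working form. Growing \<open>n\<close> steepens the edges, and the
  limit is the indicator of the open interval.\<close>

definition bump :: "real \<Rightarrow> real \<Rightarrow> nat \<Rightarrow> real \<Rightarrow> real" where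
  "bump a b n x = flat 0 (real n * x + (- real n * a)) *\<^sub>R flat 0 (- real n * x + real n * b)"

lemma bump_alt: "bump a b n x = flat 0 (real n * (x - a)) * flat 0 (real n * (b - x))"
  by (simp add: bump_def algebra_simps)

lemma bump_bounds: "0 \<le> bump a b n x" "bump a b n x \<le> 1"
  using flat_nonneg flat_0_le_1 by (auto simp: bump_alt intro!: mult_le_one)

lemma bump_eq_0: "x \<notin> {a<..<b} \<Longrightarrow> bump a b n x = 0"
  by (cases "x \<le> a") (auto simp: bump_alt flat_eq_0 mult_nonneg_nonpos)

lemma bump_test: "bump a b n \<in> test_functions"
proof (rule test_functionsI[of _ "max \<bar>a\<bar> \<bar>b\<bar>"])
  show "C_k k (bump a b n)" for k
    unfolding bump_def[abs_def] by (intro C_k_scaleR C_k_affine C_k_flat)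
  show "\<bar>x\<bar> \<le> max \<bar>a\<bar> \<bar>b\<bar>" if "bump a b n x \<noteq> 0" for x
    using that bump_eq_0[of x a b n] by (cases "x \<in> {a<..<b}") auto
qed

lemma bump_tendsto: "(\<lambda>n. bump a b n x) \<longlonglongrightarrow> indicator {a<..<b} x"
proof (cases "x \<in> {a<..<b}")
  case True
  have "(\<lambda>n. flat 0 (real n * y)) \<longlonglongrightarrow> 1" if "y > 0" for y
  proof -
    have "(\<lambda>n. exp (- (1 / (real n * y)))) \<longlonglongrightarrow> exp (- 0)"
    proof -
      have "(\<lambda>n. 1 / y * (1 / real n)) \<longlonglongrightarrow> 1 / y * 0"
        by (intro tendsto_mult tendsto_const lim_1_over_n)
      then have "(\<lambda>n. 1 / (real n * y)) \<longlonglongrightarrow> 0"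
        by (simp add: mult.commute)
      then show ?thesis by (intro tendsto_exp tendsto_minus)
    qed
    then have "(\<lambda>n. exp (- (1 / (real n * y)))) \<longlonglongrightarrow> 1" by simp
    then show ?thesis
      by (rule Lim_transform_eventually)
         (use that in \<open>auto simp: flat_def intro!: eventually_mono[OF eventually_gt_at_top[of 0]]\<close>)
  qed
  from this[of "x - a"] this[of "b - x"] True
  have "(\<lambda>n. flat 0 (real n * (x - a)) * flat 0 (real n * (b - x))) \<longlonglongrightarrow> 1 * 1"
    by (intro tendsto_mult) auto
  with True show ?thesis by (simp add: bump_alt)
qed (simp add: bump_eq_0)

section \<open>Locally integrable functions\<close>

lemma borel_measurable_lebesgue_ident [measurable]: "(\<lambda>x::'a::euclidean_space. x) \<in> borel_measurable lebesgue"
  by (simp add: measurable_completion)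

lemma continuous_borel_measurable_lebesgue:
  "continuous_on UNIV (f :: real \<Rightarrow> 'a::topological_space) \<Longrightarrow> f \<in> borel_measurable lebesgue"
  by (intro measurable_completion) (simp add: borel_measurable_continuous_onI)

lemma locally_integrable_interval:
  "locally_integrable f \<longleftrightarrow> (\<forall>R. integrable lebesgue (\<lambda>x. indicator {-R..R} x *\<^sub>R f x))"
proof
  assume *: "\<forall>R. integrable lebesgue (\<lambda>x. indicator {-R..R} x *\<^sub>R f x)"
  show "locally_integrable f"
    unfolding locally_integrable_def
  proof (intro allI impI)
    fix K :: "real set" assume "compact K"
    then obtain R where R: "\<forall>x\<in>K. norm x \<le> R" and "K \<in> sets lebesgue"
      using compact_imp_bounded bounded_iff by (metis compact_imp_closed borel_closed sets_completionI_sets sets_lborel)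
    have "set_integrable lebesgue {-R..R} f"
      using * by (simp add: set_integrable_def)
    then show "set_integrable lebesgue K f"
      by (rule set_integrable_subset) (use \<open>K \<in> sets lebesgue\<close> R in \<open>auto simp: abs_le_iff\<close>)
  qed
qed (auto simp: locally_integrable_def set_integrable_def)

lemma locally_integrable_borel_measurable:
  assumes "locally_integrable f"
  shows "f \<in> borel_measurable lebesgue"
proof (rule borel_measurable_LIMSEQ_metric)
  show "(\<lambda>x. indicator {-real n..real n} x *\<^sub>R f x) \<in> borel_measurable lebesgue" for n
    using assms unfolding locally_integrable_interval by (intro borel_measurable_integrable) blast
  show "(\<lambda>n. indicator {-real n..real n} x *\<^sub>R f x) \<longlonglongrightarrow> f x" for x
  proof (rule Lim_transform_eventually[OF tendsto_const])
    obtain N :: nat where "\<bar>x\<bar> \<le> real N" using real_arch_simple by blast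
    then show "\<forall>\<^sub>F n in sequentially. f x = indicator {-real n..real n} x *\<^sub>R f x"
      by (intro eventually_sequentiallyI[of N]) (auto simp: indicator_def)
  qed
qed

text \<open>\<open>B\<close> may depend on \<open>R\<close>: the typical use is a locally integrable
  function times a continuous factor, which is bounded on each interval but perhaps not
  globally.\<close>

lemma locally_integrableI_bound:
  assumes "locally_integrable g" "f \<in> borel_measurable lebesgue"
    and "\<And>R. \<exists>B. AE x in lebesgue. \<bar>x\<bar> \<le> R \<longrightarrow> norm (f x) \<le> B * norm (g x)"
  shows "locally_integrable f"
  unfolding locally_integrable_interval
proof
  fix R
  obtain B where B: "AE x in lebesgue. \<bar>x\<bar> \<le> R \<longrightarrow> norm (f x) \<le> B * norm (g x)"
    using assms(3) by blast
  have "integrable lebesgue (\<lambda>x. B * norm (indicator {-R..R} x *\<^sub>R g x))"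
    using assms(1) unfolding locally_integrable_interval by (intro integrable_mult_right integrable_norm) auto
  then show "integrable lebesgue (\<lambda>x. indicator {-R..R} x *\<^sub>R f x)"
  proof (rule Bochner_Integration.integrable_bound)
    show "(\<lambda>x. indicator {-R..R} x *\<^sub>R f x) \<in> borel_measurable lebesgue"
      using assms(2) by measurable
    show "AE x in lebesgue. norm (indicator {-R..R} x *\<^sub>R f x) \<le> norm (B * norm (indicator {-R..R} x *\<^sub>R g x))"
      using B by eventually_elim (auto simp: indicator_def abs_le_iff intro: order_trans[OF _ abs_ge_self])
  qed
qed

lemma locally_integrable_add:
  "locally_integrable f \<Longrightarrow> locally_integrable g \<Longrightarrow> locally_integrable (\<lambda>x. f x + g x)"
  by (auto simp: locally_integrable_interval scaleR_add_right)

lemma locally_integrable_bounded_linear: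
  assumes "bounded_linear L" "locally_integrable f"
  shows "locally_integrable (\<lambda>x. L (f x))"
  unfolding locally_integrable_interval
proof
  fix R
  have "integrable lebesgue (\<lambda>x. L (indicator {-R..R} x *\<^sub>R f x))"
    using assms by (auto simp: locally_integrable_interval intro: integrable_bounded_linear)
  then show "integrable lebesgue (\<lambda>x. indicator {-R..R} x *\<^sub>R L (f x))"
    by (simp add: linear_simps[OF assms(1)])
qed

lemma locally_integrable_uminus: "locally_integrable f \<Longrightarrow> locally_integrable (\<lambda>x. - f x)"
  by (rule locally_integrable_bounded_linear[OF bounded_linear_minus[OF bounded_linear_ident]])

lemma locally_integrable_continuous:
  fixes f :: "real \<Rightarrow> 'a::euclidean_space"
  assumes "continuous_on UNIV f"
  shows "locally_integrable f"
  unfolding locally_integrable_interval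
proof
  fix R
  have "f absolutely_integrable_on {-R..R}"
    by (rule absolutely_integrable_continuous_real) (use assms continuous_on_subset in blast)
  then show "integrable lebesgue (\<lambda>x. indicator {-R..R} x *\<^sub>R f x)"
    by (simp add: set_integrable_def)
qed

lemma continuous_bounded_interval:
  fixes f :: "real \<Rightarrow> 'a::real_normed_vector"
  assumes "continuous_on UNIV f"
  shows "\<exists>B\<ge>0. \<forall>x. \<bar>x\<bar> \<le> R \<longrightarrow> norm (f x) \<le> B"
proof -
  have "bounded (f ` {-R..R})"
    by (intro compact_imp_bounded compact_continuous_image continuous_on_subset[OF assms]) auto
  then obtain B where "B > 0" "\<forall>y\<in>f ` {-R..R}. norm y \<le> B"
    using bounded_pos by blast
  then show ?thesis by (intro exI[of _ B]) (auto simp: abs_le_iff)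
qed

lemma locally_integrable_continuous_scaleR:
  fixes \<psi> :: "real \<Rightarrow> real"
  assumes "continuous_on UNIV \<psi>" "locally_integrable f"
  shows "locally_integrable (\<lambda>x. \<psi> x *\<^sub>R f x)"
proof (rule locally_integrableI_bound[OF assms(2)])
  show "(\<lambda>x. \<psi> x *\<^sub>R f x) \<in> borel_measurable lebesgue"
    using locally_integrable_borel_measurable[OF assms(2)] continuous_borel_measurable_lebesgue[OF assms(1)]
    by measurable
  fix R
  obtain B where "\<forall>x. \<bar>x\<bar> \<le> R \<longrightarrow> norm (\<psi> x) \<le> B"
    using continuous_bounded_interval[OF assms(1), of R] by blast
  then show "\<exists>B. AE x in lebesgue. \<bar>x\<bar> \<le> R \<longrightarrow> norm (\<psi> x *\<^sub>R f x) \<le> B * norm (f x)"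
    by (intro exI[of _ B] AE_I2) (auto intro: mult_right_mono)
qed

lemma integrable_test_scaleR:
  fixes \<psi> :: "real \<Rightarrow> real"
  assumes "\<psi> \<in> test_functions" "locally_integrable f"
  shows "integrable lebesgue (\<lambda>x. \<psi> x *\<^sub>R f x)"
proof -
  obtain R where R: "R > 0" "\<And>x. \<bar>x\<bar> > R \<Longrightarrow> \<psi> x = 0"
    using test_functions_support[OF assms(1)] by blast
  have "integrable lebesgue (\<lambda>x. indicator {-R..R} x *\<^sub>R \<psi> x *\<^sub>R f x)"
    using locally_integrable_continuous_scaleR[OF test_functions_continuous[OF assms(1)] assms(2)]
    by (simp add: locally_integrable_interval)
  moreover have "indicator {-R..R} x *\<^sub>R \<psi> x *\<^sub>R f x = \<psi> x *\<^sub>R f x" for x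
    using R(2)[of x] by (cases "\<bar>x\<bar> \<le> R") (auto simp: indicator_def abs_le_iff)
  ultimately show ?thesis by (simp only:)
qed

lemma locally_integrable_absolutely_integrable:
  "locally_integrable f \<Longrightarrow> f absolutely_integrable_on {a..b}"
  by (simp add: locally_integrable_def)

lemma locally_integrable_integrable_on:
  fixes f :: "real \<Rightarrow> 'a::euclidean_space"
  shows "locally_integrable f \<Longrightarrow> f integrable_on {a..b}"
  using locally_integrable_absolutely_integrable set_lebesgue_integral_eq_integral(1) by blast

text \<open>The test functions \<^term>\<open>bump a b n\<close> converge boundedly to the indicator of \<open>(a, b)\<close>, so all
  integrals of \<open>f\<close> over intervals vanish, and the Lebesgue differentiation theorem applies.\<close>

lemma fundamental_lemma:
  fixes f :: "real \<Rightarrow> 'a::euclidean_space"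
  assumes f: "locally_integrable f"
    and test: "\<And>\<psi>::real \<Rightarrow> real. \<psi> \<in> test_functions \<Longrightarrow> (LINT x|lebesgue. \<psi> x *\<^sub>R f x) = 0"
  shows "AE x in lebesgue. f x = 0"
proof -
  have meas [measurable]: "f \<in> borel_measurable lebesgue"
    using locally_integrable_borel_measurable[OF f] .
  have zero: "integral {a..b} f = 0" for a b
  proof -
    have "(\<lambda>n. LINT x|lebesgue. bump a b n x *\<^sub>R f x) \<longlonglongrightarrow> (LINT x|lebesgue. indicator {a<..<b} x *\<^sub>R f x)"
    proof (rule integral_dominated_convergence)
      show "integrable lebesgue (\<lambda>x. norm (indicator {a..b} x *\<^sub>R f x))"
        using locally_integrable_absolutely_integrable[OF f, of a b]
        by (intro integrable_norm) (simp add: set_integrable_def)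
      show "AE x in lebesgue. (\<lambda>n. bump a b n x *\<^sub>R f x) \<longlonglongrightarrow> indicator {a<..<b} x *\<^sub>R f x"
        by (intro AE_I2 tendsto_scaleR bump_tendsto tendsto_const)
      show "AE x in lebesgue. norm (bump a b n x *\<^sub>R f x) \<le> norm (indicator {a..b} x *\<^sub>R f x)" for n
        using bump_bounds[of a b n] bump_eq_0[of _ a b n]
        by (intro AE_I2) (auto simp: indicator_def intro!: mult_left_le_one_le)
      show "(\<lambda>x. bump a b n x *\<^sub>R f x) \<in> borel_measurable lebesgue" for n
        by (intro borel_measurable_integrable integrable_test_scaleR[OF bump_test f])
    qed measurable
    moreover have "(\<lambda>n. LINT x|lebesgue. bump a b n x *\<^sub>R f x) = (\<lambda>n. 0)"
      using test bump_test by auto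
    ultimately have "(LINT x|lebesgue. indicator {a<..<b} x *\<^sub>R f x) = 0"
      using LIMSEQ_unique tendsto_const by metis
    moreover have "f absolutely_integrable_on {a<..<b}"
      by (rule set_integrable_subset[OF locally_integrable_absolutely_integrable[OF f, of a b]]) auto
    ultimately have "integral {a<..<b} f = 0"
      using set_lebesgue_integral_eq_integral(2)[of "{a<..<b}" f] by (simp add: set_lebesgue_integral_def)
    then show ?thesis by (simp add: integral_open_interval_real)
  qed
  obtain N where N: "negligible N"
    and d: "\<And>x e. \<lbrakk>x \<notin> N; 0 < e\<rbrakk> \<Longrightarrow> \<exists>d>0. \<forall>h. 0 < h \<and> h < d \<longrightarrow>
                norm (integral (cbox x (x + h *\<^sub>R One)) f /\<^sub>R h ^ DIM(real) - f x) < e"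
    using integrable_ccontinuous_explicit[of f] locally_integrable_integrable_on[OF f] by (metis cbox_interval)
  have "f x = 0" if "x \<notin> N" for x
  proof -
    have "norm (f x) < e" if e: "e > 0" for e
    proof -
      obtain d where "d > 0" "\<forall>h. 0 < h \<and> h < d \<longrightarrow>
                norm (integral (cbox x (x + h *\<^sub>R One)) f /\<^sub>R h ^ DIM(real) - f x) < e"
        using d[OF \<open>x \<notin> N\<close> e] by blast
      from this(2)[rule_format, of "d/2"] this(1) show ?thesis by (simp add: zero)
    qed
    then show ?thesis by (metis less_irrefl zero_less_norm_iff)
  qed
  then show ?thesis
    using N negligible_iff_null_sets by (intro AE_I'[of N]) auto
qed

section \<open>Weak derivatives and primitives\<close>

lemma is_weak_derivD:
  "is_weak_deriv f g \<Longrightarrow> \<psi> \<in> test_functions \<Longrightarrow>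
    (LINT x|lebesgue. vector_derivative \<psi> (at x) *\<^sub>R f x) = - (LINT x|lebesgue. \<psi> x *\<^sub>R g x)"
  by (simp add: is_weak_deriv_def)

lemma is_weak_deriv_unique:
  fixes f :: "real \<Rightarrow> 'a::euclidean_space"
  assumes "is_weak_deriv f g" "is_weak_deriv f g'"
  shows "AE x in lebesgue. g x = g' x"
proof -
  have loc: "locally_integrable g" "locally_integrable g'"
    using assms by (auto simp: is_weak_deriv_def)
  have "AE x in lebesgue. g x + - g' x = 0"
  proof (rule fundamental_lemma)
    show "locally_integrable (\<lambda>x. g x + - g' x)"
      by (intro locally_integrable_add locally_integrable_uminus loc)
    fix \<psi> :: "real \<Rightarrow> real" assume \<psi>: "\<psi> \<in> test_functions"
    have "(LINT x|lebesgue. \<psi> x *\<^sub>R g x) = (LINT x|lebesgue. \<psi> x *\<^sub>R g' x)"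
      using is_weak_derivD[OF assms(1) \<psi>] is_weak_derivD[OF assms(2) \<psi>] by simp
    then show "(LINT x|lebesgue. \<psi> x *\<^sub>R (g x + - g' x)) = 0"
      using integrable_test_scaleR[OF \<psi> loc(1)] integrable_test_scaleR[OF \<psi> loc(2)]
      by (simp add: scaleR_diff_right)
  qed
  then show ?thesis by eventually_elim simp
qed

lemma is_weak_deriv_weak_deriv: "is_weak_deriv f g \<Longrightarrow> is_weak_deriv f (weak_deriv f)"
  unfolding weak_deriv_def by (rule someI[of "is_weak_deriv f"])

lemma weak_deriv_eq:
  fixes f :: "real \<Rightarrow> 'a::euclidean_space"
  shows "is_weak_deriv f g \<Longrightarrow> AE x in lebesgue. weak_deriv f x = g x"
  using is_weak_deriv_unique is_weak_deriv_weak_deriv by blast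

lemma is_weak_deriv_bounded_linear:
  assumes "bounded_linear L" "is_weak_deriv f g"
  shows "is_weak_deriv (\<lambda>x. L (f x)) (\<lambda>x. L (g x))"
  unfolding is_weak_deriv_def
proof (intro conjI allI impI)
  have loc: "locally_integrable f" "locally_integrable g"
    using assms by (auto simp: is_weak_deriv_def)
  then show "locally_integrable (\<lambda>x. L (f x))" "locally_integrable (\<lambda>x. L (g x))"
    using assms(1) locally_integrable_bounded_linear by blast+
  fix \<psi> :: "real \<Rightarrow> real" assume \<psi>: "\<psi> \<in> test_functions"
  have "L (LINT x|lebesgue. vector_derivative \<psi> (at x) *\<^sub>R f x) = L (- (LINT x|lebesgue. \<psi> x *\<^sub>R g x))"
    using is_weak_derivD[OF assms(2) \<psi>] by simp
  then show "(LINT x|lebesgue. vector_derivative \<psi> (at x) *\<^sub>R L (f x)) = - (LINT x|lebesgue. \<psi> x *\<^sub>R L (g x))"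
    using integral_bounded_linear[OF assms(1) integrable_test_scaleR[OF \<psi> loc(2)]]
      integral_bounded_linear[OF assms(1) integrable_test_scaleR[OF test_functions_vector_derivative[OF \<psi>] loc(1)]]
    by (simp add: linear_simps[OF assms(1)])
qed

text \<open>Leibniz rule, obtained by testing \<open>f\<close> against the product
  \<open>\<psi> \<phi>\<close>. It evaluates the term
  \<open>weak_deriv (\<lambda>y. inner (u y) (\<phi> y))\<close> of the weak equation when the test
  function is a real one times a fixed vector.\<close>

lemma is_weak_deriv_test_scaleR:
  fixes \<phi> :: "real \<Rightarrow> real"
  assumes \<phi>: "\<phi> \<in> test_functions" and fg: "is_weak_deriv f g"
  shows "is_weak_deriv (\<lambda>x. \<phi> x *\<^sub>R f x) (\<lambda>x. vector_derivative \<phi> (at x) *\<^sub>R f x + \<phi> x *\<^sub>R g x)"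
  unfolding is_weak_deriv_def
proof (intro conjI allI impI)
  let ?\<phi>' = "\<lambda>x. vector_derivative \<phi> (at x)"
  have \<phi>': "?\<phi>' \<in> test_functions" using test_functions_vector_derivative[OF \<phi>] .
  have loc: "locally_integrable f" "locally_integrable g"
    using fg by (auto simp: is_weak_deriv_def)
  show loc_\<phi>f: "locally_integrable (\<lambda>x. \<phi> x *\<^sub>R f x)"
    by (intro locally_integrable_continuous_scaleR test_functions_continuous \<phi> loc)
  have loc': "locally_integrable (\<lambda>x. ?\<phi>' x *\<^sub>R f x)" "locally_integrable (\<lambda>x. \<phi> x *\<^sub>R g x)"
    by (intro locally_integrable_continuous_scaleR test_functions_continuous \<phi> \<phi>' loc)+
  then show "locally_integrable (\<lambda>x. ?\<phi>' x *\<^sub>R f x + \<phi> x *\<^sub>R g x)"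
    by (rule locally_integrable_add)
  fix \<psi> :: "real \<Rightarrow> real" assume \<psi>: "\<psi> \<in> test_functions"
  let ?\<psi>' = "\<lambda>x. vector_derivative \<psi> (at x)"
  have "vector_derivative (\<lambda>x. \<psi> x *\<^sub>R \<phi> x) (at x) = \<psi> x *\<^sub>R ?\<phi>' x + ?\<psi>' x *\<^sub>R \<phi> x" for x
    using test_functions_has_vector_derivative[OF \<psi>, of x] test_functions_has_vector_derivative[OF \<phi>, of x]
    by (intro vector_derivative_at has_vector_derivative_scaleR)
       (auto simp: has_real_derivative_iff_has_vector_derivative)
  then have "(LINT x|lebesgue. (\<psi> x *\<^sub>R ?\<phi>' x + ?\<psi>' x *\<^sub>R \<phi> x) *\<^sub>R f x) = - (LINT x|lebesgue. (\<psi> x *\<^sub>R \<phi> x) *\<^sub>R g x)"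
    using is_weak_derivD[OF fg test_functions_scaleR[OF \<psi> \<phi>]] by simp
  moreover have "(LINT x|lebesgue. (\<psi> x *\<^sub>R ?\<phi>' x + ?\<psi>' x *\<^sub>R \<phi> x) *\<^sub>R f x)
    = (LINT x|lebesgue. \<psi> x *\<^sub>R ?\<phi>' x *\<^sub>R f x) + (LINT x|lebesgue. ?\<psi>' x *\<^sub>R \<phi> x *\<^sub>R f x)"
    using integrable_test_scaleR[OF \<psi> loc'(1)] integrable_test_scaleR[OF test_functions_vector_derivative[OF \<psi>] loc_\<phi>f]
    by (simp add: scaleR_add_left)
  moreover have "(LINT x|lebesgue. \<psi> x *\<^sub>R (?\<phi>' x *\<^sub>R f x + \<phi> x *\<^sub>R g x))
    = (LINT x|lebesgue. \<psi> x *\<^sub>R ?\<phi>' x *\<^sub>R f x) + (LINT x|lebesgue. \<psi> x *\<^sub>R \<phi> x *\<^sub>R g x)"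
    using integrable_test_scaleR[OF \<psi> loc'(1)] integrable_test_scaleR[OF \<psi> loc'(2)]
    by (simp add: scaleR_add_right)
  ultimately show "(LINT x|lebesgue. ?\<psi>' x *\<^sub>R \<phi> x *\<^sub>R f x) = - (LINT x|lebesgue. \<psi> x *\<^sub>R (?\<phi>' x *\<^sub>R f x + \<phi> x *\<^sub>R g x))"
    by (simp add: algebra_simps)
qed

text \<open>The sign is explicit because \<open>integral\<close> over an empty interval is
  0.\<close>

definition primitive :: "(real \<Rightarrow> 'a::euclidean_space) \<Rightarrow> real \<Rightarrow> 'a" where
  "primitive f x = (if 0 \<le> x then integral {0..x} f else - integral {x..0} f)"

lemma primitive_diff:
  assumes "locally_integrable f" "a \<le> b"
  shows "primitive f b - primitive f a = integral {a..b} f"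
proof -
  have int: "f integrable_on {x..y}" for x y
    by (rule locally_integrable_integrable_on[OF assms(1)])
  consider "0 \<le> a" | "a < 0" "0 \<le> b" | "b < 0" by linarith
  then show ?thesis
    using assms(2) Henstock_Kurzweil_Integration.integral_combine[OF _ _ int, of 0 a b]
      Henstock_Kurzweil_Integration.integral_combine[OF _ _ int, of a 0 b]
      Henstock_Kurzweil_Integration.integral_combine[OF _ _ int, of a b 0]
    by cases (auto simp: primitive_def algebra_simps)
qed

lemma continuous_primitive:
  assumes "locally_integrable f"
  shows "continuous_on UNIV (primitive f)"
proof -
  have "isCont (primitive f) x" for x
  proof -
    have "continuous_on {x - 1..x + 1} (\<lambda>y. primitive f (x - 1) + integral {x - 1..y} f)"
      by (intro continuous_intros indefinite_integral_continuous_1 locally_integrable_integrable_on assms)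
    moreover have "primitive f (x - 1) + integral {x - 1..y} f = primitive f y" if "y \<in> {x - 1..x + 1}" for y
      using primitive_diff[OF assms, of "x - 1" y] that by (simp flip: diff_eq_eq add: eq_commute)
    ultimately have "continuous_on {x - 1..x + 1} (primitive f)"
      by (metis (no_types, lifting) continuous_on_cong)
    then show ?thesis
      by (rule continuous_on_interior) auto
  qed
  then show ?thesis by (simp add: continuous_on_eq_continuous_within)
qed

lemma test_functions_integral_vector_derivative:
  fixes \<psi> :: "real \<Rightarrow> real"
  assumes "\<psi> \<in> test_functions" "a \<le> b"
  shows "((\<lambda>x. vector_derivative \<psi> (at x)) has_integral (\<psi> b - \<psi> a)) {a..b}"
  using test_functions_has_vector_derivative[OF assms(1)]
  by (intro fundamental_theorem_of_calculus assms(2)) (auto intro: has_vector_derivative_at_within)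

lemma sigma_finite_lebesgue: "sigma_finite_measure (lebesgue :: real measure)"
proof
  let ?A = "range (\<lambda>n::nat. {-real n..real n})"
  have "x \<in> \<Union> ?A" for x
  proof -
    obtain n :: nat where "\<bar>x\<bar> \<le> real n" using real_arch_simple by blast
    then have "x \<in> {-real n..real n}" by (simp add: abs_le_iff)
    then show ?thesis by blast
  qed
  then show "\<exists>A::real set set. countable A \<and> A \<subseteq> sets lebesgue \<and> \<Union> A = space lebesgue \<and> (\<forall>a\<in>A. emeasure lebesgue a \<noteq> \<infinity>)"
    by (intro exI[of _ ?A]) auto
qed

text \<open>Fubini's theorem for \<open>\<psi>'(x) f(t)\<close> on the triangle \<open>-R \<le> t \<le> x \<le> R\<close>.\<close>

lemma is_weak_deriv_primitive:
  assumes f: "locally_integrable f"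
  shows "is_weak_deriv (primitive f) f"
  unfolding is_weak_deriv_def
proof (intro conjI allI impI f)
  show loc: "locally_integrable (primitive f)"
    by (intro locally_integrable_continuous continuous_primitive f)
  fix \<psi> :: "real \<Rightarrow> real" assume \<psi>: "\<psi> \<in> test_functions"
  let ?\<psi>' = "\<lambda>x. vector_derivative \<psi> (at x)"
  have \<psi>': "?\<psi>' \<in> test_functions" using test_functions_vector_derivative[OF \<psi>] .
  obtain R1 where R1: "R1 > 0" "\<And>x. \<bar>x\<bar> > R1 \<Longrightarrow> \<psi> x = 0"
    using test_functions_support[OF \<psi>] by blast
  obtain R2 where R2: "R2 > 0" "\<And>x. \<bar>x\<bar> > R2 \<Longrightarrow> ?\<psi>' x = 0"
    using test_functions_support[OF \<psi>'] by blast
  \<comment> \<open>The support bounds are strict; the extra 1 makes \<open>\<psi>\<close> and its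
    derivative vanish at the end points as well.\<close>
  define R where "R = max R1 R2 + 1"
  have R: "R > 0" "\<And>x. \<bar>x\<bar> \<ge> R \<Longrightarrow> \<psi> x = 0" "\<And>x. \<bar>x\<bar> \<ge> R \<Longrightarrow> ?\<psi>' x = 0"
    using R1 R2 by (auto simp: R_def)
  interpret L: sigma_finite_measure "lebesgue :: real measure" by (rule sigma_finite_lebesgue)
  interpret pair_sigma_finite "lebesgue :: real measure" "lebesgue :: real measure" ..
  define g where "g t = indicator {-R..R} t *\<^sub>R f t" for t
  have g: "integrable lebesgue g"
    using f unfolding g_def locally_integrable_interval by blast
  have \<psi>'_int: "integrable lebesgue ?\<psi>'"
    using integrable_test_scaleR[OF \<psi>' locally_integrable_continuous[of "\<lambda>_. 1::real"]] by (auto intro: continuous_intros)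
  have [measurable]: "g \<in> borel_measurable lebesgue" "?\<psi>' \<in> borel_measurable lebesgue"
    using g \<psi>'_int by auto
  define H where "H = (\<lambda>(x, t). (if t \<le> x then ?\<psi>' x else 0) *\<^sub>R g t)"
  have [measurable]: "H \<in> borel_measurable (lebesgue \<Otimes>\<^sub>M lebesgue)"
  proof -
    have [measurable]: "(\<lambda>p. fst p) \<in> borel_measurable (lebesgue \<Otimes>\<^sub>M (lebesgue::real measure))"
      by (rule measurable_compose[OF measurable_fst borel_measurable_lebesgue_ident])
    have [measurable]: "(\<lambda>p. snd p) \<in> borel_measurable ((lebesgue::real measure) \<Otimes>\<^sub>M lebesgue)"
      by (rule measurable_compose[OF measurable_snd borel_measurable_lebesgue_ident])
    have [measurable]: "(\<lambda>p. ?\<psi>' (fst p)) \<in> borel_measurable (lebesgue \<Otimes>\<^sub>M (lebesgue::real measure))"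
      by (rule measurable_compose[OF measurable_fst]) measurable
    have [measurable]: "(\<lambda>p. g (snd p)) \<in> borel_measurable ((lebesgue::real measure) \<Otimes>\<^sub>M lebesgue)"
      by (rule measurable_compose[OF measurable_snd]) measurable
    show ?thesis unfolding H_def split_beta by measurable
  qed
  have "integrable (lebesgue \<Otimes>\<^sub>M lebesgue) (\<lambda>p. ?\<psi>' (fst p) *\<^sub>R g (snd p))"
  proof (rule Fubini_integrable)
    show "(\<lambda>p. ?\<psi>' (fst p) *\<^sub>R g (snd p)) \<in> borel_measurable (lebesgue \<Otimes>\<^sub>M lebesgue)"
      by (intro borel_measurable_scaleR measurable_compose[OF measurable_fst] measurable_compose[OF measurable_snd]) measurable
    show "integrable lebesgue (\<lambda>x. LINT y|lebesgue. norm (?\<psi>' (fst (x, y)) *\<^sub>R g (snd (x, y))))"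
      using \<psi>'_int by auto
    show "AE x in lebesgue. integrable lebesgue (\<lambda>y. ?\<psi>' (fst (x, y)) *\<^sub>R g (snd (x, y)))"
      using g by auto
  qed
  then have H: "integrable (lebesgue \<Otimes>\<^sub>M lebesgue) H"
    by (rule Bochner_Integration.integrable_bound) (auto simp: H_def)
  have inner1: "(LINT t|lebesgue. H (x, t)) = ?\<psi>' x *\<^sub>R (primitive f x - primitive f (-R))" for x
  proof (cases "\<bar>x\<bar> \<le> R")
    case True
    have "(LINT t|lebesgue. H (x, t)) = ?\<psi>' x *\<^sub>R (LINT t:{-R..x}|lebesgue. f t)"
      unfolding set_lebesgue_integral_def integral_scaleR_right[symmetric]
      by (rule Bochner_Integration.integral_cong) (use True in \<open>auto simp: H_def g_def indicator_def\<close>)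
    also have "\<dots> = ?\<psi>' x *\<^sub>R (primitive f x - primitive f (-R))"
      using True primitive_diff[OF f, of "-R" x]
      by (simp add: set_lebesgue_integral_eq_integral(2)[OF locally_integrable_absolutely_integrable[OF f]])
    finally show ?thesis .
  next
    case False
    then have "?\<psi>' x = 0" using R(3) by auto
    then have "H (x, t) = 0" for t by (simp add: H_def)
    with \<open>?\<psi>' x = 0\<close> show ?thesis by simp
  qed
  have inner2: "(LINT x|lebesgue. H (x, t)) = - (\<psi> t *\<^sub>R f t)" for t
  proof (cases "\<bar>t\<bar> \<le> R")
    case True
    have "(LINT x|lebesgue. H (x, t)) = (LINT x|lebesgue. indicator {t..R} x *\<^sub>R ?\<psi>' x) *\<^sub>R f t"
    proof (subst integral_scaleR_left[symmetric])
      show "integrable lebesgue (\<lambda>x. indicator {t..R} x *\<^sub>R ?\<psi>' x)" if "f t \<noteq> 0"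
        by (intro integrable_mult_indicator \<psi>'_int) auto
      show "(LINT x|lebesgue. H (x, t)) = (LINT x|lebesgue. (indicator {t..R} x *\<^sub>R ?\<psi>' x) *\<^sub>R f t)"
        by (rule Bochner_Integration.integral_cong)
           (use True R(3) in \<open>auto simp: H_def g_def indicator_def\<close>)
    qed
    also have "(LINT x|lebesgue. indicator {t..R} x *\<^sub>R ?\<psi>' x) = integral {t..R} ?\<psi>'"
      unfolding set_lebesgue_integral_def[symmetric]
      by (intro set_lebesgue_integral_eq_integral(2) locally_integrable_absolutely_integrable locally_integrable_continuous
          test_functions_continuous \<psi>')
    also have "\<dots> = - \<psi> t"
      using test_functions_integral_vector_derivative[OF \<psi>, of t R] True R by (simp add: integral_unique)
    finally show ?thesis by simp
  next
    case False
    then have "\<psi> t = 0" "g t = 0" using R(2) by (auto simp: g_def indicator_def)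
    then show ?thesis by (simp add: H_def)
  qed
  have "(LINT x|lebesgue. ?\<psi>' x *\<^sub>R (primitive f x - primitive f (-R))) = (LINT t|lebesgue. - (\<psi> t *\<^sub>R f t))"
    using Fubini_integral[of "\<lambda>x t. H (x, t)"] H by (simp add: inner1 inner2)
  \<comment> \<open>The constant \<open>primitive f (-R)\<close> drops out because the derivative of
    a test function has integral zero.\<close>
  moreover have "(LINT x|lebesgue. ?\<psi>' x *\<^sub>R (primitive f x - primitive f (-R))) = (LINT x|lebesgue. ?\<psi>' x *\<^sub>R primitive f x)"
  proof -
    have "(LINT x|lebesgue. ?\<psi>' x) = (LINT x:{-R..R}|lebesgue. ?\<psi>' x)"
      unfolding set_lebesgue_integral_def
      by (rule Bochner_Integration.integral_cong) (use R(3) in \<open>force simp: indicator_def\<close>)+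
    also have "\<dots> = integral {-R..R} ?\<psi>'"
      by (intro set_lebesgue_integral_eq_integral(2) locally_integrable_absolutely_integrable locally_integrable_continuous
          test_functions_continuous \<psi>')
    also have "\<dots> = 0"
      using test_functions_integral_vector_derivative[OF \<psi>, of "-R" R] R by (simp add: integral_unique)
    finally have "(LINT x|lebesgue. ?\<psi>' x) = 0" .
    then show ?thesis
      using integrable_test_scaleR[OF \<psi>' loc] \<psi>'_int by (simp add: scaleR_diff_right)
  qed
  ultimately show "(LINT x|lebesgue. ?\<psi>' x *\<^sub>R primitive f x) = - (LINT x|lebesgue. \<psi> x *\<^sub>R f x)"
    by simp
qed

text \<open>Mean zero is exactly what brings the primitive started at \<open>-R\<close> back to 0
  beyond \<open>R\<close>. These are the test functions about which a vanishing weak derivative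
  gives information.\<close>

lemma test_functions_primitive:
  fixes \<theta> :: "real \<Rightarrow> real"
  assumes \<theta>: "\<theta> \<in> test_functions" and zero: "(LINT x|lebesgue. \<theta> x) = 0"
  obtains \<psi> where "\<psi> \<in> test_functions" "\<And>x. vector_derivative \<psi> (at x) = \<theta> x"
proof -
  have loc: "locally_integrable \<theta>"
    by (intro locally_integrable_continuous test_functions_continuous \<theta>)
  obtain R where R: "R > 0" "\<And>x. \<bar>x\<bar> > R \<Longrightarrow> \<theta> x = 0"
    using test_functions_support[OF \<theta>] by blast
  define \<psi> where "\<psi> x = primitive \<theta> x - primitive \<theta> (-R)" for x
  have deriv: "(\<psi> has_vector_derivative \<theta> x) (at x)" for x
  proof -
    have "((\<lambda>y. primitive \<theta> (x - 1) - primitive \<theta> (-R) + integral {x - 1..y} \<theta>) has_vector_derivative 0 + \<theta> x) (at x within {x - 1..x + 1})"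
      by (intro has_vector_derivative_add has_vector_derivative_const integral_has_vector_derivative
          test_functions_continuous \<theta>) auto
    then have "(\<psi> has_vector_derivative 0 + \<theta> x) (at x within {x - 1..x + 1})"
    proof (rule has_vector_derivative_transform[rotated 2])
      show "\<psi> y = primitive \<theta> (x - 1) - primitive \<theta> (- R) + integral {x - 1..y} \<theta>" if "y \<in> {x - 1..x + 1}" for y
        using primitive_diff[OF loc, of "x - 1" y] that by (simp add: \<psi>_def)
    qed simp
    then show ?thesis by (simp add: at_within_Icc_at)
  qed
  have "C_k k \<psi>" for k
    by (rule C_k_SucD[OF C_k_SucI[OF deriv test_functions_C_k[OF \<theta>]]])
  moreover have "\<psi> x = 0" if "\<bar>x\<bar> > R" for x
  proof (cases "x > R")
    case True
    have "0 = (LINT y:{-R..x}|lebesgue. \<theta> y)"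
      unfolding set_lebesgue_integral_def zero[symmetric]
      by (rule Bochner_Integration.integral_cong) (use R(2) True in \<open>force simp: indicator_def\<close>)+
    also have "\<dots> = \<psi> x"
      using True R(1) primitive_diff[OF loc, of "-R" x]
      by (simp add: \<psi>_def set_lebesgue_integral_eq_integral(2)[OF locally_integrable_absolutely_integrable[OF loc]])
    finally show ?thesis by simp
  next
    case False
    with that have x: "x < -R" by linarith
    have "integral {x..-R} \<theta> = integral {x..-R} (\<lambda>_. 0)"
    proof (rule integral_spike[of "{-R}"])
      show "0 = \<theta> y" if "y \<in> {x..-R} - {-R}" for y
        using R(2)[of y] that R(1) by auto
    qed simp
    then show ?thesis
      using primitive_diff[OF loc, of x "-R"] x by (simp add: \<psi>_def)
  qed
  ultimately have "\<psi> \<in> test_functions"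
    by (intro test_functionsI[of _ R]) (metis not_le)+
  then show ?thesis
    using that vector_derivative_at[OF deriv] by blast
qed

text \<open>Here \<open>h = f - primitive g\<close> has weak derivative zero, so it is orthogonal to
  all test functions of mean zero. Subtracting from an arbitrary \<open>\<phi>\<close> the multiple
  of one fixed bump that has the same integral reduces to that case, and \<open>C\<close> is the
  average of \<open>h\<close> against the normalized bump.\<close>

theorem du_Bois_Reymond:
  fixes f :: "real \<Rightarrow> 'a::euclidean_space"
  assumes "is_weak_deriv f g"
  obtains C where "AE x in lebesgue. f x = C + primitive g x"
proof -
  have loc: "locally_integrable f" "locally_integrable g"
    using assms by (auto simp: is_weak_deriv_def)
  define h where "h x = f x + - primitive g x" for x
  have h: "locally_integrable h"
    unfolding h_def by (intro locally_integrable_add locally_integrable_uminus loc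
        locally_integrable_continuous continuous_primitive)
  have h0: "(LINT x|lebesgue. vector_derivative \<psi> (at x) *\<^sub>R h x) = 0" if \<psi>: "\<psi> \<in> test_functions" for \<psi> :: "real \<Rightarrow> real"
  proof -
    have "integrable lebesgue (\<lambda>x. vector_derivative \<psi> (at x) *\<^sub>R f x)"
      "integrable lebesgue (\<lambda>x. vector_derivative \<psi> (at x) *\<^sub>R primitive g x)"
      by (intro integrable_test_scaleR test_functions_vector_derivative \<psi> loc
        locally_integrable_continuous continuous_primitive)+
    then show ?thesis
      using is_weak_derivD[OF assms \<psi>] is_weak_derivD[OF is_weak_deriv_primitive[OF loc(2)] \<psi>]
      by (simp add: h_def scaleR_diff_right)
  qed
  let ?\<chi> = "bump 0 1 1"
  have int_test: "integrable lebesgue \<phi>" if "\<phi> \<in> test_functions" for \<phi> :: "real \<Rightarrow> real"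
    using integrable_test_scaleR[OF that locally_integrable_continuous[of "\<lambda>_. 1::real"]]
    by (auto intro: continuous_intros)
  define I where "I = (LINT x|lebesgue. ?\<chi> x)"
  have "I \<noteq> 0"
  proof
    assume "I = 0"
    then have "AE x in lebesgue. ?\<chi> x = 0"
      unfolding I_def using integral_nonneg_eq_0_iff_AE[OF int_test[OF bump_test]] bump_bounds by auto
    then have "AE x in lebesgue. x \<notin> {0<..<1::real}"
    proof eventually_elim
      case (elim x)
      then show ?case
        using flat_pos[of x 0] flat_pos[of "1 - x" 0] by (auto simp: bump_alt)
    qed
    then have "{0<..<1::real} \<in> null_sets lebesgue"
      using AE_iff_null_sets[of "{0<..<1::real}" lebesgue] by simp
    then have "emeasure lebesgue {0<..<1::real} = 0" by (rule null_setsD1)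
    then show False by simp
  qed
  define C where "C = (LINT x|lebesgue. ?\<chi> x *\<^sub>R h x) /\<^sub>R I"
  have "AE x in lebesgue. h x + - C = 0"
  proof (rule fundamental_lemma)
    show "locally_integrable (\<lambda>x. h x + - C)"
      by (intro locally_integrable_add h locally_integrable_continuous continuous_intros)
    fix \<phi> :: "real \<Rightarrow> real" assume \<phi>: "\<phi> \<in> test_functions"
    define J where "J = (LINT x|lebesgue. \<phi> x)"
    define \<theta> where "\<theta> x = \<phi> x + (- J / I) *\<^sub>R ?\<chi> x" for x
    have \<theta>: "\<theta> \<in> test_functions"
      unfolding \<theta>_def[abs_def]
      by (intro test_functions_add \<phi> test_functions_bounded_linear[OF bounded_linear_scaleR_right] bump_test)
    have "(LINT x|lebesgue. \<theta> x) = 0"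
      using int_test[OF \<phi>] int_test[OF bump_test] \<open>I \<noteq> 0\<close>
      by (simp add: \<theta>_def I_def J_def)
    then obtain \<psi> where "\<psi> \<in> test_functions" "\<And>x. vector_derivative \<psi> (at x) = \<theta> x"
      using test_functions_primitive[OF \<theta>] by blast
    then have "(LINT x|lebesgue. \<theta> x *\<^sub>R h x) = 0"
      using h0[of \<psi>] by simp
    moreover have "(LINT x|lebesgue. \<theta> x *\<^sub>R h x) = (LINT x|lebesgue. \<phi> x *\<^sub>R h x) - J *\<^sub>R C"
    proof -
      have "(LINT x|lebesgue. \<theta> x *\<^sub>R h x) = (LINT x|lebesgue. \<phi> x *\<^sub>R h x + (- J / I) *\<^sub>R ?\<chi> x *\<^sub>R h x)"
        by (simp add: \<theta>_def scaleR_add_left scaleR_diff_left)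
      also have "\<dots> = (LINT x|lebesgue. \<phi> x *\<^sub>R h x) + (LINT x|lebesgue. (- J / I) *\<^sub>R ?\<chi> x *\<^sub>R h x)"
        by (intro Bochner_Integration.integral_add integrable_scaleR_right integrable_test_scaleR \<phi> h bump_test)
      also have "(LINT x|lebesgue. (- J / I) *\<^sub>R ?\<chi> x *\<^sub>R h x) = - (J *\<^sub>R C)"
        by (subst integral_scaleR_right) (simp add: C_def divide_inverse)
      finally show ?thesis by simp
    qed
    moreover have "(LINT x|lebesgue. \<phi> x *\<^sub>R (h x + - C)) = (LINT x|lebesgue. \<phi> x *\<^sub>R h x) - J *\<^sub>R C"
      using integrable_test_scaleR[OF \<phi> h] int_test[OF \<phi>]
      by (simp add: scaleR_diff_right J_def)
    ultimately show "(LINT x|lebesgue. \<phi> x *\<^sub>R (h x + - C)) = 0" by simp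
  qed
  then have "AE x in lebesgue. f x = C + primitive g x"
    by eventually_elim (simp add: h_def algebra_simps add_eq_0_iff)
  then show ?thesis by (rule that)
qed

section \<open>Regularity away from the degenerate set\<close>

text \<open>A primitive does not see null sets: near \<open>x\<close> it is a constant plus the
  integral of the continuous \<open>V\<close>, and the classical fundamental theorem applies at
  every point.\<close>

lemma primitive_has_vector_derivative:
  assumes g: "locally_integrable g" and "open S" "x \<in> S" and V: "continuous_on S V"
    and ae: "AE y in lebesgue. y \<in> S \<longrightarrow> g y = V y"
  shows "(primitive g has_vector_derivative V x) (at x)"
proof -
  obtain e where e: "e > 0" "cball x e \<subseteq> S"
    using open_contains_cball \<open>open S\<close> \<open>x \<in> S\<close> by blast
  then have sub: "{x - e..x + e} \<subseteq> S" by (simp add: cball_eq_atLeastAtMost)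
  obtain N where N: "\<And>y. y \<in> space lebesgue - N \<Longrightarrow> y \<in> S \<longrightarrow> g y = V y" "N \<in> null_sets lebesgue"
    using AE_E3[OF ae] by blast
  have prim: "primitive g y = primitive g (x - e) + integral {x - e..y} V" if y: "y \<in> {x - e..x + e}" for y
  proof -
    have "integral {x - e..y} g = integral {x - e..y} V"
    proof (rule integral_spike[of N])
      show "negligible N" using N(2) by (simp add: negligible_iff_null_sets)
      fix z assume z: "z \<in> {x - e..y} - N"
      then have "z \<in> S" using sub y by auto
      then show "V z = g z" using N(1)[of z] z by simp
    qed
    with primitive_diff[OF g, of "x - e" y] y show ?thesis by (simp add: diff_eq_eq add.commute)
  qed
  have "((\<lambda>y. primitive g (x - e) + integral {x - e..y} V) has_vector_derivative 0 + V x) (at x within {x - e..x + e})"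
    by (intro has_vector_derivative_add has_vector_derivative_const integral_has_vector_derivative
        continuous_on_subset[OF V sub]) (use e in auto)
  then have "(primitive g has_vector_derivative 0 + V x) (at x within {x - e..x + e})"
  proof (rule has_vector_derivative_transform[rotated 2])
    show "primitive g y = primitive g (x - e) + integral {x - e..y} V" if "y \<in> {x - e..x + e}" for y
      by (rule prim[OF that])
  qed (use e in simp)
  then show ?thesis using e by (simp add: at_within_Icc_at)
qed

lemma L2_imp_locally_integrable:
  fixes f :: "real \<Rightarrow> 'a::{banach, second_countable_topology}"
  assumes "f \<in> L2"
  shows "locally_integrable f" "locally_integrable (\<lambda>x. (norm (f x))\<^sup>2)"
proof -
  have meas [measurable]: "f \<in> borel_measurable lebesgue" and int: "integrable lebesgue (\<lambda>x. (norm (f x))\<^sup>2)"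
    using assms by (auto simp: L2_def)
  show sq: "locally_integrable (\<lambda>x. (norm (f x))\<^sup>2)"
    unfolding locally_integrable_interval by (intro allI integrable_mult_indicator int) simp
  have "locally_integrable (\<lambda>x. 1 + (norm (f x))\<^sup>2)"
    by (intro locally_integrable_add sq locally_integrable_continuous continuous_intros)
  then show "locally_integrable f"
  proof (rule locally_integrableI_bound[OF _ meas])
    have "norm (f x) \<le> 1 * norm (1 + (norm (f x))\<^sup>2)" for x
    proof -
      have "0 \<le> (norm (f x) - 1)\<^sup>2" by simp
      then have "2 * norm (f x) \<le> 1 + (norm (f x))\<^sup>2" by (simp add: power2_eq_square algebra_simps)
      moreover have "norm (1 + (norm (f x))\<^sup>2) = 1 + (norm (f x))\<^sup>2" by simp
      ultimately show ?thesis using norm_ge_zero[of "f x"] by linarith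
    qed
    then show "\<exists>B. AE x in lebesgue. \<bar>x\<bar> \<le> R \<longrightarrow> norm (f x) \<le> B * norm (1 + (norm (f x))\<^sup>2)" for R
      by blast
  qed
qed

definition coeff_A :: "real \<Rightarrow> complex \<Rightarrow> real" where
  "coeff_A \<kappa> w = 1 - 2 * \<kappa> * (norm w)\<^sup>2"

text \<open>The flux \<open>m = u' - 2\<kappa>\<langle>u, u'\<rangle>u\<close> has a locally integrable derivative, and \<open>u'\<close> can be recovered
  from \<open>u\<close> and \<open>m\<close> wherever \<open>1 - 2\<kappa>|u|\<^sup>2 \<noteq> 0\<close>.\<close>

definition velocity :: "real \<Rightarrow> complex \<Rightarrow> complex \<Rightarrow> complex" where
  "velocity \<kappa> w m = m + (2 * \<kappa> * inner w m / coeff_A \<kappa> w) *\<^sub>R w"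

text \<open>The last term is the half of \<langle>u, \<phi>\<rangle>' in which the derivative falls
  on u; the half with \<phi>' goes into the flux.\<close>

definition force :: "real \<Rightarrow> real \<Rightarrow> complex \<Rightarrow> complex \<Rightarrow> complex" where
  "force c \<kappa> w v = \<i> * complex_of_real c * v + (1 - (norm w)\<^sup>2) *\<^sub>R w + (2 * \<kappa> * inner w v) *\<^sub>R v"

lemma velocity_flux:
  assumes "coeff_A \<kappa> w \<noteq> 0" "m = v - (2 * \<kappa> * inner w v) *\<^sub>R w"
  shows "velocity \<kappa> w m = v"
proof -
  have "inner w m = inner w v * coeff_A \<kappa> w"
    by (simp add: assms(2) coeff_A_def inner_diff_right power2_norm_eq_inner algebra_simps)
  then have "2 * \<kappa> * inner w m / coeff_A \<kappa> w = 2 * \<kappa> * inner w v"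
    using assms(1) by simp
  then show ?thesis by (simp add: velocity_def assms(2))
qed

lemma flux_velocity:
  assumes "coeff_A \<kappa> w \<noteq> 0"
  shows "inner w (velocity \<kappa> w m) * coeff_A \<kappa> w = inner w m"
    and "m = velocity \<kappa> w m - (2 * \<kappa> * inner w (velocity \<kappa> w m)) *\<^sub>R w"
proof -
  show *: "inner w (velocity \<kappa> w m) * coeff_A \<kappa> w = inner w m"
    using assms by (simp add: velocity_def inner_add_right power2_norm_eq_inner[symmetric] field_simps)
       (simp add: coeff_A_def algebra_simps)
  then have "inner w (velocity \<kappa> w m) = inner w m / coeff_A \<kappa> w"
    using assms by (simp add: eq_divide_eq)
  then show "m = velocity \<kappa> w m - (2 * \<kappa> * inner w (velocity \<kappa> w m)) *\<^sub>R w"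
    by (simp add: velocity_def)
qed

locale weak_sol =
  fixes c \<kappa> :: real and u :: "real \<Rightarrow> complex"
  assumes weak: "weak_solution c \<kappa> u"
begin

lemma weak_deriv_u: "is_weak_deriv u (weak_deriv u)"
  using weak is_weak_deriv_weak_deriv
  by (auto simp: weak_solution_def energy_space_def H1_loc_def)

lemma weak_deriv_L2: "weak_deriv u \<in> L2"
  using weak by (simp add: weak_solution_def energy_space_def)

text \<open>\<open>U\<close> and \<open>M\<close> are the continuous representatives of
  \<open>u\<close> and of its flux, both supplied by \<open>du_Bois_Reymond\<close>. Solving the
  flux for u' divides by \<open>coeff_A\<close>, hence the restriction to open sets where it does
  not vanish; \<open>S\<close> stays arbitrary because both the whole line and half-lines occur
  later.\<close>

lemma ex_regular:
  obtains U M where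
    "AE x in lebesgue. u x = U x" "\<And>x. U x = U 0 + primitive (weak_deriv u) x" "continuous_on UNIV M"
    "\<And>S. open S \<Longrightarrow> (\<And>x. x \<in> S \<Longrightarrow> coeff_A \<kappa> (U x) \<noteq> 0) \<Longrightarrow>
       (\<forall>x\<in>S. (U has_vector_derivative velocity \<kappa> (U x) (M x)) (at x) \<and>
              (M has_vector_derivative - force c \<kappa> (U x) (velocity \<kappa> (U x) (M x))) (at x)) \<and>
       (AE x in lebesgue. x \<in> S \<longrightarrow> weak_deriv u x = velocity \<kappa> (U x) (M x))"
proof -
  define g where "g = weak_deriv u"
  have g: "is_weak_deriv u g" "g \<in> L2"
    using weak_deriv_u weak_deriv_L2 by (auto simp: g_def)
  have g_loc: "locally_integrable g" and g2_loc: "locally_integrable (\<lambda>x. (norm (g x))\<^sup>2)"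
    using L2_imp_locally_integrable[OF g(2)] by auto
  have g_meas [measurable]: "g \<in> borel_measurable lebesgue"
    using g(2) by (simp add: L2_def)
  obtain C where C: "AE x in lebesgue. u x = C + primitive g x"
    using du_Bois_Reymond[OF g(1)] by blast
  define U where "U x = C + primitive g x" for x
  have U_cont: "continuous_on UNIV U"
    unfolding U_def[abs_def] by (intro continuous_intros continuous_primitive g_loc)
  note U_meas [measurable] = continuous_borel_measurable_lebesgue[OF U_cont]
  have uU: "AE x in lebesgue. u x = U x" using C by (simp add: U_def)
  define m where "m x = g x + - ((2 * \<kappa> * inner (U x) (g x)) *\<^sub>R U x)" for x
  define F where "F x = force c \<kappa> (U x) (g x)" for x
  have m_loc: "locally_integrable m"
    unfolding m_def
  proof (intro locally_integrable_add g_loc locally_integrable_uminus)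
    show "locally_integrable (\<lambda>x. (2 * \<kappa> * inner (U x) (g x)) *\<^sub>R U x)"
    proof (rule locally_integrableI_bound[OF g_loc])
      fix R
      obtain B where B: "B \<ge> 0" "\<And>x. \<bar>x\<bar> \<le> R \<Longrightarrow> norm (U x) \<le> B"
        using continuous_bounded_interval[OF U_cont, of R] by blast
      have "norm ((2 * \<kappa> * inner (U x) (g x)) *\<^sub>R U x) \<le> (2 * \<bar>\<kappa>\<bar> * B * B) * norm (g x)" if "\<bar>x\<bar> \<le> R" for x
      proof -
        have "norm ((2 * \<kappa> * inner (U x) (g x)) *\<^sub>R U x) = 2 * \<bar>\<kappa>\<bar> * \<bar>inner (U x) (g x)\<bar> * norm (U x)"
          by (simp add: abs_mult)
        also have "\<dots> \<le> 2 * \<bar>\<kappa>\<bar> * (B * norm (g x)) * B"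
          using B that by (intro mult_mono order_trans[OF Cauchy_Schwarz_ineq2] mult_left_mono) auto
        finally show ?thesis by (simp add: mult_ac)
      qed
      then show "\<exists>B. AE x in lebesgue. \<bar>x\<bar> \<le> R \<longrightarrow> norm ((2 * \<kappa> * inner (U x) (g x)) *\<^sub>R U x) \<le> B * norm (g x)"
        by blast
    qed measurable
  qed
  have F_loc: "locally_integrable F"
    unfolding F_def force_def
  proof (intro locally_integrable_add)
    show "locally_integrable (\<lambda>x. \<i> * complex_of_real c * g x)"
      by (rule locally_integrable_bounded_linear[OF bounded_linear_mult_right g_loc])
    show "locally_integrable (\<lambda>x. (1 - (norm (U x))\<^sup>2) *\<^sub>R U x)"
      by (intro locally_integrable_continuous continuous_intros U_cont)
    show "locally_integrable (\<lambda>x. (2 * \<kappa> * inner (U x) (g x)) *\<^sub>R g x)"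
    proof (rule locally_integrableI_bound[OF g2_loc])
      fix R
      obtain B where B: "B \<ge> 0" "\<And>x. \<bar>x\<bar> \<le> R \<Longrightarrow> norm (U x) \<le> B"
        using continuous_bounded_interval[OF U_cont, of R] by blast
      have "norm ((2 * \<kappa> * inner (U x) (g x)) *\<^sub>R g x) \<le> (2 * \<bar>\<kappa>\<bar> * B) * norm ((norm (g x))\<^sup>2)" if "\<bar>x\<bar> \<le> R" for x
      proof -
        have "norm ((2 * \<kappa> * inner (U x) (g x)) *\<^sub>R g x) = 2 * \<bar>\<kappa>\<bar> * \<bar>inner (U x) (g x)\<bar> * norm (g x)"
          by (simp add: abs_mult)
        also have "\<dots> \<le> 2 * \<bar>\<kappa>\<bar> * (B * norm (g x)) * norm (g x)"
          using B that by (intro mult_mono order_trans[OF Cauchy_Schwarz_ineq2] mult_left_mono) auto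
        finally show ?thesis by (simp add: mult_ac power2_eq_square)
      qed
      then show "\<exists>B. AE x in lebesgue. \<bar>x\<bar> \<le> R \<longrightarrow> norm ((2 * \<kappa> * inner (U x) (g x)) *\<^sub>R g x) \<le> B * norm ((norm (g x))\<^sup>2)"
        by blast
    qed measurable
  qed
  have "is_weak_deriv m (\<lambda>x. - F x)"
    unfolding is_weak_deriv_def
  proof (intro conjI allI impI m_loc locally_integrable_uminus F_loc)
    fix \<psi> :: "real \<Rightarrow> real" assume \<psi>: "\<psi> \<in> test_functions"
    let ?\<psi>' = "\<lambda>x. vector_derivative \<psi> (at x)"
    have intm: "integrable lebesgue (\<lambda>x. ?\<psi>' x *\<^sub>R m x)" and intF: "integrable lebesgue (\<lambda>x. \<psi> x *\<^sub>R F x)"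
      by (intro integrable_test_scaleR \<psi> test_functions_vector_derivative m_loc F_loc)+
    have "inner (LINT x|lebesgue. \<psi> x *\<^sub>R F x - ?\<psi>' x *\<^sub>R m x) z = 0" for z
    proof -
      \<comment> \<open>A real test function times a fixed direction \<open>z\<close> reduces the
        complex weak equation to a scalar one; varying \<open>z\<close> recovers the vector
        identity.\<close>
      define \<phi> where "\<phi> = (\<lambda>x. \<psi> x *\<^sub>R z)"
      have \<phi>: "\<phi> \<in> test_functions"
        unfolding \<phi>_def by (rule test_functions_bounded_linear[OF bounded_linear_scaleR_left \<psi>])
      have vd: "vector_derivative \<phi> (at x) = ?\<psi>' x *\<^sub>R z" for x
        unfolding \<phi>_def
        by (intro vector_derivative_at bounded_linear.has_vector_derivative[OF bounded_linear_scaleR_left]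
            test_functions_has_vector_derivative \<psi>)
      have "is_weak_deriv (\<lambda>y. \<psi> y *\<^sub>R inner (u y) z) (\<lambda>x. ?\<psi>' x *\<^sub>R inner (u x) z + \<psi> x *\<^sub>R inner (g x) z)"
        by (intro is_weak_deriv_test_scaleR \<psi> is_weak_deriv_bounded_linear[OF bounded_linear_inner_left] g)
      moreover have "(\<lambda>y. inner (u y) (\<phi> y)) = (\<lambda>y. \<psi> y *\<^sub>R inner (u y) z)"
        by (simp add: \<phi>_def)
      ultimately have wd0: "is_weak_deriv (\<lambda>y. inner (u y) (\<phi> y))
          (\<lambda>x. ?\<psi>' x *\<^sub>R inner (u x) z + \<psi> x *\<^sub>R inner (g x) z)" by simp
      then have wd: "AE x in lebesgue. weak_deriv (\<lambda>y. inner (u y) (\<phi> y)) x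
           = ?\<psi>' x *\<^sub>R inner (u x) z + \<psi> x *\<^sub>R inner (g x) z"
        using weak_deriv_eq by auto
      have "0 = (LINT x|lebesgue.
             inner (\<i> * complex_of_real c * weak_deriv u x
                      + u x * complex_of_real (1 - (norm (u x))\<^sup>2)) (\<phi> x)
           - inner (weak_deriv u x) (vector_derivative \<phi> (at x))
           + 2 * \<kappa> * inner (u x) (weak_deriv u x)
               * weak_deriv (\<lambda>y. inner (u y) (\<phi> y)) x)"
        using weak \<phi> by (simp add: weak_solution_def)
      also have "\<dots> = (LINT x|lebesgue. inner (\<psi> x *\<^sub>R F x - ?\<psi>' x *\<^sub>R m x) z)"
      proof (rule integral_cong_AE)
        show eq: "AE x in lebesgue. inner (\<i> * complex_of_real c * weak_deriv u x
                      + u x * complex_of_real (1 - (norm (u x))\<^sup>2)) (\<phi> x)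
           - inner (weak_deriv u x) (vector_derivative \<phi> (at x))
           + 2 * \<kappa> * inner (u x) (weak_deriv u x)
               * weak_deriv (\<lambda>y. inner (u y) (\<phi> y)) x = inner (\<psi> x *\<^sub>R F x - ?\<psi>' x *\<^sub>R m x) z"
          using wd uU
        proof eventually_elim
          case (elim x)
          have "U x * complex_of_real (1 - (norm (U x))\<^sup>2) = (1 - (norm (U x))\<^sup>2) *\<^sub>R U x"
            by (simp add: scaleR_conv_of_real)
          then show ?case
            unfolding elim vd
            by (simp add: \<phi>_def F_def m_def force_def inner_add_left inner_diff_left elim
                flip: g_def) (simp add: algebra_simps)
        qed
        show meas: "(\<lambda>x. inner (\<psi> x *\<^sub>R F x - ?\<psi>' x *\<^sub>R m x) z) \<in> borel_measurable lebesgue"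
          using intm intF by (intro borel_measurable_inner borel_measurable_diff borel_measurable_integrable) auto
        show "(\<lambda>x. inner (\<i> * complex_of_real c * weak_deriv u x
                      + u x * complex_of_real (1 - (norm (u x))\<^sup>2)) (\<phi> x)
           - inner (weak_deriv u x) (vector_derivative \<phi> (at x))
           + 2 * \<kappa> * inner (u x) (weak_deriv u x)
               * weak_deriv (\<lambda>y. inner (u y) (\<phi> y)) x) \<in> borel_measurable lebesgue"
        proof -
          have [measurable]: "u \<in> borel_measurable lebesgue" "weak_deriv u \<in> borel_measurable lebesgue"
            using g by (auto simp: g_def is_weak_deriv_def intro: locally_integrable_borel_measurable)
          have [measurable]: "\<phi> \<in> borel_measurable lebesgue" "(\<lambda>x. vector_derivative \<phi> (at x)) \<in> borel_measurable lebesgue"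
            by (intro continuous_borel_measurable_lebesgue test_functions_continuous test_functions_vector_derivative \<phi>)+
          have [measurable]: "weak_deriv (\<lambda>y. inner (u y) (\<phi> y)) \<in> borel_measurable lebesgue"
            using is_weak_deriv_weak_deriv[OF wd0] by (auto simp: is_weak_deriv_def intro: locally_integrable_borel_measurable)
          show ?thesis by measurable
        qed
      qed
      also have "\<dots> = inner (LINT x|lebesgue. \<psi> x *\<^sub>R F x - ?\<psi>' x *\<^sub>R m x) z"
        using intm intF by (intro integral_inner_left) auto
      finally show ?thesis by simp
    qed
    then have "(LINT x|lebesgue. \<psi> x *\<^sub>R F x - ?\<psi>' x *\<^sub>R m x) = 0"
      using inner_eq_zero_iff by blast
    then show "(LINT x|lebesgue. ?\<psi>' x *\<^sub>R m x) = - (LINT x|lebesgue. \<psi> x *\<^sub>R - F x)"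
      using intm intF by simp
  qed
  then obtain C' where C': "AE x in lebesgue. m x = C' + primitive (\<lambda>x. - F x) x"
    using du_Bois_Reymond by blast
  define M where "M x = C' + primitive (\<lambda>x. - F x) x" for x
  have M_cont: "continuous_on UNIV M"
    unfolding M_def[abs_def] by (intro continuous_intros continuous_primitive locally_integrable_uminus F_loc)
  have mM: "AE x in lebesgue. m x = M x" using C' by (simp add: M_def)
  show thesis
  proof (rule that[OF uU _ M_cont])
    show "U x = U 0 + primitive (weak_deriv u) x" for x
      by (simp add: U_def g_def primitive_def)
    fix S :: "real set"
    assume S: "open S" and A: "\<And>x. x \<in> S \<Longrightarrow> coeff_A \<kappa> (U x) \<noteq> 0"
    let ?V = "\<lambda>x. velocity \<kappa> (U x) (M x)"
    have V_cont: "continuous_on S ?V"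
      using A unfolding velocity_def coeff_A_def
      by (intro continuous_intros continuous_on_subset[OF U_cont] continuous_on_subset[OF M_cont]) auto
    \<comment> \<open>On \<open>S\<close> the weak derivative has a continuous representative, which
      turns the almost-everywhere information into derivatives at every point.\<close>
    have ae: "AE x in lebesgue. x \<in> S \<longrightarrow> g x = ?V x"
      using mM
    proof eventually_elim
      case (elim x)
      then have "M x = g x - (2 * \<kappa> * inner (U x) (g x)) *\<^sub>R U x" by (simp add: m_def)
      then show ?case using velocity_flux[OF A] by metis
    qed
    moreover have "(U has_vector_derivative ?V x) (at x)" if "x \<in> S" for x
    proof -
      have "(U has_vector_derivative 0 + ?V x) (at x)"
        unfolding U_def[abs_def]
        by (intro has_vector_derivative_add has_vector_derivative_const
            primitive_has_vector_derivative[OF g_loc S that, unfolded U_def[abs_def]])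
           (use V_cont ae in \<open>simp_all add: U_def\<close>)
      then show ?thesis by simp
    qed
    moreover have "(M has_vector_derivative - force c \<kappa> (U x) (?V x)) (at x)" if "x \<in> S" for x
    proof -
      have "(primitive (\<lambda>x. - F x) has_vector_derivative - force c \<kappa> (U x) (?V x)) (at x)"
      proof (rule primitive_has_vector_derivative[OF locally_integrable_uminus[OF F_loc] S that])
        show "continuous_on S (\<lambda>x. - force c \<kappa> (U x) (?V x))"
          unfolding force_def
          by (intro continuous_intros continuous_on_subset[OF U_cont] V_cont) auto
        show "AE x in lebesgue. x \<in> S \<longrightarrow> - F x = - force c \<kappa> (U x) (?V x)"
          using ae by eventually_elim (simp add: F_def)
      qed
      then have "(M has_vector_derivative 0 + - force c \<kappa> (U x) (?V x)) (at x)"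
        unfolding M_def[abs_def]
        by (intro has_vector_derivative_add has_vector_derivative_const)
      then show ?thesis by simp
    qed
    ultimately show "(\<forall>x\<in>S. (U has_vector_derivative ?V x) (at x) \<and>
              (M has_vector_derivative - force c \<kappa> (U x) (?V x)) (at x)) \<and>
       (AE x in lebesgue. x \<in> S \<longrightarrow> weak_deriv u x = ?V x)"
      by (auto simp: g_def)
  qed
qed

end

section \<open>Decay at infinity and first integrals\<close>

locale regular_solution =
  fixes c \<kappa> :: real and U M g :: "real \<Rightarrow> complex"
  assumes g_L2: "g \<in> L2"
    and eta_L2: "(\<lambda>x. 1 - (norm (U x))\<^sup>2) \<in> L2"
    and U_primitive: "\<And>x. U x = U 0 + primitive g x"
    and M_cont: "continuous_on UNIV M"
    and regular: "\<And>S. open S \<Longrightarrow> (\<And>x. x \<in> S \<Longrightarrow> coeff_A \<kappa> (U x) \<noteq> 0) \<Longrightarrow>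
       (\<forall>x\<in>S. (U has_vector_derivative velocity \<kappa> (U x) (M x)) (at x) \<and>
              (M has_vector_derivative - force c \<kappa> (U x) (velocity \<kappa> (U x) (M x))) (at x)) \<and>
       (AE x in lebesgue. x \<in> S \<longrightarrow> g x = velocity \<kappa> (U x) (M x))"
begin

text \<open>In the notation of the paper, \<open>h = \<eta>\<close>, \<open>V = u'\<close> and \<open>p = \<langle>u, u'\<rangle> = - \<eta>'/2\<close>; the last two only where \<open>A \<noteq> 0\<close>.\<close>

definition h :: "real \<Rightarrow> real" where "h x = 1 - (norm (U x))\<^sup>2"
definition V :: "real \<Rightarrow> complex" where "V x = velocity \<kappa> (U x) (M x)"
definition p :: "real \<Rightarrow> real" where "p x = inner (U x) (V x)"
definition A :: "real \<Rightarrow> real" where "A x = coeff_A \<kappa> (U x)"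

lemma norm_U: "(norm (U x))\<^sup>2 = 1 - h x"
  by (simp add: h_def)

lemma h_le_1: "h x \<le> 1"
  by (simp add: h_def)

lemma A_alt: "A x = 1 - 2 * \<kappa> + 2 * \<kappa> * h x"
  by (simp add: A_def coeff_A_def h_def algebra_simps)

lemma g_loc: "locally_integrable g" "locally_integrable (\<lambda>x. (norm (g x))\<^sup>2)"
  using L2_imp_locally_integrable[OF g_L2] by auto

lemma U_cont: "continuous_on UNIV U"
proof -
  have "continuous_on UNIV (\<lambda>x. U 0 + primitive g x)"
    by (intro continuous_intros continuous_primitive g_loc)
  then show ?thesis by (simp only: U_primitive[symmetric])
qed

lemma h_cont: "continuous_on UNIV h"
  unfolding h_def by (intro continuous_intros U_cont)

lemma A_cont: "continuous_on UNIV A"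
  unfolding A_alt[abs_def] by (intro continuous_intros h_cont)

lemma V_cont: "(\<And>x. x \<in> S \<Longrightarrow> A x \<noteq> 0) \<Longrightarrow> continuous_on S V"
  unfolding V_def velocity_def A_def[symmetric]
  by (intro continuous_intros continuous_on_subset[OF U_cont] continuous_on_subset[OF M_cont]
      continuous_on_subset[OF A_cont]) auto

lemma energy_integrable: "integrable lebesgue (\<lambda>x. (norm (g x))\<^sup>2)" "integrable lebesgue (\<lambda>x. (h x)\<^sup>2)"
  using g_L2 eta_L2 by (auto simp: L2_def h_def)

lemma U_diff:
  "x \<le> y \<Longrightarrow> U y - U x = integral {x..y} g"
  using primitive_diff[OF g_loc(1), of x y] U_primitive[of x] U_primitive[of y] by simp

text \<open>The energy outside \<open>[-n, n]\<close> tends to zero by dominated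
  convergence.\<close>

lemma unit_interval_bound:
  assumes "r > 0"
  obtains R where "\<And>x. \<bar>x\<bar> \<ge> R \<Longrightarrow> integral {x..x + 1} (\<lambda>y. (norm (g y))\<^sup>2) + integral {x..x + 1} (\<lambda>y. (h y)\<^sup>2) < r"
proof -
  define f where "f x = (norm (g x))\<^sup>2 + (h x)\<^sup>2" for x
  have f: "integrable lebesgue f" unfolding f_def by (intro Bochner_Integration.integrable_add energy_integrable)
  have f_nonneg: "f x \<ge> 0" for x by (simp add: f_def)
  have [measurable]: "f \<in> borel_measurable lebesgue" using f by auto
  have "(\<lambda>n. LINT y|lebesgue. indicator {y. \<bar>y\<bar> \<ge> real n} y *\<^sub>R f y) \<longlonglongrightarrow> (LINT y|(lebesgue :: real measure). 0)"
  proof (rule integral_dominated_convergence)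
    show "integrable lebesgue f" by (rule f)
    show "AE y in lebesgue. (\<lambda>n. indicator {y. \<bar>y\<bar> \<ge> real n} y *\<^sub>R f y) \<longlonglongrightarrow> 0"
    proof (intro AE_I2 Lim_transform_eventually[OF tendsto_const])
      fix y :: real
      obtain N :: nat where "\<bar>y\<bar> < real N" using reals_Archimedean2 by blast
      then show "\<forall>\<^sub>F n in sequentially. 0 = indicator {y. \<bar>y\<bar> \<ge> real n} y *\<^sub>R f y"
        by (intro eventually_sequentiallyI[of N]) (auto simp: indicator_def)
    qed
    show "AE y in lebesgue. norm (indicator {y. \<bar>y\<bar> \<ge> real n} y *\<^sub>R f y) \<le> f y" for n
      using f_nonneg by (intro AE_I2) (auto simp: indicator_def)
    show "(\<lambda>y. indicator {y. \<bar>y\<bar> \<ge> real n} y *\<^sub>R f y) \<in> borel_measurable lebesgue" for n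
    proof -
      have "closed {y::real. \<bar>y\<bar> \<ge> real n}" by (intro closed_Collect_le continuous_intros)
      then have [measurable]: "{y::real. \<bar>y\<bar> \<ge> real n} \<in> sets lebesgue" by simp
      show ?thesis by measurable
    qed
  qed simp
  then have "\<forall>\<^sub>F n in sequentially. (LINT y|lebesgue. indicator {y. \<bar>y\<bar> \<ge> real n} y *\<^sub>R f y) < r"
    using assms by (intro order_tendstoD(2)[where y = 0]) auto
  then obtain n where n: "(LINT y|lebesgue. indicator {y. \<bar>y\<bar> \<ge> real n} y *\<^sub>R f y) < r"
    using eventually_happens' sequentially_bot by blast
  \<comment> \<open>The extra 1 is for negative \<open>x\<close>: the interval reaches up to
    \<open>x + 1\<close>, which must still be at most \<open>- real n\<close>.\<close>
  have "integral {x..x + 1} (\<lambda>y. (norm (g y))\<^sup>2) + integral {x..x + 1} (\<lambda>y. (h y)\<^sup>2) < r" if x: "\<bar>x\<bar> \<ge> real n + 1" for x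
  proof -
    have sub: "{x..x + 1} \<subseteq> {y. \<bar>y\<bar> \<ge> real n}" using x by (auto simp: abs_if split: if_splits)
    have int: "(\<lambda>y. (norm (g y))\<^sup>2) integrable_on {x..x + 1}" "(\<lambda>y. (h y)\<^sup>2) integrable_on {x..x + 1}"
      by (intro locally_integrable_integrable_on g_loc locally_integrable_continuous continuous_intros h_cont)+
    have "f absolutely_integrable_on {x..x + 1}"
      unfolding set_integrable_def by (intro integrable_mult_indicator f) simp
    then have "(LINT y|lebesgue. indicator {x..x + 1} y *\<^sub>R f y) = integral {x..x + 1} f"
      using set_lebesgue_integral_eq_integral(2) unfolding set_lebesgue_integral_def by blast
    also have "\<dots> = integral {x..x + 1} (\<lambda>y. (norm (g y))\<^sup>2) + integral {x..x + 1} (\<lambda>y. (h y)\<^sup>2)"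
      unfolding f_def using int by (rule Henstock_Kurzweil_Integration.integral_add)
    finally have eq: "(LINT y|lebesgue. indicator {x..x + 1} y *\<^sub>R f y) = \<dots>" .
    have "(LINT y|lebesgue. indicator {x..x + 1} y *\<^sub>R f y) \<le> (LINT y|lebesgue. indicator {y. \<bar>y\<bar> \<ge> real n} y *\<^sub>R f y)"
    proof (rule integral_mono)
      have "closed {y::real. \<bar>y\<bar> \<ge> real n}" by (intro closed_Collect_le continuous_intros)
      then show "integrable lebesgue (\<lambda>y. indicator {y. \<bar>y\<bar> \<ge> real n} y *\<^sub>R f y)"
        by (intro integrable_mult_indicator f) simp
      show "integrable lebesgue (\<lambda>y. indicator {x..x + 1} y *\<^sub>R f y)"
        by (intro integrable_mult_indicator f) simp
      show "indicator {x..x + 1} y *\<^sub>R f y \<le> indicator {y. \<bar>y\<bar> \<ge> real n} y *\<^sub>R f y" for y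
        using sub f_nonneg[of y] by (auto simp: indicator_def)
    qed
    then show ?thesis using n eq by linarith
  qed
  then show ?thesis using that[of "real n + 1"] by blast
qed

text \<open>On a far unit interval \<open>\<integral>|u'|\<^sup>2\<close> and \<open>\<integral>\<eta>\<^sup>2\<close> are below \<open>r\<^sup>2\<close>, so \<open>\<eta>\<close> is small at some point of
  the interval and \<open>u\<close> oscillates by at most \<open>\<integral>|u'| \<le> r/2 + \<integral>|u'|\<^sup>2/(2r) \<le> r\<close>.\<close>

lemma h_decay:
  assumes "\<epsilon> > 0"
  obtains R where "\<And>x. \<bar>x\<bar> \<ge> R \<Longrightarrow> \<bar>h x\<bar> < \<epsilon>"
proof -
  \<comment> \<open>The final estimate is
    \<open>\<bar>h x\<bar> \<le> (2 * r) * (2 + 2 * r) \<le> 8 * r\<close>, where the last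
    inequality uses \<open>r \<le> 1\<close>; dividing by 9 makes it strictly less than
    \<open>\<epsilon>\<close>.\<close>
  define r where "r = min 1 (\<epsilon> / 9)"
  have r: "0 < r" "r \<le> 1" "8 * r < \<epsilon>" using assms by (auto simp: r_def min_def)
  obtain R where R: "\<And>x. \<bar>x\<bar> \<ge> R \<Longrightarrow> integral {x..x + 1} (\<lambda>y. (norm (g y))\<^sup>2) + integral {x..x + 1} (\<lambda>y. (h y)\<^sup>2) < r\<^sup>2"
    using unit_interval_bound[of "r\<^sup>2"] r by auto
  have "\<bar>h x\<bar> < \<epsilon>" if x: "\<bar>x\<bar> \<ge> R" for x
  proof -
    have h2: "(\<lambda>y. (h y)\<^sup>2) integrable_on {x..x + 1}"
      by (intro locally_integrable_integrable_on locally_integrable_continuous continuous_intros h_cont)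
    have g2: "(\<lambda>y. (norm (g y))\<^sup>2) integrable_on {x..y}" for y
      by (intro locally_integrable_integrable_on g_loc)
    have nonneg: "integral {x..x + 1} (\<lambda>y. (norm (g y))\<^sup>2) \<ge> 0" "integral {x..x + 1} (\<lambda>y. (h y)\<^sup>2) \<ge> 0"
      by (intro integral_nonneg h2 g2; simp)+
    have "\<exists>y\<in>{x..x + 1}. (h y)\<^sup>2 \<le> r\<^sup>2"
    proof (rule ccontr)
      assume "\<not> (\<exists>y\<in>{x..x + 1}. (h y)\<^sup>2 \<le> r\<^sup>2)"
      then have "r\<^sup>2 \<le> (h y)\<^sup>2" if "y \<in> {x..x + 1}" for y
        using that by (meson linear)
      then have "integral {x..x + 1} (\<lambda>_. r\<^sup>2) \<le> integral {x..x + 1} (\<lambda>y. (h y)\<^sup>2)"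
        by (intro integral_le h2) auto
      then show False using R[OF x] nonneg by simp
    qed
    then obtain y where y: "y \<in> {x..x + 1}" "(h y)\<^sup>2 \<le> r\<^sup>2" by blast
    have hy: "\<bar>h y\<bar> \<le> r" using y(2) r by (simp add: power2_le_iff_abs_le)
    have "norm (U y - U x) \<le> r"
    proof -
      have "norm (integral {x..y} g) \<le> integral {x..y} (\<lambda>t. r / 2 + (norm (g t))\<^sup>2 / (2 * r))"
      proof (rule integral_norm_bound_integral)
        show "g integrable_on {x..y}" by (intro locally_integrable_integrable_on g_loc)
        show "(\<lambda>t. r / 2 + (norm (g t))\<^sup>2 / (2 * r)) integrable_on {x..y}"
          by (intro integrable_add integrable_on_divide g2) auto
        show "norm (g t) \<le> r / 2 + (norm (g t))\<^sup>2 / (2 * r)" for t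
        proof -
          have "0 \<le> (norm (g t) - r)\<^sup>2" by simp
          then have "2 * r * norm (g t) \<le> r * r + (norm (g t))\<^sup>2" by (simp add: power2_eq_square algebra_simps)
          then show ?thesis using r(1) by (simp add: field_simps)
        qed
      qed
      also have "\<dots> = r / 2 * (y - x) + integral {x..y} (\<lambda>t. (norm (g t))\<^sup>2) / (2 * r)"
        using y(1) g2 by (subst Henstock_Kurzweil_Integration.integral_add) (auto intro: integrable_on_divide)
      also have "integral {x..y} (\<lambda>t. (norm (g t))\<^sup>2) \<le> r\<^sup>2"
      proof -
        have "integral {x..y} (\<lambda>t. (norm (g t))\<^sup>2) \<le> integral {x..x + 1} (\<lambda>t. (norm (g t))\<^sup>2)"
          by (intro integral_subset_le g2) (use y(1) in auto)
        then show ?thesis using R[OF x] nonneg by linarith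
      qed
      also have "r / 2 * (y - x) + r\<^sup>2 / (2 * r) \<le> r"
      proof -
        have "r / 2 * (y - x) \<le> r / 2 * 1" using y(1) r(1) by (intro mult_left_mono) auto
        moreover have "r\<^sup>2 / (2 * r) = r / 2" using r(1) by (simp add: power2_eq_square)
        ultimately show ?thesis by simp
      qed
      finally show ?thesis
        using U_diff[of x y] y(1) r(1) by (simp add: divide_right_mono)
    qed
    moreover have "\<bar>norm (U y) - 1\<bar> \<le> r"
    proof -
      have "\<bar>norm (U y) - 1\<bar> \<le> \<bar>norm (U y) - 1\<bar> * (norm (U y) + 1)"
        using mult_left_mono[of 1 "norm (U y) + 1" "\<bar>norm (U y) - 1\<bar>"] by simp
      also have "\<dots> = \<bar>h y\<bar>"
      proof -
        have "h y = - ((norm (U y) - 1) * (norm (U y) + 1))"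
          by (simp add: h_def power2_eq_square algebra_simps)
        then show ?thesis by (simp add: abs_mult)
      qed
      finally show ?thesis using hy by linarith
    qed
    ultimately have "\<bar>norm (U x) - 1\<bar> \<le> 2 * r"
      using norm_triangle_ineq3[of "U y" "U x"] by linarith
    moreover have "\<bar>h x\<bar> = \<bar>norm (U x) - 1\<bar> * (norm (U x) + 1)"
    proof -
      have "h x = - ((norm (U x) - 1) * (norm (U x) + 1))"
        by (simp add: h_def power2_eq_square algebra_simps)
      then show ?thesis by (simp add: abs_mult)
    qed
    ultimately have "\<bar>h x\<bar> \<le> (2 * r) * (2 + 2 * r)"
      using r by (simp only:) (intro mult_mono; auto)
    also have "\<dots> \<le> 2 * r * 4" using r by (intro mult_left_mono) auto
    finally show ?thesis using r by linarith
  qed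
  then show ?thesis using that by blast
qed

section \<open>The classical equation and its conserved quantities\<close>

lemma U_deriv: "open S \<Longrightarrow> (\<And>x. x \<in> S \<Longrightarrow> A x \<noteq> 0) \<Longrightarrow> x \<in> S \<Longrightarrow> (U has_vector_derivative V x) (at x)"
  using regular[of S] by (auto simp: A_def V_def)

lemma h_deriv:
  assumes "open S" "\<And>x. x \<in> S \<Longrightarrow> A x \<noteq> 0" "x \<in> S"
  shows "(h has_real_derivative - 2 * p x) (at x)"
proof -
  have U: "(U has_derivative (\<lambda>t. t *\<^sub>R V x)) (at x)"
    using U_deriv[OF assms] by (simp add: has_vector_derivative_def)
  have "((\<lambda>x. 1 - inner (U x) (U x)) has_derivative (\<lambda>t. 0 - (inner (U x) (t *\<^sub>R V x) + inner (t *\<^sub>R V x) (U x)))) (at x)"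
    by (intro has_derivative_diff has_derivative_const has_derivative_inner U)
  moreover have "(\<lambda>t. 0 - (inner (U x) (t *\<^sub>R V x) + inner (t *\<^sub>R V x) (U x))) = (*) (- 2 * p x)"
    by (auto simp: p_def inner_commute)
  ultimately show ?thesis
    by (simp add: has_field_derivative_def h_def[abs_def] power2_norm_eq_inner)
qed

text \<open>The system differentiates only \<open>U\<close> and \<open>M\<close>; \<open>V\<close>
  inherits a derivative as \<open>M\<close> plus a differentiable multiple of \<open>U\<close>.
  Pairing the result with \<open>U\<close> puts \<open>q\<close> on both sides, through
  \<open>2 * \<kappa> * q\<close>, and collecting it produces the factor \<open>A\<close>.\<close>

lemma V_deriv:
  assumes S: "open S" "\<And>x. x \<in> S \<Longrightarrow> A x \<noteq> 0" "x \<in> S"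
  obtains W q where "(V has_vector_derivative W) (at x)" "(p has_real_derivative q) (at x)"
    "W = (2 * \<kappa> * q - h x) *\<^sub>R U x - \<i> * complex_of_real c * V x"
    "q * A x = (norm (V x))\<^sup>2 + c * inner (\<i> * U x) (V x) - h x * (1 - h x)"
proof -
  have U: "(U has_vector_derivative V x) (at x)" using U_deriv[OF S] .
  have M: "(M has_vector_derivative - force c \<kappa> (U x) (V x)) (at x)"
    using regular[of S] S by (auto simp: A_def V_def)
  have UM: "((\<lambda>x. inner (U x) (M x)) has_real_derivative inner (U x) (- force c \<kappa> (U x) (V x)) + inner (V x) (M x)) (at x)"
  proof -
    have "((\<lambda>x. inner (U x) (M x)) has_derivative
       (\<lambda>t. inner (U x) (t *\<^sub>R - force c \<kappa> (U x) (V x)) + inner (t *\<^sub>R V x) (M x))) (at x)"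
      using U M unfolding has_vector_derivative_def by (rule has_derivative_inner)
    moreover have "(\<lambda>t. inner (U x) (t *\<^sub>R - force c \<kappa> (U x) (V x)) + inner (t *\<^sub>R V x) (M x))
        = (*) (inner (U x) (- force c \<kappa> (U x) (V x)) + inner (V x) (M x))"
      by (auto simp: algebra_simps)
    ultimately show ?thesis
      by (simp add: has_field_derivative_def)
  qed
  have A': "(A has_real_derivative 2 * \<kappa> * (- 2 * p x)) (at x)"
    unfolding A_alt[abs_def] by (auto intro!: derivative_eq_intros h_deriv[OF S])
  define k where "k x = 2 * \<kappa> * inner (U x) (M x) / A x" for x
  \<comment> \<open>Only existence is taken from the quotient rule. The value comes afterwards from
    \<open>k = 2 * \<kappa> * p\<close> on \<open>S\<close>, which yields
    \<open>k' = 2 * \<kappa> * q\<close>.\<close>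
  have "\<exists>k'. (k has_real_derivative k') (at x)"
    unfolding k_def[abs_def] using DERIV_divide[OF DERIV_cmult[OF UM, of "2 * \<kappa>"] A'] S(2)[OF S(3)] by blast
  then obtain k' where k': "(k has_real_derivative k') (at x)" by blast
  have V_alt: "V = (\<lambda>x. M x + k x *\<^sub>R U x)"
    by (simp add: V_def velocity_def k_def A_def fun_eq_iff)
  define W where "W = - force c \<kappa> (U x) (V x) + (k x *\<^sub>R V x + k' *\<^sub>R U x)"
  have W: "(V has_vector_derivative W) (at x)"
    unfolding V_alt W_def using M U k'
    by (intro has_vector_derivative_add has_vector_derivative_scaleR) (auto simp: V_alt)
  have k_eq: "k y = 2 * \<kappa> * p y" if "y \<in> S" for y
    using flux_velocity(1)[of \<kappa> "U y" "M y"] S(2)[OF that]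
    by (simp add: k_def p_def V_def A_def[symmetric] field_simps)
  define q where "q = inner (U x) W + inner (V x) (V x)"
  have p': "(p has_real_derivative q) (at x)"
  proof -
    have "((\<lambda>x. inner (U x) (V x)) has_derivative (\<lambda>t. inner (U x) (t *\<^sub>R W) + inner (t *\<^sub>R V x) (V x))) (at x)"
      using U W unfolding has_vector_derivative_def by (rule has_derivative_inner)
    moreover have "(\<lambda>t. inner (U x) (t *\<^sub>R W) + inner (t *\<^sub>R V x) (V x)) = (*) q"
      by (auto simp: q_def algebra_simps)
    ultimately show ?thesis
      by (simp add: has_field_derivative_def p_def[abs_def])
  qed
  have "(k has_real_derivative 2 * \<kappa> * q) (at x)"
    by (rule has_field_derivative_transform_within_open[OF DERIV_cmult[OF p'] S(1) S(3)]) (simp add: k_eq)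
  then have k'_eq: "k' = 2 * \<kappa> * q" using k' DERIV_unique by blast
  have W_eq: "W = (2 * \<kappa> * q - h x) *\<^sub>R U x - \<i> * complex_of_real c * V x"
    using k_eq[OF S(3)]
    by (simp add: W_def k'_eq force_def p_def h_def scaleR_diff_left)
  have "inner (U x) (\<i> * complex_of_real c * V x) = - c * inner (\<i> * U x) (V x)"
    by (simp add: inner_complex_def algebra_simps)
  then have "inner (U x) W = (2 * \<kappa> * q - h x) * (1 - h x) + c * inner (\<i> * U x) (V x)"
    unfolding W_eq by (simp add: inner_diff_right norm_U flip: power2_norm_eq_inner)
  then have "q = (2 * \<kappa> * q - h x) * (1 - h x) + c * inner (\<i> * U x) (V x) + (norm (V x))\<^sup>2"
    by (simp add: q_def power2_norm_eq_inner)
  then have "q * A x = (norm (V x))\<^sup>2 + c * inner (\<i> * U x) (V x) - h x * (1 - h x)"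
    unfolding A_alt by algebra
  then show ?thesis using that[OF W p' W_eq] by blast
qed

text \<open>The conservation law of phase rotations: against \<open>\<i> * U\<close> the multiple of
  \<open>U\<close> in \<open>W\<close> drops out, and what remains is \<open>- c * p\<close>, the
  derivative of \<open>c * h / 2\<close>.\<close>

lemma momentum_deriv:
  assumes S: "open S" "\<And>x. x \<in> S \<Longrightarrow> A x \<noteq> 0" "x \<in> S"
  shows "((\<lambda>x. inner (\<i> * U x) (V x) - c * h x / 2) has_real_derivative 0) (at x)"
proof -
  obtain W q where W: "(V has_vector_derivative W) (at x)"
    "W = (2 * \<kappa> * q - h x) *\<^sub>R U x - \<i> * complex_of_real c * V x"
    using V_deriv[OF S] by metis
  have "((\<lambda>x. \<i> * U x) has_vector_derivative \<i> * V x) (at x)"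
    by (rule bounded_linear.has_vector_derivative[OF bounded_linear_mult_right U_deriv[OF S]])
  then have "((\<lambda>x. inner (\<i> * U x) (V x)) has_derivative
      (\<lambda>t. inner (\<i> * U x) (t *\<^sub>R W) + inner (t *\<^sub>R (\<i> * V x)) (V x))) (at x)"
    using W(1) unfolding has_vector_derivative_def by (rule has_derivative_inner)
  moreover have "(\<lambda>t. inner (\<i> * U x) (t *\<^sub>R W) + inner (t *\<^sub>R (\<i> * V x)) (V x)) = (*) (- c * p x)"
    by (auto simp: W(2) p_def inner_complex_def algebra_simps)
  ultimately have "((\<lambda>x. inner (\<i> * U x) (V x)) has_real_derivative - c * p x) (at x)"
    by (simp add: has_field_derivative_def)
  from DERIV_diff[OF this DERIV_cmult[OF h_deriv[OF S], of "c / 2"]] show ?thesis by simp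
qed

text \<open>The conservation law of translations: against \<open>V\<close> the term with
  \<open>\<i> * c * V\<close> does no work, and the other term of \<open>W\<close> is an exact
  derivative because \<open>q\<close> is the derivative of \<open>p\<close> and
  \<open>- 2 * p\<close> that of \<open>h\<close>.\<close>

lemma energy_deriv:
  assumes S: "open S" "\<And>x. x \<in> S \<Longrightarrow> A x \<noteq> 0" "x \<in> S"
  shows "((\<lambda>x. (norm (V x))\<^sup>2 - 2 * \<kappa> * (p x)\<^sup>2 - (h x)\<^sup>2 / 2) has_real_derivative 0) (at x)"
proof -
  obtain W q where W: "(V has_vector_derivative W) (at x)" "(p has_real_derivative q) (at x)"
    "W = (2 * \<kappa> * q - h x) *\<^sub>R U x - \<i> * complex_of_real c * V x"
    using V_deriv[OF S] by metis
  have "((\<lambda>x. inner (V x) (V x)) has_derivative (\<lambda>t. inner (V x) (t *\<^sub>R W) + inner (t *\<^sub>R W) (V x))) (at x)"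
    using W(1) unfolding has_vector_derivative_def by (rule has_derivative_inner[OF _ W(1)[unfolded has_vector_derivative_def]])
  moreover have "(\<lambda>t. inner (V x) (t *\<^sub>R W) + inner (t *\<^sub>R W) (V x)) = (*) (2 * (2 * \<kappa> * q - h x) * p x)"
    by (auto simp: W(3) p_def inner_complex_def algebra_simps)
  ultimately have "((\<lambda>x. (norm (V x))\<^sup>2) has_real_derivative 2 * (2 * \<kappa> * q - h x) * p x) (at x)"
    by (simp add: has_field_derivative_def power2_norm_eq_inner)
  moreover have "((\<lambda>x. (p x)\<^sup>2) has_real_derivative 2 * p x * q) (at x)"
    by (auto intro!: derivative_eq_intros W(2))
  moreover have "((\<lambda>x. (h x)\<^sup>2) has_real_derivative 2 * h x * (- 2 * p x)) (at x)"
    by (auto intro!: derivative_eq_intros h_deriv[OF S])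
  ultimately have "((\<lambda>x. (norm (V x))\<^sup>2 - 2 * \<kappa> * (p x)\<^sup>2 - (h x)\<^sup>2 / 2) has_real_derivative
      2 * (2 * \<kappa> * q - h x) * p x - 2 * \<kappa> * (2 * p x * q) - 2 * h x * (- 2 * p x) / 2) (at x)"
    by (intro DERIV_diff DERIV_cmult DERIV_cdivide)
  then show ?thesis by (simp add: algebra_simps)
qed

text \<open>Otherwise a positive constant on a half-line would be dominated by the integrable energy
  density. A single such point is enough to evaluate constants of motion, so no limit of
  \<open>V\<close> at infinity has to be established.\<close>

lemma ex_small:
  assumes S: "open S" "\<And>x. x \<in> S \<Longrightarrow> A x \<noteq> 0" "{R..} \<subseteq> S" and "\<epsilon> > 0"
  obtains x where "x \<in> S" "(norm (V x))\<^sup>2 < \<epsilon>" "(h x)\<^sup>2 < \<epsilon>"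
proof (rule ccontr)
  assume "\<not> thesis"
  with that have *: "\<epsilon> \<le> (norm (V x))\<^sup>2 + (h x)\<^sup>2" if "x \<in> S" for x
    using zero_le_power2[of "norm (V x)"] zero_le_power2[of "h x"] \<open>x \<in> S\<close> by (smt (verit))
  have ae: "AE x in lebesgue. x \<in> S \<longrightarrow> g x = V x"
    using regular[of S] S by (auto simp: A_def V_def)
  have "integrable lebesgue (\<lambda>x. indicator {R..} x * \<epsilon>)"
  proof (rule Bochner_Integration.integrable_bound)
    show "integrable lebesgue (\<lambda>x. (norm (g x))\<^sup>2 + (h x)\<^sup>2)"
      by (intro Bochner_Integration.integrable_add energy_integrable)
    show "AE x in lebesgue. norm (indicator {R..} x * \<epsilon>) \<le> norm ((norm (g x))\<^sup>2 + (h x)\<^sup>2)"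
      using ae
    proof eventually_elim
      case (elim x)
      have "norm (indicator {R..} x * \<epsilon>) \<le> (norm (g x))\<^sup>2 + (h x)\<^sup>2"
        using elim * S(3) \<open>\<epsilon> > 0\<close> by (auto simp: indicator_def)
      then show ?case by simp
    qed
  qed measurable
  then have "integrable lebesgue (\<lambda>x. indicat_real {R..} x)"
    using \<open>\<epsilon> > 0\<close> by simp
  then have fin: "{R..} \<in> lmeasurable"
    by (simp add: integrable_indicator_iff fmeasurable_def)
  obtain n :: nat where n: "measure lebesgue {R..} < real n" using reals_Archimedean2 by blast
  have "measure lebesgue {R..R + real n} \<le> measure lebesgue {R..}"
    by (intro measure_mono_fmeasurable fin) auto
  with n show False by simp
qed

text \<open>Convexity makes the two conserved quantities constant on \<open>S\<close>; the half-line
  contains points where \<open>V\<close> and \<open>h\<close> are arbitrarily small, which forces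
  both constants to be 0.\<close>

lemma first_integrals:
  assumes S: "open S" "convex S" "\<And>x. x \<in> S \<Longrightarrow> A x \<noteq> 0" "{R..} \<subseteq> S" and x: "x \<in> S"
  shows "inner (\<i> * U x) (V x) = c * h x / 2"
    and "(norm (V x))\<^sup>2 = 2 * \<kappa> * (p x)\<^sup>2 + (h x)\<^sup>2 / 2"
    and "4 * (p x)\<^sup>2 * A x = (h x)\<^sup>2 * (2 - c\<^sup>2 - 2 * h x)"
proof -
  define J where "J x = inner (\<i> * U x) (V x) - c * h x / 2" for x
  define E where "E x = (norm (V x))\<^sup>2 - 2 * \<kappa> * (p x)\<^sup>2 - (h x)\<^sup>2 / 2" for x
  obtain j where j: "\<And>x. x \<in> S \<Longrightarrow> J x = j"
    using has_field_derivative_zero_constant[OF S(2), of J] momentum_deriv[OF S(1,3)]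
    by (auto simp: J_def[abs_def] intro: has_field_derivative_at_within)
  obtain e where e: "\<And>x. x \<in> S \<Longrightarrow> E x = e"
    using has_field_derivative_zero_constant[OF S(2), of E] energy_deriv[OF S(1,3)]
    by (auto simp: E_def[abs_def] intro: has_field_derivative_at_within)
  have small: "j\<^sup>2 \<le> (4 + c\<^sup>2) * \<epsilon> \<and> \<bar>e\<bar> \<le> (2 + 4 * \<bar>\<kappa>\<bar>) * \<epsilon>" if \<epsilon>: "0 < \<epsilon>" "\<epsilon> < 1" for \<epsilon>
  proof -
    obtain y where y: "y \<in> S" "(norm (V y))\<^sup>2 < \<epsilon>" "(h y)\<^sup>2 < \<epsilon>"
      using ex_small[OF S(1,3,4) \<epsilon>(1)] by blast
    have "\<bar>h y\<bar> < 1" using y(3) \<epsilon> by (simp add: abs_square_less_1[symmetric])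
    then have U2: "(norm (U y))\<^sup>2 \<le> 2" using norm_U[of y] by linarith
    have prod: "(norm (U y))\<^sup>2 * (norm (V y))\<^sup>2 \<le> 2 * \<epsilon>"
      using U2 y(2) by (intro mult_mono) auto
    have cs: "(inner w (V y))\<^sup>2 \<le> 2 * \<epsilon>" if "norm w = norm (U y)" for w
      using Cauchy_Schwarz_ineq[of w "V y"] prod that by (simp flip: power2_norm_eq_inner)
    have "j\<^sup>2 \<le> 2 * (inner (\<i> * U y) (V y))\<^sup>2 + 2 * (c * h y / 2)\<^sup>2"
    proof -
      have "0 \<le> (inner (\<i> * U y) (V y) + c * h y / 2)\<^sup>2" by simp
      then show ?thesis
        unfolding j[OF y(1), symmetric] J_def power2_eq_square by (simp add: algebra_simps)
    qed
    also have "\<dots> \<le> 2 * (2 * \<epsilon>) + 2 * (c\<^sup>2 * \<epsilon> / 4)"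
    proof -
      have "c\<^sup>2 * (h y)\<^sup>2 \<le> c\<^sup>2 * \<epsilon>" using y(3) by (intro mult_left_mono) auto
      then have "(c * h y / 2)\<^sup>2 \<le> c\<^sup>2 * \<epsilon> / 4"
        by (simp add: power_divide power_mult_distrib)
      then show ?thesis
        using cs[of "\<i> * U y"] by (intro add_mono mult_left_mono) (auto simp: norm_mult)
    qed
    also have "\<dots> \<le> (4 + c\<^sup>2) * \<epsilon>" using \<epsilon> by (simp add: algebra_simps)
    finally have "j\<^sup>2 \<le> (4 + c\<^sup>2) * \<epsilon>" .
    moreover have "\<bar>e\<bar> \<le> (2 + 4 * \<bar>\<kappa>\<bar>) * \<epsilon>"
    proof -
      have "\<bar>2 * \<kappa> * (p y)\<^sup>2\<bar> \<le> 2 * \<bar>\<kappa>\<bar> * (2 * \<epsilon>)"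
        unfolding abs_mult using cs[of "U y"] by (intro mult_mono) (auto simp: p_def)
      moreover have "\<bar>e\<bar> \<le> (norm (V y))\<^sup>2 + \<bar>2 * \<kappa> * (p y)\<^sup>2\<bar> + (h y)\<^sup>2 / 2"
        unfolding e[OF y(1), symmetric] E_def by (smt (verit) zero_le_power2 field_sum_of_halves)
      ultimately show ?thesis using y \<epsilon> by (simp add: algebra_simps)
    qed
    ultimately show ?thesis ..
  qed
  have zero: "k = 0" if "\<And>\<epsilon>. 0 < \<epsilon> \<Longrightarrow> \<epsilon> < 1 \<Longrightarrow> k \<le> C * \<epsilon>" "k \<ge> 0" "C > 0" for k C :: real
  proof (rule ccontr)
    assume "k \<noteq> 0"
    with that(2) have "k > 0" by simp
    define \<epsilon> where "\<epsilon> = min (1/2) (k / (2 * C))"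
    have "\<epsilon> > 0" "\<epsilon> < 1" using \<open>k > 0\<close> \<open>C > 0\<close> by (auto simp: \<epsilon>_def)
    then have "k \<le> C * \<epsilon>" by (rule that(1))
    also have "\<dots> \<le> C * (k / (2 * C))" using \<open>C > 0\<close> by (intro mult_left_mono) (auto simp: \<epsilon>_def)
    finally show False using \<open>k > 0\<close> \<open>C > 0\<close> by simp
  qed
  have "j\<^sup>2 = 0" by (rule zero[of _ "4 + c\<^sup>2"]) (use small in \<open>auto intro: add_pos_nonneg\<close>)
  then show J: "inner (\<i> * U x) (V x) = c * h x / 2" using j[OF x] by (simp add: J_def)
  have "\<bar>e\<bar> = 0" by (rule zero[of _ "2 + 4 * \<bar>\<kappa>\<bar>"]) (use small in \<open>auto intro: add_pos_nonneg\<close>)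
  then show E: "(norm (V x))\<^sup>2 = 2 * \<kappa> * (p x)\<^sup>2 + (h x)\<^sup>2 / 2" using e[OF x] by (simp add: E_def)
  \<comment> \<open>\<open>U\<close> and \<open>\<i> * U\<close> are orthogonal and of equal length.
    This identity eliminates \<open>V\<close> between the two integrals and leaves an equation in
    \<open>h\<close> and \<open>p\<close> alone.\<close>
  have "(norm (U x))\<^sup>2 * (norm (V x))\<^sup>2 = (p x)\<^sup>2 + (inner (\<i> * U x) (V x))\<^sup>2"
    by (simp add: p_def inner_complex_def cmod_power2) (simp add: power2_eq_square algebra_simps)
  then have "(1 - h x) * (2 * \<kappa> * (p x)\<^sup>2 + (h x)\<^sup>2 / 2) = (p x)\<^sup>2 + (c * h x / 2)\<^sup>2"
    unfolding norm_U J E .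
  then show "4 * (p x)\<^sup>2 * A x = (h x)\<^sup>2 * (2 - c\<^sup>2 - 2 * h x)"
    unfolding A_alt by (simp add: power2_eq_square field_simps)
qed

end

section \<open>The profile equation\<close>

locale dark_parameters =
  fixes c \<kappa> :: real
  assumes D2: "(c, \<kappa>) \<in> D2"
begin

text \<open>The height of the dark soliton: the zero of
  \<open>2 - c\<^sup>2 - 2 * y\<close>.\<close>

definition m :: real where "m = 1 - c\<^sup>2 / 2"
text \<open>The profile equation in first-order form reads \<eta>' = - \<eta> \<sigma>(\<eta>) to
  the right of the maximum, with the opposite sign to the left.\<close>

definition \<sigma> :: "real \<Rightarrow> real" where "\<sigma> y = sqrt ((2 - c\<^sup>2 - 2 * y) / (1 - 2 * \<kappa> + 2 * \<kappa> * y))"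

lemma params: "c \<ge> 0" "c\<^sup>2 < 2" "\<kappa> \<le> 0"
  using D2 real_sqrt_less_iff[of "c\<^sup>2" 2] by (auto simp: D2_def)

lemma c_sq: "c\<^sup>2 = 2 - 2 * m"
  by (simp add: m_def)

lemma m_bounds: "0 < m" "m \<le> 1"
  using params by (auto simp: m_def)

lemma B_ge_1: "y \<le> 1 \<Longrightarrow> 1 - 2 * \<kappa> + 2 * \<kappa> * y \<ge> 1"
  using mult_nonneg_nonpos[of "1 - y" \<kappa>] params(3) by (simp add: algebra_simps)

text \<open>These are the denominators in the derivatives of the two \<open>artanh\<close> terms of
  \<open>G\<close>; their positivity also keeps both arguments inside (-1, 1).\<close>

lemma one_minus_\<kappa>\<sigma>:
  assumes "0 < y" "y \<le> m"
  shows "1 - (sqrt (- \<kappa>) * \<sigma> y)\<^sup>2 = (1 - 2 * \<kappa> + 2 * \<kappa> * m) / (1 - 2 * \<kappa> + 2 * \<kappa> * y)"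
    and "1 - (sqrt ((1 - 2 * \<kappa>) / (2 - c\<^sup>2)) * \<sigma> y)\<^sup>2
      = y * (1 - 2 * \<kappa> + 2 * \<kappa> * m) / (m * (1 - 2 * \<kappa> + 2 * \<kappa> * y))"
proof -
  define B where "B = 1 - 2 * \<kappa> + 2 * \<kappa> * y"
  have B: "B \<ge> 1" using B_ge_1[of y] assms m_bounds by (simp add: B_def)
  have s2: "(\<sigma> y)\<^sup>2 = (2 * m - 2 * y) / B"
    using assms B by (simp add: \<sigma>_def c_sq B_def)
  have "(sqrt (- \<kappa>) * \<sigma> y)\<^sup>2 = - \<kappa> * ((2 * m - 2 * y) / B)"
    using params by (simp add: power_mult_distrib s2)
  then show "1 - (sqrt (- \<kappa>) * \<sigma> y)\<^sup>2 = (1 - 2 * \<kappa> + 2 * \<kappa> * m) / (1 - 2 * \<kappa> + 2 * \<kappa> * y)"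
    using B unfolding B_def[symmetric] by (simp add: field_simps) (simp add: B_def algebra_simps)
  have "(sqrt ((1 - 2 * \<kappa>) / (2 - c\<^sup>2)) * \<sigma> y)\<^sup>2 = (1 - 2 * \<kappa>) / (2 * m) * ((2 * m - 2 * y) / B)"
    using params m_bounds by (simp add: power_mult_distrib s2 c_sq)
  then show "1 - (sqrt ((1 - 2 * \<kappa>) / (2 - c\<^sup>2)) * \<sigma> y)\<^sup>2
      = y * (1 - 2 * \<kappa> + 2 * \<kappa> * m) / (m * (1 - 2 * \<kappa> + 2 * \<kappa> * y))"
    using B m_bounds unfolding B_def[symmetric] by (simp add: field_simps) (simp add: B_def algebra_simps)
qed

lemma G_alt:
  "G c \<kappa> y = - 2 * sqrt (- \<kappa>) * artanh (sqrt (- \<kappa>) * \<sigma> y)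
     + 2 * sqrt ((1 - 2 * \<kappa>) / (2 - c\<^sup>2)) * artanh (sqrt ((1 - 2 * \<kappa>) / (2 - c\<^sup>2)) * \<sigma> y)"
  by (simp add: G_def \<sigma>_def flip: real_sqrt_mult)

lemma artanh_args:
  assumes "0 < y" "y \<le> m"
  shows "\<bar>sqrt (- \<kappa>) * \<sigma> y\<bar> < 1" "\<bar>sqrt ((1 - 2 * \<kappa>) / (2 - c\<^sup>2)) * \<sigma> y\<bar> < 1"
proof -
  have pos: "1 - 2 * \<kappa> + 2 * \<kappa> * m > 0" "1 - 2 * \<kappa> + 2 * \<kappa> * y > 0"
    using B_ge_1[of m] B_ge_1[of y] assms m_bounds by auto
  have "1 - (sqrt (- \<kappa>) * \<sigma> y)\<^sup>2 > 0"
    unfolding one_minus_\<kappa>\<sigma>(1)[OF assms] using pos by simp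
  then show "\<bar>sqrt (- \<kappa>) * \<sigma> y\<bar> < 1" by (simp flip: abs_square_less_1)
  have "1 - (sqrt ((1 - 2 * \<kappa>) / (2 - c\<^sup>2)) * \<sigma> y)\<^sup>2 > 0"
    unfolding one_minus_\<kappa>\<sigma>(2)[OF assms] using pos assms m_bounds by simp
  then show "\<bar>sqrt ((1 - 2 * \<kappa>) / (2 - c\<^sup>2)) * \<sigma> y\<bar> < 1" by (simp flip: abs_square_less_1)
qed

lemma \<sigma>_pos: "0 < y \<Longrightarrow> y < m \<Longrightarrow> \<sigma> y > 0"
  using B_ge_1[of y] m_bounds by (simp add: \<sigma>_def c_sq)

lemma \<sigma>_cont: "continuous_on {0<..m} \<sigma>"
proof -
  have "1 - 2 * \<kappa> + 2 * \<kappa> * y \<noteq> 0" if "y \<in> {0<..m}" for y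
    using B_ge_1[of y] m_bounds that by auto
  then show ?thesis unfolding \<sigma>_def by (intro continuous_intros) auto
qed

lemma G_cont: "continuous_on {0<..m} (G c \<kappa>)"
  unfolding G_alt[abs_def]
  by (intro continuous_intros \<sigma>_cont) (use artanh_args in \<open>auto simp: abs_less_iff minus_less_iff\<close>)

lemma G_m: "G c \<kappa> m = 0"
  by (simp add: G_alt \<sigma>_def m_def)

text \<open>Together with \<open>G_m\<close> and continuity this makes \<open>G\<close> the travel
  time of the profile equation, the integral of \<open>1 / (s * \<sigma> s)\<close> from
  \<open>y\<close> to \<open>m\<close>.\<close>

lemma G_deriv:
  assumes y: "0 < y" "y < m"
  shows "(G c \<kappa> has_real_derivative - 1 / (y * \<sigma> y)) (at y)"
proof -
  define B where "B = 1 - 2 * \<kappa> + 2 * \<kappa> * y"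
  define D where "D = 1 - 2 * \<kappa> + 2 * \<kappa> * m"
  have B: "B > 0" using B_ge_1[of y] y m_bounds by (simp add: B_def)
  have D: "D > 0" using B_ge_1[of m] m_bounds by (simp add: D_def)
  have s: "\<sigma> y > 0" using \<sigma>_pos y by simp
  have X: "(2 - c\<^sup>2 - 2 * y) / B > 0" using B y by (simp add: c_sq)
  have X': "((\<lambda>y. (2 - c\<^sup>2 - 2 * y) / (1 - 2 * \<kappa> + 2 * \<kappa> * y)) has_real_derivative - 2 * D / B\<^sup>2) (at y)"
  proof -
    have num: "((\<lambda>y. 2 - c\<^sup>2 - 2 * y) has_real_derivative - 2) (at y)"
      and den: "((\<lambda>y. 1 - 2 * \<kappa> + 2 * \<kappa> * y) has_real_derivative 2 * \<kappa>) (at y)"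
      by (auto intro!: derivative_eq_intros)
    have "- 2 * B - (2 - c\<^sup>2 - 2 * y) * (2 * \<kappa>) = - 2 * D"
      by (simp add: B_def D_def c_sq algebra_simps)
    then show ?thesis
      using DERIV_divide[OF num den] B by (simp add: power2_eq_square flip: B_def)
  qed
  have "(\<sigma> has_real_derivative inverse (\<sigma> y) / 2 * (- 2 * D / B\<^sup>2)) (at y)"
    unfolding \<sigma>_def
    by (rule DERIV_chain2[where f = sqrt and g = "\<lambda>y. (2 - c\<^sup>2 - 2 * y) / (1 - 2 * \<kappa> + 2 * \<kappa> * y)",
          OF DERIV_real_sqrt[OF X[unfolded B_def]] X'])
  then have s': "(\<sigma> has_real_derivative - D / (\<sigma> y * B\<^sup>2)) (at y)"
    by (rule DERIV_cong) (simp add: field_simps)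
  have lin: "((\<lambda>y. a * \<sigma> y) has_real_derivative a * (- D / (\<sigma> y * B\<^sup>2))) (at y)" for a
    by (rule DERIV_cmult[OF s'])
  let ?r = "sqrt (- \<kappa>)" and ?a = "sqrt ((1 - 2 * \<kappa>) / (2 - c\<^sup>2))"
  note args = artanh_args[OF y(1) less_imp_le[OF y(2)]]
  note one = one_minus_\<kappa>\<sigma>[OF y(1) less_imp_le[OF y(2)], folded B_def D_def]
  have "(G c \<kappa> has_real_derivative
      - 2 * ?r * (1 / (1 - (?r * \<sigma> y)\<^sup>2) * (?r * (- D / (\<sigma> y * B\<^sup>2))))
      + 2 * ?a * (1 / (1 - (?a * \<sigma> y)\<^sup>2) * (?a * (- D / (\<sigma> y * B\<^sup>2))))) (at y)"
    unfolding G_alt[abs_def]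
    by (intro DERIV_add DERIV_cmult DERIV_chain2[OF artanh_real_has_field_derivative lin] args)
  moreover have "- 2 * ?r * (1 / (1 - (?r * \<sigma> y)\<^sup>2) * (?r * (- D / (\<sigma> y * B\<^sup>2))))
      + 2 * ?a * (1 / (1 - (?a * \<sigma> y)\<^sup>2) * (?a * (- D / (\<sigma> y * B\<^sup>2)))) = - 1 / (y * \<sigma> y)"
  proof -
    have r2: "?r * ?r = - \<kappa>" and a2: "?a * ?a = (1 - 2 * \<kappa>) / (2 * m)"
      using params m_bounds by (auto simp: c_sq)
    have "- 2 * ?r * (1 / (1 - (?r * \<sigma> y)\<^sup>2) * (?r * (- D / (\<sigma> y * B\<^sup>2))))
      + 2 * ?a * (1 / (1 - (?a * \<sigma> y)\<^sup>2) * (?a * (- D / (\<sigma> y * B\<^sup>2))))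
      = (- 2 * (?r * ?r) / (1 - (?r * \<sigma> y)\<^sup>2) + 2 * (?a * ?a) / (1 - (?a * \<sigma> y)\<^sup>2)) * (- D / (\<sigma> y * B\<^sup>2))"
      by (simp add: algebra_simps)
    also have "\<dots> = (2 * \<kappa> / (D / B) + 2 * ((1 - 2 * \<kappa>) / (2 * m)) / (y * D / (m * B))) * (- D / (\<sigma> y * B\<^sup>2))"
      unfolding r2 a2 one by simp
    \<comment> \<open>Over the common denominator \<open>D * y\<close> the numerator is
      \<open>B * (2 * \<kappa> * y + 1 - 2 * \<kappa>)\<close>, that is \<open>B\<^sup>2\<close>;
      the coefficients of the two \<open>artanh\<close> terms are chosen for this.\<close>
    also have "2 * \<kappa> / (D / B) + 2 * ((1 - 2 * \<kappa>) / (2 * m)) / (y * D / (m * B)) = B\<^sup>2 / (D * y)"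
      using B D m_bounds y by (simp add: field_simps power2_eq_square) (simp add: B_def algebra_simps)
    also have "B\<^sup>2 / (D * y) * (- D / (\<sigma> y * B\<^sup>2)) = - 1 / (y * \<sigma> y)"
      using B D y s by (simp add: field_simps)
    finally show ?thesis .
  qed
  ultimately show ?thesis by (rule DERIV_cong)
qed

lemma inj_G: "inj_on (G c \<kappa>) {0<..m}"
proof (rule linorder_inj_onI')
  fix x y assume xy: "x \<in> {0<..m}" "y \<in> {0<..m}" "x < y"
  have "G c \<kappa> y < G c \<kappa> x"
  proof (rule DERIV_neg_imp_decreasing_open[OF xy(3)])
    fix z assume z: "x < z" "z < y"
    then have "0 < z" "z < m" using xy by auto
    then show "\<exists>d. (G c \<kappa> has_real_derivative d) (at z) \<and> d < 0"
      using G_deriv[of z] \<sigma>_pos[of z] by (intro exI[of _ "- 1 / (z * \<sigma> z)"]) simp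
  qed (use xy in \<open>auto intro: continuous_on_subset[OF G_cont]\<close>)
  then show "G c \<kappa> x \<noteq> G c \<kappa> y" by simp
qed

text \<open>Along a solution \<open>G\<close> grows at unit speed, so
  \<open>G c \<kappa> (f t) - t\<close> is constant. At \<open>t = 0\<close> only continuity is
  used: \<open>\<sigma> m = 0\<close> makes the derivative of \<open>G\<close> blow up there, and
  the same degeneracy keeps a Lipschitz uniqueness argument from applying.\<close>

lemma G_profile:
  assumes f: "continuous_on {0..} f" "f 0 = m"
    and "\<And>t. t > 0 \<Longrightarrow> 0 < f t \<and> f t < m"
    and f': "\<And>t. t > 0 \<Longrightarrow> (f has_real_derivative - f t * \<sigma> (f t)) (at t)"
    and t: "t \<ge> 0"
  shows "G c \<kappa> (f t) = t"
proof (cases "t = 0")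
  case False
  with t have "t > 0" by simp
  have range: "f s \<in> {0<..m}" if "s \<ge> 0" for s
    using assms(3)[of s] f(2) that m_bounds by (cases "s = 0") auto
  have "G c \<kappa> (f t) - t = G c \<kappa> (f 0) - 0"
  proof (rule DERIV_isconst2[OF \<open>t > 0\<close>])
    have "continuous_on {0..t} (G c \<kappa> \<circ> f)"
    proof (rule continuous_on_compose)
      show "continuous_on {0..t} f" by (rule continuous_on_subset[OF f(1)]) auto
      show "continuous_on (f ` {0..t}) (G c \<kappa>)" by (rule continuous_on_subset[OF G_cont]) (use range in auto)
    qed
    then show "continuous_on {0..t} (\<lambda>t. G c \<kappa> (f t) - t)" by (intro continuous_intros) (simp add: o_def)
    show "((\<lambda>t. G c \<kappa> (f t) - t) has_real_derivative 0) (at s)" if "0 < s" "s < t" for s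
    proof -
      have "((\<lambda>t. G c \<kappa> (f t) - t) has_real_derivative (- 1 / (f s * \<sigma> (f s))) * (- f s * \<sigma> (f s)) - 1) (at s)"
        using assms(3)[OF that(1)] f'[OF that(1)]
        by (intro DERIV_diff DERIV_ident DERIV_chain2[OF G_deriv]) auto
      then show ?thesis
        using assms(3)[OF that(1)] \<sigma>_pos[of "f s"] by simp
    qed
  qed (use t in auto)
  then show ?thesis using f(2) G_m by simp
qed (simp add: f(2) G_m)

end

section \<open>Classification\<close>

lemma ex_global_max:
  fixes f :: "real \<Rightarrow> real"
  assumes cont: "continuous_on UNIV f" and decay: "\<And>x. \<bar>x\<bar> \<ge> R \<Longrightarrow> f x < f a"
  obtains b where "\<And>x. f x \<le> f b"
proof -
  have "\<bar>a\<bar> < R" using decay[of a] by (meson less_irrefl not_le)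
  then have "compact {-R..R}" "{-R..R} \<noteq> {}" "a \<in> {-R..R}" by auto
  then obtain b where b: "\<forall>y\<in>{-R..R}. f y \<le> f b"
    using continuous_attains_sup[of "{-R..R}" f] continuous_on_subset[OF cont] by auto
  have "f x \<le> f b" for x
  proof (cases "\<bar>x\<bar> \<ge> R")
    case True
    then show ?thesis using decay[of x] b \<open>a \<in> {-R..R}\<close> by fastforce
  next
    case False
    then have "x \<in> {-R..R}" by auto
    then show ?thesis using b by blast
  qed
  then show ?thesis by (rule that)
qed

lemma deriv_zero_at_max:
  fixes f :: "real \<Rightarrow> real"
  assumes "(f has_real_derivative d) (at b)" "\<And>x. f x \<le> f b"
  shows "d = 0"
  using DERIV_local_max[OF assms(1), of 1] assms(2) by simp

section \<open>Parameters for which only constants have finite energy\<close>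

context regular_solution
begin

lemma eq_0_if_wrong_sign:
  assumes "(1 - 2 * \<kappa>) * (2 - c\<^sup>2) < 0"
  shows "h x = 0"
proof -
  \<comment> \<open>The product of the two factors does double duty: where it is negative the signs
    clash, and \<open>A\<close> cannot vanish, so the first integrals are available.\<close>
  define F where "F y = (1 - 2 * \<kappa> + 2 * \<kappa> * y) * (2 - c\<^sup>2 - 2 * y)" for y
  have "F 0 < 0" using assms by (simp add: F_def)
  have "(F \<longlongrightarrow> F 0) (at 0)" unfolding F_def by (intro tendsto_intros)
  then have "\<forall>\<^sub>F y in at 0. F y < 0"
    using \<open>F 0 < 0\<close> by (rule order_tendstoD(2))
  then obtain \<epsilon> where \<epsilon>: "\<epsilon> > 0" "\<And>y. \<bar>y\<bar> < \<epsilon> \<Longrightarrow> F y < 0"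
    unfolding eventually_at using \<open>F 0 < 0\<close> by (auto simp: dist_real_def) metis
  have zero: "h x = 0" if S: "open S" "convex S" "\<And>x. x \<in> S \<Longrightarrow> \<bar>h x\<bar> < \<epsilon>" "{R..} \<subseteq> S" "x \<in> S" for S R x
  proof -
    have A: "A y \<noteq> 0" if "y \<in> S" for y
      using \<epsilon>(2)[OF S(3)[OF that]] by (auto simp: F_def A_alt)
    have "4 * (p x)\<^sup>2 * A x * A x = (h x)\<^sup>2 * F (h x)"
      using first_integrals(3)[OF S(1,2) A S(4,5)] by (simp add: F_def A_alt)
    moreover have "4 * (p x)\<^sup>2 * A x * A x \<ge> 0"
      by (simp add: mult.assoc)
    moreover have "F (h x) < 0" using \<epsilon>(2) S(3,5) by blast
    ultimately show "h x = 0" by (smt (verit) mult_pos_neg zero_less_power2)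
  qed
  obtain R where R: "\<And>x. \<bar>x\<bar> \<ge> R \<Longrightarrow> \<bar>h x\<bar> < \<epsilon>" using h_decay[OF \<epsilon>(1)] by blast
  \<comment> \<open>Since \<open>A\<close> might vanish where \<open>h\<close> is large, the
    argument starts at infinity. To the right of the last point of \<open>Z\<close> it gives
    \<open>h = 0\<close>, and by continuity \<open>h = 0\<close> at that point too, which
    contradicts membership in \<open>Z\<close>.\<close>
  define Z where "Z = {z. \<epsilon> \<le> \<bar>h z\<bar>}"
  have Z_bdd: "z \<le> \<bar>R\<bar>" if "z \<in> Z" for z
    using R[of z] that unfolding Z_def by (smt (verit) mem_Collect_eq)
  show ?thesis
  proof (cases "Z = {}")
    case True
    then show ?thesis
      using zero[of UNIV R x] by (auto simp: Z_def not_le)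
  next
    case False
    define b where "b = Sup Z"
    have "bdd_above Z" using Z_bdd by (intro bdd_aboveI)
    have "closed Z" unfolding Z_def by (intro closed_Collect_le continuous_intros h_cont)
    then have "b \<in> Z" unfolding b_def using False \<open>bdd_above Z\<close> by (intro closed_contains_Sup)
    have "h y = 0" if "y > b" for y
    proof (rule zero[of "{b<..}" "b + 1"])
      show "\<bar>h y\<bar> < \<epsilon>" if "y \<in> {b<..}" for y
        using cSup_upper[OF _ \<open>bdd_above Z\<close>, of y] that by (force simp: Z_def b_def)
    qed (use that in auto)
    then have "h b = 0"
      using continuous_constant_on_closure[of "{b<..}" h 0 b] continuous_on_subset[OF h_cont] by auto
    then show ?thesis using \<open>b \<in> Z\<close> \<epsilon>(1) by (simp add: Z_def)
  qed
qed

text \<open>With \<open>h = 0\<close> the coefficient \<open>A\<close> is the constant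
  \<open>1 - 2 * \<kappa>\<close>; it is nonzero, so the energy integral holds on the whole line and
  gives \<open>V = 0\<close>.\<close>

lemma constant_if_eq_0:
  assumes "\<And>x. h x = 0" "\<kappa> \<noteq> 1 / 2"
  shows "U x = U 0" "norm (U x) = 1"
proof -
  have A: "A x \<noteq> 0" for x using assms by (simp add: A_alt)
  have "V x = 0" for x
  proof -
    have "(h has_real_derivative - 2 * p x) (at x)" by (rule h_deriv[of UNIV]) (use A in auto)
    moreover have "(h has_real_derivative 0) (at x)" unfolding assms(1)[abs_def] by simp
    ultimately have "p x = 0" using DERIV_unique by fastforce
    then show ?thesis using first_integrals(2)[of UNIV 0 x] A assms(1) by simp
  qed
  then have "(U has_vector_derivative 0) (at x)" for x
    using U_deriv[of UNIV x] A by simp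
  then show "U x = U 0"
    using has_vector_derivative_zero_constant[of UNIV U] by (metis UNIV_I convex_UNIV)
  have "(norm (U x))\<^sup>2 = 1" using norm_U assms(1) by simp
  then show "norm (U x) = 1" by (simp add: power2_eq_1_iff) (metis norm_ge_zero not_one_le_zero neg_0_le_iff_le)
qed

end

section \<open>Nonpositive \<kappa>: the equation is nondegenerate everywhere\<close>

locale nonpos_solution = regular_solution +
  assumes \<kappa>_nonpos: "\<kappa> \<le> 0"
begin

lemma A_ge_1: "A x \<ge> 1"
  using mult_nonneg_nonpos[of "1 - h x" \<kappa>] \<kappa>_nonpos h_le_1[of x] by (simp add: A_alt algebra_simps)

lemma A_neq_0: "A x \<noteq> 0"
  using A_ge_1[of x] by linarith

lemma U': "(U has_vector_derivative V x) (at x)"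
  using U_deriv[of UNIV x] A_neq_0 by simp

lemma h': "(h has_real_derivative - 2 * p x) (at x)"
  using h_deriv[of UNIV x] A_neq_0 by simp

lemma p_cont: "continuous_on UNIV p"
  unfolding p_def by (intro continuous_intros U_cont V_cont A_neq_0)

lemma integrals:
  "inner (\<i> * U x) (V x) = c * h x / 2"
  "(norm (V x))\<^sup>2 = 2 * \<kappa> * (p x)\<^sup>2 + (h x)\<^sup>2 / 2"
  "4 * (p x)\<^sup>2 * A x = (h x)\<^sup>2 * (2 - c\<^sup>2 - 2 * h x)"
  using first_integrals[of UNIV 0 x] A_neq_0 by auto

lemma critical_value: "p x = 0 \<Longrightarrow> h x \<noteq> 0 \<Longrightarrow> h x = 1 - c\<^sup>2 / 2"
  using integrals(3)[of x] by simp

lemma ex_max: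
  assumes "h a > 0"
  obtains b where "\<And>x. h x \<le> h b" "h b = 1 - c\<^sup>2 / 2" "p b = 0"
proof -
  obtain R where "\<And>x. \<bar>x\<bar> \<ge> R \<Longrightarrow> \<bar>h x\<bar> < h a" using h_decay[OF assms] by blast
  then obtain b where b: "\<And>x. h x \<le> h b"
    using ex_global_max[OF h_cont, of R a] by (metis abs_le_D1 abs_ge_self order_le_less_trans)
  have "p b = 0" using deriv_zero_at_max[OF h' b] by simp
  moreover have "h b \<noteq> 0" using b[of a] assms by simp
  ultimately show ?thesis using that b critical_value by blast
qed

text \<open>Its role is to be contradicted: for \<open>c\<^sup>2 \<le> 2\<close> the critical value
  \<open>1 - c\<^sup>2 / 2\<close> is nonnegative, so \<open>h\<close> takes no negative
  values.\<close>

lemma ex_min: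
  assumes "h a < 0"
  obtains b where "h b < 0" "h b = 1 - c\<^sup>2 / 2"
proof -
  obtain R where R: "\<And>x. \<bar>x\<bar> \<ge> R \<Longrightarrow> \<bar>h x\<bar> < - h a" using h_decay[of "- h a"] assms by auto
  have "- h x < - h a" if "\<bar>x\<bar> \<ge> R" for x using R[OF that] by linarith
  then obtain b where b: "\<And>x. - h x \<le> - h b"
    using ex_global_max[OF continuous_on_minus[OF h_cont], of R a] by blast
  have "p b = 0" using deriv_zero_at_max[OF DERIV_minus[OF h'] b] by simp
  moreover have "h b < 0" using b[of a] assms by simp
  ultimately show ?thesis using that critical_value by (metis less_irrefl)
qed

text \<open>At the sonic speed the critical value degenerates to 0, so neither a positive maximum
  nor a negative minimum is possible.\<close>

lemma eq_0_if_sonic: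
  assumes "c\<^sup>2 = 2"
  shows "h x = 0"
proof (rule ccontr)
  assume "h x \<noteq> 0"
  then consider "h x > 0" | "h x < 0" by linarith
  then show False
  proof cases
    case 1
    then show ?thesis using ex_max assms by (metis diff_self div_self not_le zero_neq_numeral)
  next
    case 2
    then show ?thesis using ex_min assms by (metis diff_self div_self less_irrefl zero_neq_numeral)
  qed
qed

text \<open>Solving the relation for \<open>q\<close> in \<open>V_deriv\<close>, possible as
  \<open>A\<close> never vanishes, displays the second derivative as a continuous function.\<close>

lemma C_k_2_U: "C_k 2 U"
proof -
  define q where "q x = ((norm (V x))\<^sup>2 + c * inner (\<i> * U x) (V x) - h x * (1 - h x)) / A x" for x
  define W where "W x = (2 * \<kappa> * q x - h x) *\<^sub>R U x - \<i> * complex_of_real c * V x" for x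
  have Vc: "continuous_on UNIV V" by (intro V_cont A_neq_0)
  have "continuous_on UNIV W"
    unfolding W_def q_def by (intro continuous_intros Vc U_cont h_cont A_cont) (use A_neq_0 in auto)
  moreover have "(V has_vector_derivative W x) (at x)" for x
  proof -
    obtain W' q' where "(V has_vector_derivative W') (at x)"
      "W' = (2 * \<kappa> * q' - h x) *\<^sub>R U x - \<i> * complex_of_real c * V x"
      "q' * A x = (norm (V x))\<^sup>2 + c * inner (\<i> * U x) (V x) - h x * (1 - h x)"
      using V_deriv[of UNIV x] A_neq_0 by blast
    moreover from this(3) have "q' = q x" using A_neq_0[of x] by (simp add: q_def field_simps)
    ultimately show ?thesis by (simp add: W_def)
  qed
  ultimately have "C_k (Suc (Suc 0)) U"
    by (intro C_k_SucI[OF U'] C_k_SucI[of V W]) auto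
  then show ?thesis by (simp add: numeral_2_eq_2)
qed

end

section \<open>Shape of a nontrivial profile\<close>

locale dark_solution = nonpos_solution + dark_parameters +
  assumes nontrivial: "\<exists>x. h x \<noteq> 0"
begin

lemma h_nonneg: "h x \<ge> 0"
proof (rule ccontr)
  assume "\<not> h x \<ge> 0"
  then obtain b where "h b < 0" "h b = m" using ex_min[of x] by (auto simp: m_def not_le)
  then show False using m_bounds by simp
qed

definition x0 :: real where "x0 = (SOME b. (\<forall>x. h x \<le> h b) \<and> h b = m)"

lemma x0: "h x \<le> m" "h x0 = m" "p x0 = 0"
proof -
  obtain a where "h a > 0" using nontrivial h_nonneg by (metis order_less_le)
  then have "\<exists>b. (\<forall>x. h x \<le> h b) \<and> h b = m" using ex_max[of a] by (metis m_def)
  from someI_ex[OF this] have *: "\<forall>x. h x \<le> h x0" "h x0 = m" by (auto simp: x0_def)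
  then show "h x \<le> m" "h x0 = m" by auto
  show "p x0 = 0" using deriv_zero_at_max[OF h', of x0] * by simp
qed

text \<open>Crude but linear in \<open>h\<close>: it yields a differential inequality under which
  \<open>h\<close> cannot reach 0 within a finite distance.\<close>

lemma p_bound: "\<bar>p x\<bar> \<le> h x"
proof -
  have "4 * (p x)\<^sup>2 \<le> 4 * (p x)\<^sup>2 * A x"
    using mult_left_mono[OF A_ge_1[of x], of "4 * (p x)\<^sup>2"] by simp
  also have "\<dots> \<le> (h x)\<^sup>2 * 4"
  proof -
    have "2 - c\<^sup>2 - 2 * h x \<le> 4" using h_nonneg[of x] params(1) by (smt (verit) zero_le_power2)
    then show ?thesis unfolding integrals(3) by (intro mult_left_mono) auto
  qed
  finally show ?thesis using h_nonneg[of x] by (simp add: abs_le_square_iff[symmetric] power2_le_iff_abs_le)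
qed

text \<open>Since \<open>|\<eta>'| \<le> 2\<eta>\<close>, the functions \<open>\<eta> e\<^sup>\<plusminus>\<^sup>2\<^sup>x\<close> are monotone, so positivity propagates from the maximum.\<close>

lemma h_pos: "h x > 0"
proof (cases "x0 \<le> x")
  case True
  have "h x0 * exp (2 * x0) \<le> h x * exp (2 * x)"
  proof (rule DERIV_nonneg_imp_nondecreasing[OF True])
    fix y
    have "((\<lambda>x. h x * exp (2 * x)) has_real_derivative (- 2 * p y + 2 * h y) * exp (2 * y)) (at y)"
      by (auto intro!: derivative_eq_intros h' simp: algebra_simps)
    moreover have "(- 2 * p y + 2 * h y) * exp (2 * y) \<ge> 0"
      using p_bound[of y] by (intro mult_nonneg_nonneg) auto
    ultimately show "\<exists>z. ((\<lambda>x. h x * exp (2 * x)) has_real_derivative z) (at y) \<and> 0 \<le> z" by blast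
  qed
  moreover have "h x0 * exp (2 * x0) > 0" using x0 m_bounds by simp
  ultimately show ?thesis by (metis exp_gt_zero order_less_le_trans zero_less_mult_pos2)
next
  case False
  then have "x \<le> x0" by simp
  have "h x * exp (- 2 * x) \<ge> h x0 * exp (- 2 * x0)"
  proof (rule DERIV_nonpos_imp_nonincreasing[OF \<open>x \<le> x0\<close>])
    fix y
    have "((\<lambda>x. h x * exp (- 2 * x)) has_real_derivative (- 2 * p y - 2 * h y) * exp (- 2 * y)) (at y)"
      by (auto intro!: derivative_eq_intros h' simp: algebra_simps)
    moreover have "(- 2 * p y - 2 * h y) * exp (- 2 * y) \<le> 0"
      using p_bound[of y] by (intro mult_nonpos_nonneg) auto
    ultimately show "\<exists>z. ((\<lambda>x. h x * exp (- 2 * x)) has_real_derivative z) (at y) \<and> z \<le> 0" by blast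
  qed
  moreover have "h x0 * exp (- 2 * x0) > 0" using x0 m_bounds by simp
  ultimately show ?thesis by (metis exp_gt_zero order_less_le_trans zero_less_mult_pos2)
qed

lemma p_eq_0_iff: "p x = 0 \<longleftrightarrow> h x = m"
proof
  show "h x = m" if "p x = 0"
    using critical_value[OF that] h_pos[of x] by (simp add: m_def)
  show "p x = 0" if "h x = m"
    using integrals(3)[of x] A_neq_0[of x] that by (simp add: c_sq)
qed

text \<open>Excludes plateaus at height \<open>m\<close>, which the first-order equation would
  allow. At a critical point the momentum term cancels \<open>h * (1 - h)\<close>, since
  \<open>c\<^sup>2 / 2 = 1 - m\<close>, and the energy integral leaves
  \<open>q * A = m\<^sup>2 / 2\<close>.\<close>

lemma p_increasing_at_zero:
  assumes "p x = 0"
  obtains q where "(p has_real_derivative q) (at x)" "q > 0"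
proof -
  obtain q where q: "(p has_real_derivative q) (at x)"
    "q * A x = (norm (V x))\<^sup>2 + c * inner (\<i> * U x) (V x) - h x * (1 - h x)"
    using V_deriv[of UNIV x] A_neq_0 by blast
  have "h x = m" using assms p_eq_0_iff by simp
  have "c * (c * m / 2) = (1 - m) * m" using c_sq by (simp add: power2_eq_square)
  then have "q * A x = m\<^sup>2 / 2"
    unfolding q(2) integrals assms \<open>h x = m\<close> by (simp add: algebra_simps)
  then have "q * A x > 0" using zero_less_power[OF m_bounds(1), of 2] by linarith
  then have "q > 0" using A_ge_1[of x] by (simp add: zero_less_mult_iff)
  then show ?thesis using that q(1) by blast
qed

text \<open>Just to the right of a zero \<open>p\<close> is positive, so \<open>h\<close> falls
  below \<open>m\<close>. Between two zeros the minimum of \<open>h\<close> would then be interior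
  and below \<open>m\<close>, yet critical points have height \<open>m\<close>.\<close>

lemma p_zero_unique:
  assumes "p a = 0" "p b = 0"
  shows "a = b"
proof -
  have False if "a < b" "p a = 0" "p b = 0" for a b
  proof -
    obtain q where "(p has_real_derivative q) (at a)" "q > 0" using p_increasing_at_zero[OF \<open>p a = 0\<close>] by blast
    then obtain d where d: "d > 0" "\<forall>t>0. t < d \<longrightarrow> p a < p (a + t)" using DERIV_pos_inc_right by blast
    define t where "t = a + min d (b - a) / 2"
    have t: "a < t" "t < b" "p t > 0"
      using d(2)[rule_format, of "min d (b - a) / 2"] d(1) that by (auto simp: t_def min_def field_simps)
    have "\<exists>z\<in>{a..b}. \<forall>y\<in>{a..b}. h z \<le> h y"
      by (rule continuous_attains_inf) (use that continuous_on_subset[OF h_cont] in auto)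
    then obtain z where z: "z \<in> {a..b}" "\<forall>y\<in>{a..b}. h z \<le> h y" by blast
    have "h t < m" using x0(1)[of t] p_eq_0_iff[of t] t(3) by simp
    moreover have "h z \<le> h t" using z(2) t by simp
    ultimately have "h z < m" by linarith
    have "z \<noteq> a" "z \<noteq> b" using \<open>h z < m\<close> that p_eq_0_iff by auto
    then have "a < z" "z < b" using z(1) by auto
    have "- 2 * p z = 0"
    proof (rule DERIV_local_min[OF h'])
      show "0 < min (z - a) (b - z)" using \<open>a < z\<close> \<open>z < b\<close> by simp
      show "\<forall>y. \<bar>z - y\<bar> < min (z - a) (b - z) \<longrightarrow> h z \<le> h y"
      proof (intro allI impI)
        fix y assume "\<bar>z - y\<bar> < min (z - a) (b - z)"
        then have "y \<in> {a..b}" by (auto simp: abs_less_iff)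
        then show "h z \<le> h y" using z(2) by blast
      qed
    qed
    then show False using p_eq_0_iff[of z] \<open>h z < m\<close> by simp
  qed
  then show ?thesis using assms by (metis linorder_less_linear)
qed

lemma h_less_m: "x \<noteq> x0 \<Longrightarrow> h x < m"
  using x0(1)[of x] p_eq_0_iff[of x] p_zero_unique[of x x0] x0(3) by force

lemma p_pos:
  assumes "x > x0"
  shows "p x > 0"
proof (rule ccontr)
  assume "\<not> p x > 0"
  obtain q where "(p has_real_derivative q) (at x0)" "q > 0" using p_increasing_at_zero[OF x0(3)] by blast
  then obtain d where d: "d > 0" "\<forall>t>0. t < d \<longrightarrow> p x0 < p (x0 + t)" using DERIV_pos_inc_right by blast
  define t where "t = x0 + min d (x - x0) / 2"
  have t: "x0 < t" "t < x" "p t > 0"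
    using d(2)[rule_format, of "min d (x - x0) / 2"] d(1) assms x0(3) by (auto simp: t_def min_def field_simps)
  then obtain z where "t \<le> z" "z \<le> x" "p z = 0"
    using IVT2'[of p x 0 t] continuous_on_subset[OF p_cont] \<open>\<not> p x > 0\<close> by auto
  then show False using p_zero_unique[of z x0] x0(3) t by simp
qed

lemma p_neg:
  assumes "x < x0"
  shows "p x < 0"
proof (rule ccontr)
  assume "\<not> p x < 0"
  obtain q where "(p has_real_derivative q) (at x0)" "q > 0" using p_increasing_at_zero[OF x0(3)] by blast
  then obtain d where d: "d > 0" "\<forall>t>0. t < d \<longrightarrow> p (x0 - t) < p x0" using DERIV_pos_inc_left by blast
  define t where "t = x0 - min d (x0 - x) / 2"
  have t: "x < t" "t < x0" "p t < 0"
    using d(2)[rule_format, of "min d (x0 - x) / 2"] d(1) assms x0(3) by (auto simp: t_def min_def field_simps)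
  then obtain z where "x \<le> z" "z \<le> t" "p z = 0"
    using IVT2'[of p t 0 x] continuous_on_subset[OF p_cont] \<open>\<not> p x < 0\<close> by auto
  then show False using p_zero_unique[of z x0] x0(3) t by simp
qed

lemma abs_p: "2 * \<bar>p x\<bar> = h x * \<sigma> (h x)"
proof -
  have "(2 * \<bar>p x\<bar>)\<^sup>2 = (h x)\<^sup>2 * ((2 - c\<^sup>2 - 2 * h x) / A x)"
    using integrals(3)[of x] A_neq_0[of x] by (simp add: field_simps power2_eq_square)
  also have "\<dots> = (h x * \<sigma> (h x))\<^sup>2"
    using A_ge_1[of x] x0(1)[of x] by (simp add: power_mult_distrib \<sigma>_def c_sq flip: A_alt)
  finally show ?thesis
  proof (rule power2_eq_imp_eq)
    show "h x * \<sigma> (h x) \<ge> 0"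
      using h_nonneg A_ge_1[of x] x0(1)[of x] by (simp add: \<sigma>_def c_sq flip: A_alt)
  qed simp
qed

text \<open>The sign of \<open>p\<close> on either side of \<open>x0\<close> selects the branch of
  the square root in \<open>abs_p\<close>; the left half is reflected onto positive times.\<close>

lemma G_h: "G c \<kappa> (h (x0 + x)) = \<bar>x\<bar>"
proof (cases "x \<ge> 0")
  case True
  have "G c \<kappa> (h (x0 + x)) = x"
  proof (rule G_profile[where f = "\<lambda>t. h (x0 + t)"])
    show "continuous_on {0..} (\<lambda>t. h (x0 + t))"
      by (intro continuous_on_compose2[OF h_cont] continuous_intros) auto
    show "0 < h (x0 + t) \<and> h (x0 + t) < m" if "t > 0" for t
      using h_pos h_less_m[of "x0 + t"] that by simp
    show "((\<lambda>t. h (x0 + t)) has_real_derivative - h (x0 + t) * \<sigma> (h (x0 + t))) (at t)" if "t > 0" for t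
    proof -
      have "((\<lambda>t. h (x0 + t)) has_real_derivative - 2 * p (x0 + t) * (0 + 1)) (at t)"
        by (intro DERIV_chain2[OF h'] DERIV_add DERIV_const DERIV_ident)
      moreover have "- 2 * p (x0 + t) * (0 + 1) = - h (x0 + t) * \<sigma> (h (x0 + t))"
        using abs_p[of "x0 + t"] p_pos[of "x0 + t"] that by simp
      ultimately show ?thesis by (simp only:)
    qed
  qed (use True x0 in auto)
  with True show ?thesis by simp
next
  case False
  have "G c \<kappa> (h (x0 - (- x))) = - x"
  proof (rule G_profile[where f = "\<lambda>t. h (x0 - t)"])
    show "continuous_on {0..} (\<lambda>t. h (x0 - t))"
      by (intro continuous_on_compose2[OF h_cont] continuous_intros) auto
    show "0 < h (x0 - t) \<and> h (x0 - t) < m" if "t > 0" for t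
      using h_pos h_less_m[of "x0 - t"] that by simp
    show "((\<lambda>t. h (x0 - t)) has_real_derivative - h (x0 - t) * \<sigma> (h (x0 - t))) (at t)" if "t > 0" for t
    proof -
      have "((\<lambda>t. h (x0 - t)) has_real_derivative - 2 * p (x0 - t) * (0 - 1)) (at t)"
        by (intro DERIV_chain2[OF h'] DERIV_diff DERIV_const DERIV_ident)
      moreover have "- 2 * p (x0 - t) * (0 - 1) = - h (x0 - t) * \<sigma> (h (x0 - t))"
        using abs_p[of "x0 - t"] p_neg[of "x0 - t"] that by simp
      ultimately show ?thesis by (simp only:)
    qed
  qed (use False x0 in auto)
  with False show ?thesis by simp
qed

text \<open>The solution itself supplies a preimage of \<open>\<bar>x\<bar>\<close> under
  \<open>G\<close>, and injectivity identifies it with the chosen inverse.\<close>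

lemma eta_eq: "eta c \<kappa> x = h (x0 + x)"
  unfolding eta_def
proof (rule inv_into_f_eq)
  show "inj_on (G c \<kappa>) {0<..1 - c\<^sup>2 / 2}" using inj_G by (simp add: m_def)
  show "h (x0 + x) \<in> {0<..1 - c\<^sup>2 / 2}" using h_pos x0(1) by (simp add: m_def)
qed (rule G_h)

section \<open>Reconstruction of the phase\<close>

lemma V_identity: "(1 - h x) *\<^sub>R V x = (complex_of_real (p x) + \<i> * complex_of_real (c * h x / 2)) * U x"
proof -
  \<comment> \<open>Expansion of \<open>V\<close> in the orthogonal directions \<open>U\<close> and
    \<open>\<i> * U\<close>. The factor \<open>(norm (U x))\<^sup>2\<close> is kept on the left so
    that the identity also holds at a zero of \<open>U\<close>.\<close>
  have "(norm (U x))\<^sup>2 *\<^sub>R V x = (complex_of_real (p x) + \<i> * complex_of_real (inner (\<i> * U x) (V x))) * U x"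
    by (simp add: complex_eq_iff p_def inner_complex_def cmod_power2) (simp add: power2_eq_square algebra_simps)
  then show ?thesis by (simp only: norm_U integrals)
qed

text \<open>Both \<open>u\<close> and \<open>\<surd>(1 - \<eta>) e\<^sup>i\<^sup>\<Theta>\<close> have logarithmic derivative \<open>(\<langle>u, u'\<rangle> + i c\<eta>/2)/(1 - \<eta>)\<close>
  when \<open>\<Theta>' = c\<eta>/(2(1 - \<eta>))\<close>.\<close>

lemma polar_constant:
  assumes S: "open S" "convex S" "\<And>x. x \<in> S \<Longrightarrow> h x < 1"
    and \<Theta>: "\<And>x. x \<in> S \<Longrightarrow> (\<Theta> has_real_derivative c * h x / (2 * (1 - h x))) (at x)"
  obtains N where "\<And>x. x \<in> S \<Longrightarrow> U x = complex_of_real (sqrt (1 - h x)) * exp (\<i> * complex_of_real (\<Theta> x)) * N"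
proof -
  define Q where "Q x = (1 / sqrt (1 - h x)) *\<^sub>R (exp (- \<i> * complex_of_real (\<Theta> x)) * U x)" for x
  have "(Q has_vector_derivative 0) (at x)" if x: "x \<in> S" for x
  proof -
    let ?e = "exp (- \<i> * complex_of_real (\<Theta> x))"
    define \<rho> where "\<rho> = sqrt (1 - h x)"
    have \<rho>: "\<rho> > 0" "\<rho>\<^sup>2 = 1 - h x" using S(3)[OF x] by (auto simp: \<rho>_def)
    have "((\<lambda>x. 1 - h x) has_real_derivative 2 * p x) (at x)"
      by (auto intro!: derivative_eq_intros h')
    then have "((\<lambda>x. sqrt (1 - h x)) has_real_derivative inverse (sqrt (1 - h x)) / 2 * (2 * p x)) (at x)"
      by (intro DERIV_chain2[where f = sqrt and g = "\<lambda>x. 1 - h x", OF DERIV_real_sqrt]) (use S(3)[OF x] in auto)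
    then have "((\<lambda>x. 1 / sqrt (1 - h x)) has_real_derivative - (inverse \<rho> / 2 * (2 * p x)) / (\<rho> * \<rho>)) (at x)"
      using DERIV_divide[OF DERIV_const[of 1], of "\<lambda>x. sqrt (1 - h x)" _ x] \<rho>(1) by (simp add: \<rho>_def)
    moreover have "- (inverse \<rho> / 2 * (2 * p x)) / (\<rho> * \<rho>) = - (p x / \<rho> ^ 3)"
      using \<rho>(1) by (simp add: field_simps power3_eq_cube)
    ultimately have d\<rho>: "((\<lambda>x. 1 / sqrt (1 - h x)) has_real_derivative - (p x / \<rho> ^ 3)) (at x)"
      by simp
    define \<theta>' where "\<theta>' = c * h x / (2 * (1 - h x))"
    have d\<Theta>: "((\<lambda>x. complex_of_real (\<Theta> x)) has_vector_derivative complex_of_real \<theta>') (at x)"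
      using \<Theta>[OF x] unfolding \<theta>'_def
      by (intro has_vector_derivative_of_real) (simp add: has_real_derivative_iff_has_vector_derivative)
    have "((\<lambda>x. exp (- \<i> * complex_of_real (\<Theta> x))) has_vector_derivative (- \<i> * complex_of_real \<theta>') * ?e) (at x)"
    proof -
      have "((\<lambda>x. - \<i> * complex_of_real (\<Theta> x)) has_vector_derivative - \<i> * complex_of_real \<theta>') (at x)"
        by (rule bounded_linear.has_vector_derivative[OF bounded_linear_mult_right d\<Theta>])
      from field_vector_diff_chain_at[OF this DERIV_exp] show ?thesis by (simp add: o_def)
    qed
    then have de: "((\<lambda>x. exp (- \<i> * complex_of_real (\<Theta> x)) * U x) has_vector_derivative
        ?e * V x + (- \<i> * complex_of_real \<theta>') * ?e * U x) (at x)"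
      by (rule has_vector_derivative_mult[OF _ U'])
    have "(Q has_vector_derivative (1 / \<rho>) *\<^sub>R (?e * V x + (- \<i> * complex_of_real \<theta>') * ?e * U x)
        + (- (p x / \<rho> ^ 3)) *\<^sub>R (?e * U x)) (at x)"
      unfolding Q_def[abs_def] using has_vector_derivative_scaleR[OF d\<rho> de] by (simp add: \<rho>_def)
    moreover have "(1 / \<rho>) *\<^sub>R (?e * V x + (- \<i> * complex_of_real \<theta>') * ?e * U x) + (- (p x / \<rho> ^ 3)) *\<^sub>R (?e * U x) = 0"
    proof -
      have \<theta>': "\<theta>' * \<rho>\<^sup>2 = c * h x / 2"
      proof -
        have "c * h x / (2 * t) * t = c * h x / 2" if "t \<noteq> 0" for t using that by simp
        then show ?thesis unfolding \<theta>'_def \<rho>(2) using S(3)[OF x] by (metis diff_gt_0_iff_gt less_irrefl)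
      qed
      \<comment> \<open>The factor \<open>\<rho> ^ 3\<close> clears the denominators and leaves
        \<open>\<rho>\<^sup>2 *\<^sub>R V x\<close>, to which \<open>V_identity\<close>
        applies.\<close>
      have "\<rho> ^ 3 *\<^sub>R ((1 / \<rho>) *\<^sub>R (?e * V x + (- \<i> * complex_of_real \<theta>') * ?e * U x) + (- (p x / \<rho> ^ 3)) *\<^sub>R (?e * U x))
        = \<rho>\<^sup>2 *\<^sub>R (?e * V x + (- \<i> * complex_of_real \<theta>') * ?e * U x) - p x *\<^sub>R (?e * U x)"
        using \<rho>(1) by (simp add: scaleR_add_right scaleR_diff_right power3_eq_cube power2_eq_square)
      also have "\<dots> = ?e * (\<rho>\<^sup>2 *\<^sub>R V x - \<i> * complex_of_real (\<theta>' * \<rho>\<^sup>2) * U x - complex_of_real (p x) * U x)"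
        by (simp add: scaleR_conv_of_real algebra_simps)
      also have "\<dots> = 0"
        unfolding \<theta>' unfolding \<rho>(2) V_identity by (simp add: algebra_simps)
      finally show ?thesis using \<rho>(1) by simp
    qed
    ultimately show ?thesis by simp
  qed
  then have "\<And>x. x \<in> S \<Longrightarrow> (Q has_vector_derivative 0) (at x within S)"
    by (simp add: has_vector_derivative_at_within)
  from has_vector_derivative_zero_constant[OF S(2) this]
  obtain N where N: "\<And>x. x \<in> S \<Longrightarrow> Q x = N" by metis
  have "U x = complex_of_real (sqrt (1 - h x)) * exp (\<i> * complex_of_real (\<Theta> x)) * N" if x: "x \<in> S" for x
  proof -
    have "complex_of_real (sqrt (1 - h x)) \<noteq> 0" using S(3)[OF x] by simp
    then show ?thesis
      unfolding N[OF x, symmetric] Q_def by (simp add: scaleR_conv_of_real exp_minus field_simps)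
  qed
  then show ?thesis by (rule that)
qed

lemma polar_norm:
  assumes "h x < 1" "U x = complex_of_real (sqrt (1 - h x)) * exp (\<i> * complex_of_real t) * N"
  shows "norm N = 1"
proof -
  have "norm (U x) = sqrt (1 - h x) * norm N"
    using assms by (simp add: norm_mult)
  moreover have "norm (U x) = sqrt (1 - h x)"
    using norm_U[of x] by (metis norm_ge_zero real_sqrt_unique)
  ultimately show ?thesis using assms(1) by simp
qed

lemma unit_eq_exp: "norm N = 1 \<Longrightarrow> \<exists>\<alpha>::real. N = exp (\<i> * complex_of_real \<alpha>)"
  using complex_norm_eq_1_exp[of N] by metis

lemma theta_deriv:
  assumes "c > 0"
  shows "((\<lambda>x. theta c \<kappa> (x - x0)) has_real_derivative c * h x / (2 * (1 - h x))) (at x)"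
proof -
  have "m < 1" using assms by (simp add: m_def)
  then have lt: "h y < 1" for y using x0(1)[of y] by linarith
  define f where "f y = h (x0 + y) / (1 - h (x0 + y))" for y
  have f: "continuous_on S f" for S
  proof -
    have "continuous_on S (\<lambda>y. h (x0 + y))"
      by (intro continuous_on_compose2[OF h_cont] continuous_intros) auto
    then show ?thesis unfolding f_def using lt by (intro continuous_intros) (auto simp: less_imp_neq)
  qed
  let ?y = "x - x0"
  \<comment> \<open>The margin 1 puts both 0 and \<open>?y\<close> in the interior of the interval,
    so the derivative within it is a derivative at \<open>?y\<close>.\<close>
  have "((\<lambda>u. LBINT y=ereal 0..ereal u. f y) has_vector_derivative f ?y) (at ?y within {- \<bar>?y\<bar> - 1..\<bar>?y\<bar> + 1})"
    using interval_integral_FTC2[of "- \<bar>?y\<bar> - 1" 0 "\<bar>?y\<bar> + 1" f ?y] f by (simp add: zero_ereal_def)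
  then have "((\<lambda>u. LBINT y=ereal 0..ereal u. f y) has_real_derivative f ?y) (at ?y)"
    by (simp add: at_within_Icc_at has_real_derivative_iff_has_vector_derivative)
  then have "(theta c \<kappa> has_real_derivative c / 2 * f ?y) (at ?y)"
    unfolding theta_def[abs_def] eta_eq f_def[abs_def] by (rule DERIV_cmult)
  then have "((\<lambda>x. theta c \<kappa> (x - x0)) has_real_derivative c / 2 * f ?y * (1 - 0)) (at x)"
    by (rule DERIV_chain2) (intro DERIV_diff DERIV_ident DERIV_const)
  then show ?thesis by (simp add: f_def)
qed

lemma moving_soliton:
  assumes "c > 0"
  shows "\<exists>\<alpha>::real. \<forall>x. U x = exp (\<i> * complex_of_real \<alpha>) * dark_soliton c \<kappa> (x - x0)"
proof -
  have "m < 1" using assms by (simp add: m_def)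
  then have lt: "h y < 1" for y using x0(1)[of y] by linarith
  obtain N where N: "\<And>x. U x = complex_of_real (sqrt (1 - h x)) * exp (\<i> * complex_of_real (theta c \<kappa> (x - x0))) * N"
    using polar_constant[of UNIV "\<lambda>x. theta c \<kappa> (x - x0)"] theta_deriv[OF assms] lt by auto
  then obtain \<alpha> :: real where "N = exp (\<i> * complex_of_real \<alpha>)"
    using unit_eq_exp polar_norm[OF lt N] by blast
  then show ?thesis using N assms by (auto simp: dark_soliton_def eta_eq intro!: exI[of _ \<alpha>])
qed

text \<open>The two half-line phases are opposite because \<open>u'\<close> is continuous and nonzero at the zero \<^term>\<open>x0\<close> of \<open>u\<close>.\<close>

lemma black_soliton:
  assumes "c = 0"
  shows "\<exists>\<alpha>::real. \<forall>x. U x = exp (\<i> * complex_of_real \<alpha>) * dark_soliton c \<kappa> (x - x0)"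
proof -
  have m: "m = 1" unfolding m_def using assms by simp
  have lt: "h y < 1" if "y \<noteq> x0" for y using h_less_m[OF that] m by simp
  have const: "((\<lambda>_. 0) has_real_derivative c * h x / (2 * (1 - h x))) (at x)" for x
    using assms by simp
  obtain N1 where "\<And>x. x \<in> {x0<..} \<Longrightarrow> U x = complex_of_real (sqrt (1 - h x)) * exp (\<i> * complex_of_real 0) * N1"
    using polar_constant[of "{x0<..}" "\<lambda>_. 0"] const lt by auto
  then have N1: "\<And>x. x > x0 \<Longrightarrow> U x = complex_of_real (sqrt (1 - h x)) * N1" by simp
  obtain N2 where "\<And>x. x \<in> {..<x0} \<Longrightarrow> U x = complex_of_real (sqrt (1 - h x)) * exp (\<i> * complex_of_real 0) * N2"
    using polar_constant[of "{..<x0}" "\<lambda>_. 0"] const lt by auto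
  then have N2: "\<And>x. x < x0 \<Longrightarrow> U x = complex_of_real (sqrt (1 - h x)) * N2" by simp
  have n1: "norm N1 = 1" using polar_norm[of "x0 + 1" 0 N1] N1[of "x0 + 1"] lt by simp
  have n2: "norm N2 = 1" using polar_norm[of "x0 - 1" 0 N2] N2[of "x0 - 1"] lt by simp
  have Vc: "continuous_on S V" for S by (intro V_cont A_neq_0)
  \<comment> \<open>On each side \<open>V\<close> is \<open>p / sqrt (1 - h)\<close> times the
    phase, and the sign of \<open>p\<close> turns this into \<open>V = norm V * N1\<close> on the
    right and \<open>V = - norm V * N2\<close> on the left. In this form the relations extend
    continuously to \<open>x0\<close>, where the quotient is 0/0.\<close>
  have cont1: "continuous_on S (\<lambda>x. V x - complex_of_real (norm (V x)) * N1)"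
    and cont2: "continuous_on S (\<lambda>x. V x + complex_of_real (norm (V x)) * N2)" for S
    by (intro continuous_intros Vc)+
  have V_eq: "V x = complex_of_real (p x / sqrt (1 - h x)) * N"
    if "x \<noteq> x0" "U x = complex_of_real (sqrt (1 - h x)) * N" for x N
  proof -
    have pos: "1 - h x > 0" using lt[OF that(1)] by simp
    have sq: "complex_of_real (1 - h x) = complex_of_real (sqrt (1 - h x)) * complex_of_real (sqrt (1 - h x))"
      using pos by (simp flip: of_real_mult)
    have "complex_of_real (1 - h x) * V x = complex_of_real (p x) * (complex_of_real (sqrt (1 - h x)) * N)"
      using V_identity[of x] assms that(2) by (simp add: scaleR_conv_of_real)
    then have "complex_of_real (sqrt (1 - h x)) * (complex_of_real (sqrt (1 - h x)) * V x) = complex_of_real (sqrt (1 - h x)) * (complex_of_real (p x) * N)"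
      unfolding sq by (simp add: mult_ac)
    then show ?thesis using pos by (simp add: field_simps)
  qed
  have "V x - complex_of_real (norm (V x)) * N1 = 0" if "x > x0" for x
  proof -
    have eq: "V x = complex_of_real (p x / sqrt (1 - h x)) * N1" using V_eq N1 that by simp
    have "p x / sqrt (1 - h x) \<ge> 0" using p_pos[OF that] lt[of x] that by simp
    then have "norm (V x) = p x / sqrt (1 - h x)" unfolding eq norm_mult n1 norm_of_real by linarith
    then show ?thesis using eq by simp
  qed
  then have right: "V x0 - complex_of_real (norm (V x0)) * N1 = 0"
    using continuous_constant_on_closure[of "{x0<..}" "\<lambda>x. V x - complex_of_real (norm (V x)) * N1" 0 x0]
    by (simp add: cont1)
  have "V x + complex_of_real (norm (V x)) * N2 = 0" if "x < x0" for x
  proof -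
    have eq: "V x = complex_of_real (p x / sqrt (1 - h x)) * N2" using V_eq N2 that by simp
    have "p x / sqrt (1 - h x) \<le> 0" using p_neg[OF that] lt[of x] that by (simp add: divide_nonpos_nonneg)
    then have "norm (V x) = - (p x / sqrt (1 - h x))" unfolding eq norm_mult n2 norm_of_real by linarith
    then show ?thesis using eq by simp
  qed
  then have left: "V x0 + complex_of_real (norm (V x0)) * N2 = 0"
    using continuous_constant_on_closure[of "{..<x0}" "\<lambda>x. V x + complex_of_real (norm (V x)) * N2" 0 x0]
    by (simp add: cont2)
  \<comment> \<open>At \<open>x0\<close>, where \<open>p = 0\<close> and \<open>h = 1\<close>, the
    energy integral gives \<open>(norm (V x0))\<^sup>2 = 1 / 2\<close>.\<close>
  have "norm (V x0) \<noteq> 0"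
    using integrals(2)[of x0] x0(2,3) m by auto
  moreover have "complex_of_real (norm (V x0)) * (N1 + N2) = 0"
  proof -
    have "complex_of_real (norm (V x0)) * (N1 + N2)
      = (V x0 + complex_of_real (norm (V x0)) * N2) - (V x0 - complex_of_real (norm (V x0)) * N1)"
      by (simp add: algebra_simps)
    then show ?thesis unfolding left right by simp
  qed
  ultimately have "N1 + N2 = 0" by simp
  then have N21: "N2 = - N1" by (simp add: add_eq_0_iff)
  have U_x0: "U x0 = 0" using norm_U[of x0] x0(2) m by simp
  obtain \<alpha> :: real where \<alpha>: "N1 = exp (\<i> * complex_of_real \<alpha>)" using unit_eq_exp[OF n1] by blast
  have "U x = N1 * dark_soliton c \<kappa> (x - x0)" for x
  proof -
    consider "x > x0" | "x = x0" | "x < x0" by linarith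
    then show ?thesis
    proof cases
      case 1
      then show ?thesis using N1[OF 1] eta_eq[of "x - x0"] assms by (simp add: dark_soliton_def)
    next
      case 2
      then show ?thesis using U_x0 eta_eq[of 0] x0(2) m assms by (simp add: dark_soliton_def)
    next
      case 3
      then show ?thesis using N2[OF 3] N21 eta_eq[of "x - x0"] assms by (simp add: dark_soliton_def)
    qed
  qed
  then show ?thesis using \<alpha> by blast
qed

lemma soliton: "\<exists>\<alpha>::real. \<forall>x. U x = exp (\<i> * complex_of_real \<alpha>) * dark_soliton c \<kappa> (x - x0)"
  using moving_soliton black_soliton params(1) by (cases "c = 0") auto

end

section \<open>The classification by parameters\<close>

theorem theorem1p2:
  fixes c \<kappa> :: real and u :: "real \<Rightarrow> complex"
  assumes "c \<ge> 0"
    and "u \<in> energy_space"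
    and "weak_solution c \<kappa> u"
    and "(c, \<kappa>) \<notin> D_tilde \<union> C_crit"
  shows "((c, \<kappa>) \<in> D2 \<and>
           (\<exists>w. (AE x in lebesgue. u x = w x) \<and> C_k 2 w \<and>
             (\<exists>x\<^sub>0 \<alpha>::real. \<forall>x. w x = exp (\<i> * complex_of_real \<alpha>) * dark_soliton c \<kappa> (x - x\<^sub>0)))) \<or>
         (\<exists>a::complex. norm a = 1 \<and> (AE x in lebesgue. u x = a))"
proof -
  interpret weak_sol c \<kappa> u by standard (rule assms(3))
  obtain U M where U: "AE x in lebesgue. u x = U x" "\<And>x. U x = U 0 + primitive (weak_deriv u) x"
    and M: "continuous_on UNIV M"
    and reg: "\<And>S. open S \<Longrightarrow> (\<And>x. x \<in> S \<Longrightarrow> coeff_A \<kappa> (U x) \<noteq> 0) \<Longrightarrow>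
       (\<forall>x\<in>S. (U has_vector_derivative velocity \<kappa> (U x) (M x)) (at x) \<and>
              (M has_vector_derivative - force c \<kappa> (U x) (velocity \<kappa> (U x) (M x))) (at x)) \<and>
       (AE x in lebesgue. x \<in> S \<longrightarrow> weak_deriv u x = velocity \<kappa> (U x) (M x))"
    using ex_regular by blast
  have loc: "locally_integrable (weak_deriv u)" by (rule L2_imp_locally_integrable[OF weak_deriv_L2])
  have "continuous_on UNIV (\<lambda>x. U 0 + primitive (weak_deriv u) x)"
    by (intro continuous_intros continuous_primitive loc)
  then have U_cont: "continuous_on UNIV U" by (simp only: U(2)[symmetric])
  have eta_L2: "(\<lambda>x. 1 - (norm (U x))\<^sup>2) \<in> L2"
  proof -
    have "(\<lambda>x. 1 - (norm (u x))\<^sup>2) \<in> L2" using assms(2) by (simp add: energy_space_def)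
    then have u: "(\<lambda>x. 1 - (norm (u x))\<^sup>2) \<in> borel_measurable lebesgue"
      "integrable lebesgue (\<lambda>x. (norm (1 - (norm (u x))\<^sup>2))\<^sup>2)" by (auto simp: L2_def)
    have [measurable]: "(\<lambda>x. 1 - (norm (U x))\<^sup>2) \<in> borel_measurable lebesgue"
      by (intro continuous_borel_measurable_lebesgue continuous_intros U_cont)
    have "integrable lebesgue (\<lambda>x. (norm (1 - (norm (U x))\<^sup>2))\<^sup>2)"
    proof (rule integrable_cong_AE_imp[OF u(2)])
      show "AE x in lebesgue. (norm (1 - (norm (u x))\<^sup>2))\<^sup>2 = (norm (1 - (norm (U x))\<^sup>2))\<^sup>2"
        using U(1) by eventually_elim simp
    qed measurable
    then show ?thesis by (simp add: L2_def)
  qed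
  interpret regular_solution c \<kappa> U M "weak_deriv u"
    by standard (use weak_deriv_L2 eta_L2 U(2) M reg in blast)+
  have \<kappa>: "\<kappa> \<noteq> 1 / 2" using assms(1,4) by (auto simp: C_crit_def)
  have trivial: ?thesis if "\<And>x. h x = 0"
    using constant_if_eq_0[OF that \<kappa>] U(1) by (intro disjI2 exI[of _ "U 0"]) auto
  have sonic: "c < sqrt 2 \<longleftrightarrow> c\<^sup>2 < 2" "c = sqrt 2 \<longleftrightarrow> c\<^sup>2 = 2"
    using assms(1) real_sqrt_less_iff[of "c\<^sup>2" 2] real_sqrt_eq_iff[of "c\<^sup>2" 2] by auto
  \<comment> \<open>For \<kappa> > 0 the excluded sets leave only c above \<open>sqrt 2\<close> when
    \<kappa> < 1/2 and c below it when \<kappa> > 1/2, so the product is negative. For \<kappa>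
    \<le> 0 the sign of \<open>2 - c\<^sup>2\<close> separates the three cases.\<close>
  consider "(1 - 2 * \<kappa>) * (2 - c\<^sup>2) < 0" | "\<kappa> \<le> 0" "c\<^sup>2 = 2" | "(c, \<kappa>) \<in> D2"
  proof (cases "\<kappa> \<le> 0")
    case True
    then consider "c\<^sup>2 < 2" | "c\<^sup>2 = 2" | "c\<^sup>2 > 2" by linarith
    then show ?thesis
    proof cases
      case 1
      then show ?thesis using that(3) True assms(1) sonic by (simp add: D2_def)
    next
      case 3
      then show ?thesis using that(1) True by (simp add: mult_pos_neg)
    qed (use that True in auto)
  next
    case False
    show ?thesis
    proof (cases "\<kappa> < 1 / 2")
      case True
      have "\<not> c \<le> sqrt 2" using assms(1,4) False True by (auto simp: D_tilde_def D1_def B_minus_def)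
      then have "c\<^sup>2 > 2" using sonic by linarith
      then show ?thesis using that(1) True by (simp add: mult_pos_neg)
    next
      case ge: False
      have "\<not> c \<ge> sqrt 2" using assms(1,4) \<kappa> ge by (auto simp: D_tilde_def D3_def B_plus_def)
      then have "c\<^sup>2 < 2" using sonic by linarith
      then show ?thesis using that(1) \<kappa> ge by (simp add: mult_neg_pos)
    qed
  qed
  then show ?thesis
  proof cases
    case 1
    show ?thesis by (rule trivial) (rule eq_0_if_wrong_sign[OF 1])
  next
    case 2
    interpret nonpos_solution c \<kappa> U M "weak_deriv u" by standard (rule 2)
    show ?thesis by (rule trivial) (rule eq_0_if_sonic[OF 2(2)])
  next
    case 3
    show ?thesis
    proof (cases "\<exists>x. h x \<noteq> 0")
      case True
      have "\<kappa> \<le> 0" using 3 by (simp add: D2_def)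
      interpret dark_solution c \<kappa> U M "weak_deriv u"
        by standard (use 3 True \<open>\<kappa> \<le> 0\<close> in auto)
      show ?thesis using 3 U(1) C_k_2_U soliton by blast
    next
      case False
      then show ?thesis using trivial by blast
    qed
  qed
qed

end
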